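(* Let $1<p<\infty$, $\alpha\in\mathrm{M}^+(\Omega)$, $f\in L^p(\Omega)$, let $\beta:\Omega\to\mathbb{R}$ be a non-negative continuous and bounded function, and let $\Gamma\subset\partial\Omega$ (possibly empty). Then the problem $$\min_{\mu}\ \mathcal{J}(\mu):=\frac1p\int_\Omega|\mathrm{div}\,\mu(x)-f(x)|^p\,dx+\int_\Omega\beta(x)\,d|\mu|(x)\quad\text{subject to}\quad\mu\in\mathrm{M}^p_\Gamma(\Omega;\mathrm{div}),\ |\mu|\le\alpha,$$ admits solutions.
   Context: $\Omega$ is an open subset of $\mathbb{R}^N$. $\mathrm{M}(\Omega)$ and $\mathrm{M}(\Omega)^N$ are the spaces of (finite) real-valued, respectively $\mathbb{R}^N$-valued, Borel measures on $\Omega$; $\mathrm{M}^+(\Omega)\subset\mathrm{M}(\Omega)$ is the set of non-negative ones. $|\mu|$ is the total variation measure (Euclidean norm). $\mu\le\sigma$ means $\sigma-\mu\in\mathrm{M}^+(\Omega)$. For $\phi=(\phi_i)$, $\int_\Omega\phi\cdot d\mu=\sum_i\int_\Omega\phi_i\,d\mu_i$. $\mathrm{M}^p(\Omega;\mathrm{div})$ is the set of $\mu\in\mathrm{M}(\Omega)^N$ for which there is $h\in L^p(\Omega)$ with $\int_\Omega\nabla\phi\cdot d\mu=-\int_\Omega\phi h\,dx$ for all $\phi\in C_c^\infty(\Omega)$; then $\mathrm{div}\,\mu:=h$. $C_b^1(\Omega)$ is the space of bounded functions in $C^1(\Omega)$ with bounded partial derivatives, and $\mathbf{C}_b^1(\overline{\Omega})=C_b^1(\Omega)\cap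 C(\overline{\Omega})$ is the subspace of those that extend continuously to $\overline{\Omega}$. The normal trace is $\mathrm{N}(\phi,\mu)=\int_\Omega\nabla\phi\cdot d\mu+\int_\Omega\phi\,\mathrm{div}\,\mu\,dx$. For non-empty $\Gamma\subset\partial\Omega$, $\mathrm{M}^p_\Gamma(\Omega;\mathrm{div})$ is the set of $\mu\in\mathrm{M}^p(\Omega;\mathrm{div})$ with $\mathrm{N}(\phi,\mu)=0$ for all $\phi\in\mathbf{C}_b^1(\overline{\Omega})$ such that $\phi=0$ on $\overline{\partial\Omega\setminus\Gamma}$; for $\Gamma=\emptyset$, $\mathrm{M}^p_\Gamma(\Omega;\mathrm{div})=\mathrm{M}^p(\Omega;\mathrm{div})$.
   Formalization: When Ω has infinite Lebesgue measure and Γ is non-empty, N(φ,μ)=0 is required only for those φ for which φ div μ is integrable on Ω, since N(φ,μ) is otherwise undefined; for Ω of finite measure nothing changes. *)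

theory Defs
  imports "HOL-Analysis.Analysis"
begin

text \<open>The space \<open>\<real>\<^sup>N\<close> is rendered by a type \<open>'a :: euclidean_space\<close>, with \<open>N = DIM('a)\<close>.\<close>

abbreviation borel_on :: "'a::topological_space set \<Rightarrow> 'a measure"
  where "borel_on \<Omega> \<equiv> restrict_space borel \<Omega>"

text \<open>Signed and vector-valued measures are set functions. Values outside the sigma-algebra
  are set to 0, so that equality of set functions is equality of measures. Countable additivity
  gives \<open>\<mu> {} = 0\<close>: take all sets \<open>A n\<close> empty.\<close>

definition vector_measures :: "'a::topological_space set \<Rightarrow> ('a set \<Rightarrow> 'b::real_normed_vector) set"
  where "vector_measures \<Omega> = {\<mu>.
    (\<forall>A. A \<notin> sets (borel_on \<Omega>) \<longrightarrow> \<mu> A = 0) \<and>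
    (\<forall>A :: nat \<Rightarrow> 'a set. range A \<subseteq> sets (borel_on \<Omega>) \<longrightarrow> disjoint_family A \<longrightarrow>
        (\<lambda>n. \<mu> (A n)) sums \<mu> (\<Union>n. A n))}"

definition nonneg_measures :: "'a::topological_space set \<Rightarrow> 'a measure set"
  where "nonneg_measures \<Omega> = {\<alpha>. sets \<alpha> = sets (borel_on \<Omega>) \<and> finite_measure \<alpha>}"

definition total_variation ::
    "'a::topological_space set \<Rightarrow> ('a set \<Rightarrow> 'b::real_normed_vector) \<Rightarrow> 'a measure"
  where "total_variation \<Omega> \<mu> = measure_of \<Omega> (sets (borel_on \<Omega>))
    (\<lambda>A. SUP E \<in> {E :: nat \<Rightarrow> 'a set. range E \<subseteq> sets (borel_on \<Omega>) \<and> disjoint_family E \<and> (\<Union>n. E n) = A}.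
           (\<Sum>n. ennreal (norm (\<mu> (E n)))))"

text \<open>The order on non-negative measures: \<open>\<sigma> - \<mu>\<close> is non-negative.\<close>

definition measure_le_on :: "'a::topological_space set \<Rightarrow> 'a measure \<Rightarrow> 'a measure \<Rightarrow> bool"
  where "measure_le_on \<Omega> \<mu> \<sigma> \<longleftrightarrow> (\<forall>A \<in> sets (borel_on \<Omega>). emeasure \<mu> A \<le> emeasure \<sigma> A)"

text \<open>Positive part in the Jordan decomposition of a signed measure,
  \<open>\<nu>\<^sup>+(A) = sup {\<nu>(B) | B \<subseteq> A}\<close>; the negative part is the positive part of \<open>-\<nu>\<close>.
  The truncation of negative values by \<open>ennreal\<close> is harmless because \<open>B = {}\<close> is allowed.\<close>

definition pos_part :: "'a::topological_space set \<Rightarrow> ('a set \<Rightarrow> real) \<Rightarrow> 'a measure"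
  where "pos_part \<Omega> \<nu> = measure_of \<Omega> (sets (borel_on \<Omega>))
    (\<lambda>A. SUP B \<in> {B \<in> sets (borel_on \<Omega>). B \<subseteq> A}. ennreal (\<nu> B))"

definition signed_integral :: "'a::topological_space set \<Rightarrow> ('a set \<Rightarrow> real) \<Rightarrow> ('a \<Rightarrow> real) \<Rightarrow> real"
  where "signed_integral \<Omega> \<nu> g =
    integral\<^sup>L (pos_part \<Omega> \<nu>) g - integral\<^sup>L (pos_part \<Omega> (\<lambda>A. - \<nu> A)) g"

definition vector_integral ::
    "'a::euclidean_space set \<Rightarrow> ('a set \<Rightarrow> 'a) \<Rightarrow> ('a \<Rightarrow> 'a) \<Rightarrow> real"
  where "vector_integral \<Omega> \<mu> \<Phi> =
    (\<Sum>b\<in>Basis. signed_integral \<Omega> (\<lambda>A. \<mu> A \<bullet> b) (\<lambda>x. \<Phi> x \<bullet> b))"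

definition partial_deriv :: "('a::euclidean_space \<Rightarrow> real) \<Rightarrow> 'a \<Rightarrow> 'a \<Rightarrow> real"
  where "partial_deriv \<phi> b x = frechet_derivative \<phi> (at x) b"

definition grad :: "('a::euclidean_space \<Rightarrow> real) \<Rightarrow> 'a \<Rightarrow> 'a"
  where "grad \<phi> x = (\<Sum>b\<in>Basis. partial_deriv \<phi> b x *\<^sub>R b)"

text \<open>Meant for open \<open>\<Omega>\<close>; derivatives are full-neighbourhood and are junk where they do not exist.\<close>

primrec Ck_on :: "nat \<Rightarrow> 'a::euclidean_space set \<Rightarrow> ('a \<Rightarrow> real) \<Rightarrow> bool"
  where
    "Ck_on 0 \<Omega> \<phi> \<longleftrightarrow> continuous_on \<Omega> \<phi>"
  | "Ck_on (Suc k) \<Omega> \<phi> \<longleftrightarrow>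
       (\<forall>x\<in>\<Omega>. \<phi> differentiable (at x)) \<and> (\<forall>b\<in>Basis. Ck_on k \<Omega> (partial_deriv \<phi> b))"

text \<open>Elements of \<open>C\<^sub>c\<^sup>\<infinity>(\<Omega>)\<close> are extended by 0 to the whole space.\<close>

definition test_functions :: "'a::euclidean_space set \<Rightarrow> ('a \<Rightarrow> real) set"
  where "test_functions \<Omega> = {\<phi>. (\<forall>k. Ck_on k \<Omega> \<phi>) \<and>
    compact (closure {x. \<phi> x \<noteq> 0}) \<and> closure {x. \<phi> x \<noteq> 0} \<subseteq> \<Omega>}"

text \<open>Bounded \<open>C\<^sup>1\<close> functions on \<open>\<Omega>\<close> with bounded partial derivatives that extend
  continuously to the closure; an element is given together with its (unique) extension, and
  its values outside the closure are irrelevant.\<close>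

definition C1b_closure :: "'a::euclidean_space set \<Rightarrow> ('a \<Rightarrow> real) set"
  where "C1b_closure \<Omega> = {\<phi>. Ck_on 1 \<Omega> \<phi> \<and> bounded (\<phi> ` \<Omega>) \<and>
    (\<forall>b\<in>Basis. bounded (partial_deriv \<phi> b ` \<Omega>)) \<and> continuous_on (closure \<Omega>) \<phi>}"

text \<open>Functions, not classes modulo null sets.\<close>

definition Lp :: "real \<Rightarrow> 'a::euclidean_space set \<Rightarrow> ('a \<Rightarrow> real) set"
  where "Lp p \<Omega> = {h \<in> borel_measurable (lebesgue_on \<Omega>).
    integrable (lebesgue_on \<Omega>) (\<lambda>x. \<bar>h x\<bar> powr p)}"

definition has_divergence ::
    "real \<Rightarrow> 'a::euclidean_space set \<Rightarrow> ('a set \<Rightarrow> 'a) \<Rightarrow> ('a \<Rightarrow> real) \<Rightarrow> bool"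
  where "has_divergence p \<Omega> \<mu> h \<longleftrightarrow> h \<in> Lp p \<Omega> \<and>
    (\<forall>\<phi> \<in> test_functions \<Omega>.
        vector_integral \<Omega> \<mu> (grad \<phi>) = - integral\<^sup>L (lebesgue_on \<Omega>) (\<lambda>x. \<phi> x * h x))"

definition Mp_div :: "real \<Rightarrow> 'a::euclidean_space set \<Rightarrow> ('a set \<Rightarrow> 'a) set"
  where "Mp_div p \<Omega> = {\<mu> \<in> vector_measures \<Omega>. \<exists>h. has_divergence p \<Omega> \<mu> h}"

text \<open>A representative of the divergence, which is unique up to null sets.\<close>

definition divergence ::
    "real \<Rightarrow> 'a::euclidean_space set \<Rightarrow> ('a set \<Rightarrow> 'a) \<Rightarrow> 'a \<Rightarrow> real"
  where "divergence p \<Omega> \<mu> = (SOME h. has_divergence p \<Omega> \<mu> h)"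

definition normal_trace ::
    "real \<Rightarrow> 'a::euclidean_space set \<Rightarrow> ('a \<Rightarrow> real) \<Rightarrow> ('a set \<Rightarrow> 'a) \<Rightarrow> real"
  where "normal_trace p \<Omega> \<phi> \<mu> = vector_integral \<Omega> \<mu> (grad \<phi>) +
    integral\<^sup>L (lebesgue_on \<Omega>) (\<lambda>x. \<phi> x * divergence p \<Omega> \<mu> x)"

text \<open>The trace \<open>N(\<phi>, \<mu>)\<close> is defined when \<open>\<phi> div \<mu>\<close> is integrable on \<open>\<Omega>\<close>. As \<open>\<phi>\<close> is bounded
  and \<open>div \<mu> \<in> L\<^sup>p\<close>, this always holds when \<open>\<Omega>\<close> has finite Lebesgue measure, but it can fail
  otherwise, where the library integral would silently be 0; the vanishing condition is
  therefore imposed for exactly those \<open>\<phi>\<close> for which the trace is defined.\<close>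

definition Mp_div_trace ::
    "real \<Rightarrow> 'a::euclidean_space set \<Rightarrow> 'a set \<Rightarrow> ('a set \<Rightarrow> 'a) set"
  where "Mp_div_trace p \<Omega> \<Gamma> =
    (if \<Gamma> = {} then Mp_div p \<Omega>
     else {\<mu> \<in> Mp_div p \<Omega>. \<forall>\<phi> \<in> C1b_closure \<Omega>.
        (\<forall>x \<in> closure (frontier \<Omega> - \<Gamma>). \<phi> x = 0) \<longrightarrow>
        integrable (lebesgue_on \<Omega>) (\<lambda>x. \<phi> x * divergence p \<Omega> \<mu> x) \<longrightarrow>
        normal_trace p \<Omega> \<phi> \<mu> = 0})"

definition objective ::
    "real \<Rightarrow> 'a::euclidean_space set \<Rightarrow> ('a \<Rightarrow> real) \<Rightarrow> ('a \<Rightarrow> real) \<Rightarrow> ('a set \<Rightarrow> 'a) \<Rightarrow> real"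
  where "objective p \<Omega> f \<beta> \<mu> =
    1 / p * integral\<^sup>L (lebesgue_on \<Omega>) (\<lambda>x. \<bar>divergence p \<Omega> \<mu> x - f x\<bar> powr p)
    + integral\<^sup>L (total_variation \<Omega> \<mu>) \<beta>"

definition admissible ::
    "real \<Rightarrow> 'a::euclidean_space set \<Rightarrow> 'a set \<Rightarrow> 'a measure \<Rightarrow> ('a set \<Rightarrow> 'a) set"
  where "admissible p \<Omega> \<Gamma> \<alpha> =
    {\<mu> \<in> Mp_div_trace p \<Omega> \<Gamma>. measure_le_on \<Omega> (total_variation \<Omega> \<mu>) \<alpha>}"

end

theory Submission
  imports Defs
begin

text \<open>A measure \<open>\<mu>\<close> with \<open>\<bar>\<mu>\<bar> \<le> \<alpha>\<close> has a density \<open>g\<close> with respect to \<open>\<alpha>\<close> such that \<open>\<bar>g\<bar> \<le> 1\<close>; then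
  \<open>\<bar>\<mu>\<bar>\<close> has the density \<open>\<bar>g\<bar>\<close>, and all constraints are linear in the pair \<open>(g, h)\<close> with \<open>h = div \<mu>\<close>.
  The problem becomes a convex one on a bounded subset of \<open>L\<^sup>2(\<alpha>) \<times> L\<^sup>p(\<Omega>)\<close>. Weak compactness is
  avoided: a minimising sequence that in addition almost minimises the uniformly convex functional
  \<open>\<integral>\<bar>g\<bar>\<^sup>2 d\<alpha> + \<integral>\<bar>h - f\<bar>\<^sup>p dx\<close> is strongly Cauchy, and its limit is a minimiser.\<close>

subsection \<open>The total variation is a measure\<close>

text \<open>\<open>J\<close> alone cannot force convergence of \<open>g\<close>: the term with
  \<beta> is not strictly convex, and \<beta> may vanish. The auxiliary functional supplies the
  missing strictness. It cannot be minimised over the minimisers of \<open>J\<close>, whose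
  existence is the claim, so it is nearly minimised on sublevel sets of \<open>J\<close> instead.
  Two obstacles shape the rest. The divergence is a chosen representative, so passing between
  measures and pairs \<open>(g, h)\<close> rests on its uniqueness up to null sets; this is why
  smooth functions approximating boxes are built. Moreover \<Omega> may have infinite measure: for a
  merely bounded \<phi> the integral of \<open>\<phi> h\<close> need not be defined, let alone be
  continuous in \<open>h\<close>, so the corresponding trace condition does not pass to a strong
  limit directly. The conditions are imposed for \<phi> of bounded support, and the others are
  regained through cutoffs: their gradients are of order \<open>1/n\<close> while \<alpha> is
  finite, so the additional term in the gradient of the product disappears in the limit.\<close>

definition partitions :: "'a::topological_space set \<Rightarrow> 'a set \<Rightarrow> (nat \<Rightarrow> 'a set) set"
  where "partitions \<Omega> A =
    {E. range E \<subseteq> sets (borel_on \<Omega>) \<and> disjoint_family E \<and> (\<Union>n. E n) = A}"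

text \<open>This is the set function handed to \<open>measure_of\<close> in
  \<open>total_variation\<close>. It is studied separately because \<open>measure_of\<close> falls
  back to the zero measure unless its argument is countably additive.\<close>

definition variation ::
    "'a::topological_space set \<Rightarrow> ('a set \<Rightarrow> 'b::real_normed_vector) \<Rightarrow> 'a set \<Rightarrow> ennreal"
  where "variation \<Omega> \<mu> A = (SUP E \<in> partitions \<Omega> A. \<Sum>n. ennreal (norm (\<mu> (E n))))"

lemma total_variation_eq:
  "total_variation \<Omega> \<mu> = measure_of \<Omega> (sets (borel_on \<Omega>)) (variation \<Omega> \<mu>)"
  unfolding total_variation_def variation_def[abs_def] partitions_def ..

lemma vector_measures_sums:
  assumes "\<mu> \<in> vector_measures \<Omega>" "range A \<subseteq> sets (borel_on \<Omega>)" "disjoint_family A"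
  shows "(\<lambda>n. \<mu> (A n)) sums \<mu> (\<Union>n. A n)"
  using assms unfolding vector_measures_def by auto

lemma vector_measures_empty:
  assumes "\<mu> \<in> vector_measures \<Omega>"
  shows "\<mu> {} = 0"
proof -
  have "(\<lambda>n::nat. \<mu> {}) sums \<mu> {}"
    using vector_measures_sums[OF assms, of "\<lambda>_. {}"] by (auto simp: disjoint_family_on_def)
  then have "summable (\<lambda>n::nat. \<mu> {})"
    by (rule sums_summable)
  then show ?thesis
    by (simp add: summable_const_iff)
qed

lemma trivial_partition:
  assumes "A \<in> sets (borel_on \<Omega>)"
  shows "(\<lambda>n::nat. if n = 0 then A else {}) \<in> partitions \<Omega> A"
  using assms by (auto simp: partitions_def disjoint_family_on_def split: if_splits)

lemma norm_le_variation:
  assumes "A \<in> sets (borel_on \<Omega>)" and "\<mu> {} = 0"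
  shows "ennreal (norm (\<mu> A)) \<le> variation \<Omega> \<mu> A"
proof -
  have "(\<Sum>n. ennreal (norm (\<mu> (if n = 0 then A else {})))) = (\<Sum>n\<in>{0::nat}. ennreal (norm (\<mu> A)))"
    by (subst suminf_finite[of "{0}"]) (auto simp: assms)
  then show ?thesis
    unfolding variation_def
    by (intro SUP_upper2[OF trivial_partition[OF assms(1)]]) simp
qed

text \<open>The triangle inequality for partial sums passes to the limit. The right-hand side may be
  infinite, so conditionally convergent series are covered.\<close>

lemma ennreal_norm_suminf_le:
  fixes f :: "nat \<Rightarrow> 'b::real_normed_vector"
  assumes "f sums s"
  shows "ennreal (norm s) \<le> (\<Sum>n. ennreal (norm (f n)))"
proof -
  have "(\<lambda>n. \<Sum>i<n. f i) \<longlonglongrightarrow> s"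
    using assms by (simp add: sums_def)
  then have lim: "(\<lambda>n. ennreal (norm (\<Sum>i<n. f i))) \<longlonglongrightarrow> ennreal (norm s)"
    by (intro tendsto_ennrealI tendsto_norm)
  show ?thesis
  proof (rule LIMSEQ_le_const2[OF lim], intro exI allI impI)
    fix n :: nat
    have "ennreal (norm (\<Sum>i<n. f i)) \<le> ennreal (\<Sum>i<n. norm (f i))"
      by (intro ennreal_leI norm_sum)
    also have "\<dots> = (\<Sum>i<n. ennreal (norm (f i)))"
      by (simp add: sum_ennreal)
    also have "\<dots> \<le> (\<Sum>n. ennreal (norm (f n)))"
      by (rule sum_le_suminf) auto
    finally show "ennreal (norm (\<Sum>i<n. f i)) \<le> (\<Sum>n. ennreal (norm (f n)))" .
  qed
qed

text \<open>Tonelli for the counting measure on \<open>nat\<close>.\<close>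

lemma suminf_swap_ennreal:
  fixes f :: "nat \<Rightarrow> nat \<Rightarrow> ennreal"
  shows "(\<Sum>i. \<Sum>j. f i j) = (\<Sum>j. \<Sum>i. f i j)"
proof -
  have "(\<Sum>i. \<Sum>j. f i j) = (\<integral>\<^sup>+i. (\<Sum>j. f i j) \<partial>count_space UNIV)"
    by (simp only: nn_integral_count_space_nat)
  also have "\<dots> = (\<Sum>j. \<integral>\<^sup>+i. f i j \<partial>count_space UNIV)"
    by (rule nn_integral_suminf) simp
  also have "\<dots> = (\<Sum>j. \<Sum>i. f i j)"
    by (simp only: nn_integral_count_space_nat)
  finally show ?thesis .
qed

text \<open>The index can be chosen independently in each term, so choices that miss the
  \<open>i\<close>-th supremum by less than \<open>e / 2 ^ (i + 1)\<close> miss the whole sum by at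
  most \<open>e\<close>.\<close>

lemma suminf_SUP_le_ennreal:
  fixes f :: "nat \<Rightarrow> 'i \<Rightarrow> ennreal"
  assumes ne: "\<And>i. I i \<noteq> {}"
    and le: "\<And>x. (\<And>i. x i \<in> I i) \<Longrightarrow> (\<Sum>i. f i (x i)) \<le> c"
  shows "(\<Sum>i. SUP x\<in>I i. f i x) \<le> c"
proof (rule ennreal_le_epsilon)
  fix e :: real assume c: "c < top" and e: "0 < e"
  \<comment> \<open>Near-optimal choices exist only for finite suprema. A single term is at most the
    sum for any choice at the other indices, hence at most \<open>c < top\<close>.\<close>
  have "(SUP x\<in>I i. f i x) \<le> c" for i
  proof (rule SUP_least)
    fix y assume y: "y \<in> I i"
    define x where "x = (\<lambda>j. SOME z. z \<in> I j)(i := y)"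
    have x: "x j \<in> I j" for j
      using y ne[of j] by (auto simp: x_def some_in_eq)
    have "f i y = (\<Sum>j\<in>{i}. f j (x j))"
      by (simp add: x_def)
    also have "\<dots> \<le> (\<Sum>j. f j (x j))"
      by (rule sum_le_suminf) auto
    also have "\<dots> \<le> c"
      by (rule le[OF x])
    finally show "f i y \<le> c" .
  qed
  then have fin: "(SUP x\<in>I i. f i x) \<noteq> \<infinity>" for i
    using c by (metis infinity_ennreal_def leD)
  have "\<exists>x\<in>I i. (SUP x\<in>I i. f i x) < f i x + ennreal (e * (1/2) ^ Suc i)" for i
    by (rule SUP_approx_ennreal[OF _ ne refl fin]) (use e in auto)
  then obtain x where x: "\<And>i. x i \<in> I i"
    and le': "\<And>i. (SUP x\<in>I i. f i x) < f i (x i) + ennreal (e * (1/2) ^ Suc i)"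
    by metis
  have "(\<Sum>i. SUP x\<in>I i. f i x) \<le> (\<Sum>i. f i (x i) + ennreal (e * (1/2) ^ Suc i))"
    using le' by (intro suminf_le) (auto intro: less_imp_le)
  also have "\<dots> = (\<Sum>i. f i (x i)) + (\<Sum>i. ennreal (e * (1/2) ^ Suc i))"
    by (rule suminf_add[symmetric]) auto
  also have "(\<Sum>i. ennreal (e * (1/2) ^ Suc i)) = ennreal (e * 1)"
    using e by (intro suminf_ennreal_eq sums_mult power_half_series) auto
  also have "(\<Sum>i. f i (x i)) + ennreal (e * 1) \<le> c + ennreal e"
    using le[OF x] by (simp add: add_right_mono)
  finally show "(\<Sum>i. SUP x\<in>I i. f i x) \<le> c + ennreal e" .
qed

text \<open>Partitions of the sets \<open>A i\<close> glue to a partition of the union, and they may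
  be chosen simultaneously by \<open>suminf_SUP_le_ennreal\<close>. Conversely, a partition of the
  union is cut along the sets \<open>A i\<close>; the triangle inequality and an exchange of sums
  bring it back to partitions of the pieces.\<close>

lemma variation_countably_additive:
  assumes \<mu>: "\<mu> \<in> vector_measures \<Omega>"
  shows "countably_additive (sets (borel_on \<Omega>)) (variation \<Omega> \<mu>)"
proof (rule countably_additiveI)
  fix A :: "nat \<Rightarrow> 'a set"
  assume A: "range A \<subseteq> sets (borel_on \<Omega>)" "disjoint_family A" "(\<Union>i. A i) \<in> sets (borel_on \<Omega>)"
  show "(\<Sum>i. variation \<Omega> \<mu> (A i)) = variation \<Omega> \<mu> (\<Union>i. A i)"
  proof (rule antisym)
    show "(\<Sum>i. variation \<Omega> \<mu> (A i)) \<le> variation \<Omega> \<mu> (\<Union>i. A i)"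
      unfolding variation_def[of _ _ "A _"]
    proof (rule suminf_SUP_le_ennreal)
      fix i
      show "partitions \<Omega> (A i) \<noteq> {}"
        using trivial_partition[of "A i" \<Omega>] A by blast
    next
      fix E assume E: "\<And>i. E i \<in> partitions \<Omega> (A i)"
      then have Es: "E i j \<in> sets (borel_on \<Omega>)" and Ed: "disjoint_family (E i)"
        and EA: "(\<Union>j. E i j) = A i" for i j
        unfolding partitions_def by blast+
      \<comment> \<open>Partitions are indexed by \<open>nat\<close>, so the double family is listed
        as a single sequence.\<close>
      define G where "G = (\<lambda>k. case prod_decode k of (i, j) \<Rightarrow> E i j)"
      have "G \<in> partitions \<Omega> (\<Union>i. A i)"
        unfolding partitions_def
      proof (intro CollectI conjI)
        show "range G \<subseteq> sets (borel_on \<Omega>)"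
          using Es by (auto simp: G_def split: prod.split)
        show "(\<Union>n. G n) = (\<Union>i. A i)"
        proof (intro equalityI subsetI)
          fix x assume "x \<in> (\<Union>i. A i)"
          then obtain i j where "x \<in> E i j"
            using EA by blast
          then have "x \<in> G (prod_encode (i, j))"
            by (simp add: G_def)
          then show "x \<in> (\<Union>n. G n)"
            by blast
        next
          fix x assume "x \<in> (\<Union>n. G n)"
          then show "x \<in> (\<Union>i. A i)"
            unfolding EA[symmetric] by (auto simp: G_def split_beta)
        qed
        show "disjoint_family G"
          unfolding disjoint_family_on_def
        proof (intro ballI impI)
          fix m n :: nat assume "m \<noteq> n"
          obtain i j k l where ij: "prod_decode m = (i, j)" "prod_decode n = (k, l)"
            by (metis surj_pair)
          have ne: "(i, j) \<noteq> (k, l)"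
            using \<open>m \<noteq> n\<close> ij by (metis prod_decode_inverse)
          have "E i j \<inter> E k l = {}"
          proof (cases "i = k")
            case True
            then show ?thesis
              using ne Ed[of i] by (auto simp: disjoint_family_on_def)
          next
            case False
            then have "A i \<inter> A k = {}"
              using A(2) by (auto simp: disjoint_family_on_def)
            then show ?thesis
              using EA[of i] EA[of k] by blast
          qed
          then show "G m \<inter> G n = {}"
            by (simp add: G_def ij)
        qed
      qed
      then have "(\<Sum>n. ennreal (norm (\<mu> (G n)))) \<le> variation \<Omega> \<mu> (\<Union>i. A i)"
        unfolding variation_def by (rule SUP_upper)
      also have "(\<Sum>n. ennreal (norm (\<mu> (G n)))) =
          (\<Sum>n. (\<lambda>(i, j). ennreal (norm (\<mu> (E i j)))) (prod_decode n))"
        by (simp add: G_def split_beta)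
      also have "\<dots> = (\<Sum>i. \<Sum>j. ennreal (norm (\<mu> (E i j))))"
        by (rule suminf_ennreal_2dimen) simp
      finally show "(\<Sum>i. \<Sum>n. ennreal (norm (\<mu> (E i n)))) \<le> variation \<Omega> \<mu> (\<Union>i. A i)" .
    qed
  next
    show "variation \<Omega> \<mu> (\<Union>i. A i) \<le> (\<Sum>i. variation \<Omega> \<mu> (A i))"
      unfolding variation_def[of _ _ "\<Union>i. A i"]
    proof (rule SUP_least)
      fix E assume "E \<in> partitions \<Omega> (\<Union>i. A i)"
      then have Es: "E j \<in> sets (borel_on \<Omega>)" and Ed: "disjoint_family E"
        and EA: "(\<Union>j. E j) = (\<Union>i. A i)" for j
        by (auto simp: partitions_def)
      have As: "A i \<in> sets (borel_on \<Omega>)" for i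
        using A by auto
      have "ennreal (norm (\<mu> (E j))) \<le> (\<Sum>i. ennreal (norm (\<mu> (E j \<inter> A i))))" for j
      proof (rule ennreal_norm_suminf_le)
        have "(\<lambda>i. \<mu> (E j \<inter> A i)) sums \<mu> (\<Union>i. E j \<inter> A i)"
          using Es As A(2) by (intro vector_measures_sums[OF \<mu>]) (fastforce simp: disjoint_family_on_def)+
        also have "(\<Union>i. E j \<inter> A i) = E j"
          using EA by blast
        finally show "(\<lambda>i. \<mu> (E j \<inter> A i)) sums \<mu> (E j)" .
      qed
      then have "(\<Sum>j. ennreal (norm (\<mu> (E j)))) \<le> (\<Sum>j. \<Sum>i. ennreal (norm (\<mu> (E j \<inter> A i))))"
        by (intro suminf_le) auto
      also have "\<dots> = (\<Sum>i. \<Sum>j. ennreal (norm (\<mu> (E j \<inter> A i))))"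
        by (rule suminf_swap_ennreal)
      also have "\<dots> \<le> (\<Sum>i. variation \<Omega> \<mu> (A i))"
      proof (rule suminf_le)
        fix i
        have "(\<lambda>j. E j \<inter> A i) \<in> partitions \<Omega> (A i)"
          using Es As Ed EA by (fastforce simp: partitions_def disjoint_family_on_def)
        then show "(\<Sum>j. ennreal (norm (\<mu> (E j \<inter> A i)))) \<le> variation \<Omega> \<mu> (A i)"
          unfolding variation_def by (rule SUP_upper)
      qed auto
      finally show "(\<Sum>n. ennreal (norm (\<mu> (E n)))) \<le> (\<Sum>i. variation \<Omega> \<mu> (A i))" .
    qed
  qed
qed

lemma emeasure_total_variation:
  assumes \<mu>: "\<mu> \<in> vector_measures \<Omega>" and A: "A \<in> sets (borel_on \<Omega>)"
  shows "emeasure (total_variation \<Omega> \<mu>) A = variation \<Omega> \<mu> A"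
proof (rule emeasure_measure_of[OF total_variation_eq])
  show sub: "sets (borel_on \<Omega>) \<subseteq> Pow \<Omega>"
    using sets.space_closed[of "borel_on \<Omega>"] by (simp add: space_restrict_space)
  have eq: "sets (total_variation \<Omega> \<mu>) = sets (borel_on \<Omega>)"
    using sets.sigma_sets_eq[of "borel_on \<Omega>"] sub
    by (simp add: total_variation_eq sets_measure_of space_restrict_space)
  show "A \<in> sets (total_variation \<Omega> \<mu>)"
    using A eq by simp
  show "countably_additive (sets (total_variation \<Omega> \<mu>)) (variation \<Omega> \<mu>)"
    unfolding eq by (rule variation_countably_additive[OF \<mu>])
  have "variation \<Omega> \<mu> {} \<le> 0"
    unfolding variation_def
  proof (rule SUP_least)
    fix E :: "nat \<Rightarrow> 'a set" assume "E \<in> partitions \<Omega> {}"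
    then have "E n = {}" for n
      by (auto simp: partitions_def)
    then show "(\<Sum>n. ennreal (norm (\<mu> (E n)))) \<le> 0"
      using vector_measures_empty[OF \<mu>] by simp
  qed
  then show "positive (sets (total_variation \<Omega> \<mu>)) (variation \<Omega> \<mu>)"
    by (simp add: positive_def)
qed

subsection \<open>Measures dominated by \<open>\<alpha>\<close> as densities\<close>

lemma nonneg_measuresD:
  assumes "\<alpha> \<in> nonneg_measures \<Omega>"
  shows "sets \<alpha> = sets (borel_on \<Omega>)" "finite_measure \<alpha>" "space \<alpha> = \<Omega>"
    "sets (borel_on \<Omega>) \<subseteq> Pow \<Omega>"
proof -
  show s: "sets \<alpha> = sets (borel_on \<Omega>)" and "finite_measure \<alpha>"
    using assms by (auto simp: nonneg_measures_def)
  show sp: "space \<alpha> = \<Omega>"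
    using sets_eq_imp_space_eq[OF s] by (simp add: space_restrict_space)
  show "sets (borel_on \<Omega>) \<subseteq> Pow \<Omega>"
    using sets.space_closed[of \<alpha>] by (simp add: s sp)
qed

lemma set_integrable_of_integrable:
  fixes g :: "'a \<Rightarrow> 'b::{banach, second_countable_topology}"
  assumes "integrable \<alpha> g" "A \<in> sets \<alpha>"
  shows "set_integrable \<alpha> A g"
  using assms by (simp add: set_integrable_def integrable_mult_indicator)

text \<open>The measure \<open>\<nu> + \<alpha>\<close> is non-negative, so that Radon-Nikodym applies to it without a Jordan
  decomposition of \<open>\<nu>\<close>.\<close>

lemma signed_measure_density:
  assumes \<alpha>: "\<alpha> \<in> nonneg_measures \<Omega>"
    and add: "\<And>A. range A \<subseteq> sets \<alpha> \<Longrightarrow> disjoint_family A \<Longrightarrow> (\<lambda>n. \<nu> (A n)) sums \<nu> (\<Union>n. A n)"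
    and le: "\<And>A. A \<in> sets \<alpha> \<Longrightarrow> \<bar>\<nu> A\<bar> \<le> measure \<alpha> A"
  obtains k :: "'a::euclidean_space \<Rightarrow> real"
  where "integrable \<alpha> k" "\<And>A. A \<in> sets \<alpha> \<Longrightarrow> \<nu> A = (LINT x:A|\<alpha>. k x)"
proof -
  interpret finite_measure \<alpha> by (rule nonneg_measuresD[OF \<alpha>])
  define F where "F = (\<lambda>A. ennreal (\<nu> A + measure \<alpha> A))"
  define N where "N = measure_of (space \<alpha>) (sets \<alpha>) F"
  have nn: "0 \<le> \<nu> A + measure \<alpha> A" if "A \<in> sets \<alpha>" for A
    using le[OF that] by linarith
  have setsN: "sets N = sets \<alpha>"
    by (simp add: N_def)
  have N: "emeasure N A = F A" if "A \<in> sets \<alpha>" for A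
  proof (rule emeasure_measure_of[OF N_def sets.space_closed])
    show "A \<in> sets N"
      using that setsN by simp
    have "\<nu> {} = 0"
      using le[of "{}"] by simp
    then show "positive (sets N) F"
      by (simp add: positive_def F_def)
    show "countably_additive (sets N) F"
    proof (rule countably_additiveI)
      fix A :: "nat \<Rightarrow> 'a set"
      assume A: "range A \<subseteq> sets N" "disjoint_family A"
      show "(\<Sum>i. F (A i)) = F (\<Union>i. A i)"
        unfolding F_def
        using A setsN nn by (intro suminf_ennreal_eq sums_add add finite_measure_UNION) auto
    qed
  qed
  have "absolutely_continuous \<alpha> N"
    unfolding absolutely_continuous_def
  proof
    fix A assume "A \<in> null_sets \<alpha>"
    then have A: "A \<in> sets \<alpha>" "measure \<alpha> A = 0"
      by (auto simp: null_sets_def measure_def)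
    then show "A \<in> null_sets N"
      using le[of A] N[of A] setsN by (auto simp: null_sets_def F_def)
  qed
  then obtain f where f[measurable]: "f \<in> borel_measurable \<alpha>" and dens: "density \<alpha> f = N"
    using Radon_Nikodym setsN by blast
  have intf: "(\<integral>\<^sup>+x. f x * indicator A x \<partial>\<alpha>) = F A" if "A \<in> sets \<alpha>" for A
    using N[OF that] dens emeasure_density[OF f that] by simp
  have "(\<integral>\<^sup>+x. f x \<partial>\<alpha>) = (\<integral>\<^sup>+x. f x * indicator (space \<alpha>) x \<partial>\<alpha>)"
    by (intro nn_integral_cong) simp
  also have "\<dots> \<noteq> \<infinity>"
    by (subst intf) (auto simp: F_def)
  finally have "AE x in \<alpha>. f x \<noteq> \<infinity>"
    by (intro nn_integral_PInf_AE) auto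
  then have eq: "AE x in \<alpha>. ennreal (enn2real (f x)) = f x"
    by eventually_elim (auto simp: ennreal_enn2real_if)
  have hbi: "has_bochner_integral \<alpha> (\<lambda>x. enn2real (f x) * indicator A x) (\<nu> A + measure \<alpha> A)"
    if A[measurable]: "A \<in> sets \<alpha>" for A
  proof (rule has_bochner_integral_nn_integral)
    have "(\<integral>\<^sup>+x. ennreal (enn2real (f x) * indicator A x) \<partial>\<alpha>) = (\<integral>\<^sup>+x. f x * indicator A x \<partial>\<alpha>)"
      using eq by (intro nn_integral_cong_AE, eventually_elim) (auto split: split_indicator)
    then show "(\<integral>\<^sup>+x. ennreal (enn2real (f x) * indicator A x) \<partial>\<alpha>) = ennreal (\<nu> A + measure \<alpha> A)"
      using intf[OF A] by (simp add: F_def)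
  qed (use nn[OF that] in auto)
  have "integrable \<alpha> (\<lambda>x. enn2real (f x) * indicator (space \<alpha>) x)"
    using hbi[of "space \<alpha>"] by (auto simp: has_bochner_integral_iff)
  then have int: "integrable \<alpha> (\<lambda>x. enn2real (f x))"
    by (subst Bochner_Integration.integrable_cong[OF refl,
          where g = "\<lambda>x. enn2real (f x) * indicator (space \<alpha>) x"]) auto
  show ?thesis
  proof (rule that)
    \<comment> \<open>The added \<alpha> has density 1 with respect to itself, which is subtracted
      again here.\<close>
    show "integrable \<alpha> (\<lambda>x. enn2real (f x) - 1)"
      using int by simp
    fix A assume A[measurable]: "A \<in> sets \<alpha>"
    have "(LINT x:A|\<alpha>. enn2real (f x) - 1) = (LINT x:A|\<alpha>. enn2real (f x)) - (LINT x:A|\<alpha>. 1)"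
      using int A by (intro set_integral_diff set_integrable_of_integrable) auto
    also have "(LINT x:A|\<alpha>. enn2real (f x)) = \<nu> A + measure \<alpha> A"
      using hbi[OF A] by (simp add: set_lebesgue_integral_def has_bochner_integral_iff mult.commute)
    also have "(LINT x:A|\<alpha>. (1::real)) = measure \<alpha> A"
      using A sets.sets_into_space[OF A] by (simp add: set_lebesgue_integral_def Int_absorb2)
    finally show "\<nu> A = (LINT x:A|\<alpha>. enn2real (f x) - 1)"
      by simp
  qed
qed

text \<open>The supremum defining \<open>pos_part\<close> is attained at the part of
  \<open>A\<close> where \<open>k\<close> is positive, as in the Hahn decomposition. Recognising the
  set function as \<open>emeasure\<close> of a density also yields its countable additivity at no
  cost.\<close>

lemma pos_part_density:
  assumes \<alpha>: "\<alpha> \<in> nonneg_measures \<Omega>"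
    and k: "integrable \<alpha> k" and \<nu>: "\<And>A. A \<in> sets \<alpha> \<Longrightarrow> \<nu> A = (LINT x:A|\<alpha>. k x)"
  shows "pos_part \<Omega> \<nu> = density \<alpha> (\<lambda>x. ennreal (max 0 (k x)))" (is "_ = ?D")
proof -
  note S = nonneg_measuresD[OF \<alpha>]
  have k_meas[measurable]: "k \<in> borel_measurable \<alpha>"
    using k by auto
  have ik: "set_integrable \<alpha> A k" "set_integrable \<alpha> A (\<lambda>x. max 0 (k x))" if "A \<in> sets \<alpha>" for A
    using that k by (auto intro!: set_integrable_of_integrable Bochner_Integration.integrable_max)
  have "pos_part \<Omega> \<nu> = measure_of \<Omega> (sets \<alpha>) (emeasure ?D)"
    unfolding pos_part_def S(1)[symmetric]
  proof (rule measure_of_eq)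
    show "sets \<alpha> \<subseteq> Pow \<Omega>"
      using S by simp
    fix A assume "A \<in> sigma_sets \<Omega> (sets \<alpha>)"
    then have A[measurable]: "A \<in> sets \<alpha>"
      using sets.sigma_sets_eq[of \<alpha>] S(3) by simp
    have em: "emeasure ?D A = ennreal (LINT x:A|\<alpha>. max 0 (k x))"
    proof -
      have "emeasure ?D A = (\<integral>\<^sup>+x. ennreal (indicator A x *\<^sub>R max 0 (k x)) \<partial>\<alpha>)"
        by (subst emeasure_density) (auto intro!: nn_integral_cong split: split_indicator)
      also have "\<dots> = ennreal (LINT x:A|\<alpha>. max 0 (k x))"
        unfolding set_lebesgue_integral_def using ik(2)[OF A]
        by (intro nn_integral_eq_integral) (auto simp: set_integrable_def split: split_indicator)
      finally show ?thesis .
    qed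
    show "(SUP B\<in>{B \<in> sets \<alpha>. B \<subseteq> A}. ennreal (\<nu> B)) = emeasure ?D A"
    proof (rule antisym)
      show "(SUP B\<in>{B \<in> sets \<alpha>. B \<subseteq> A}. ennreal (\<nu> B)) \<le> emeasure ?D A"
      proof (rule SUP_least)
        fix B assume "B \<in> {B \<in> sets \<alpha>. B \<subseteq> A}"
        then have B: "B \<in> sets \<alpha>" "B \<subseteq> A" by auto
        have "\<nu> B \<le> (LINT x:A|\<alpha>. max 0 (k x))"
          unfolding \<nu>[OF B(1)] set_lebesgue_integral_def
          using ik(1)[OF B(1)] ik(2)[OF A] B(2)
          by (intro integral_mono) (auto simp: set_integrable_def split: split_indicator)
        then show "ennreal (\<nu> B) \<le> emeasure ?D A"
          unfolding em by (rule ennreal_leI)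
      qed
      define B where "B = A \<inter> {x \<in> space \<alpha>. 0 < k x}"
      have B: "B \<in> sets \<alpha>" "B \<subseteq> A"
        by (auto simp: B_def)
      have "(LINT x:A|\<alpha>. max 0 (k x)) = \<nu> B"
        unfolding \<nu>[OF B(1)] set_lebesgue_integral_def
        by (intro Bochner_Integration.integral_cong) (auto simp: B_def split: split_indicator)
      then show "emeasure ?D A \<le> (SUP B\<in>{B \<in> sets \<alpha>. B \<subseteq> A}. ennreal (\<nu> B))"
        unfolding em using B by (auto intro: SUP_upper)
    qed
  qed
  also have "\<dots> = ?D"
    using measure_of_of_measure[of ?D] S(3) by simp
  finally show ?thesis .
qed

text \<open>Both Jordan parts turn into densities, and \<open>max 0 k - max 0 (- k) = k\<close>
  recombines them. Since \<open>g\<close> is bounded, both integrals are finite and their difference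
  is the integral of the difference.\<close>

lemma signed_integral_density:
  assumes \<alpha>: "\<alpha> \<in> nonneg_measures \<Omega>"
    and k: "integrable \<alpha> k" and \<nu>: "\<And>A. A \<in> sets \<alpha> \<Longrightarrow> \<nu> A = (LINT x:A|\<alpha>. k x)"
    and g[measurable]: "g \<in> borel_measurable \<alpha>" and bd: "\<And>x. x \<in> \<Omega> \<Longrightarrow> \<bar>g x\<bar> \<le> C"
  shows "signed_integral \<Omega> \<nu> g = (\<integral>x. g x * k x \<partial>\<alpha>)"
proof -
  note S = nonneg_measuresD[OF \<alpha>]
  have k_meas[measurable]: "k \<in> borel_measurable \<alpha>"
    using k by auto
  have int: "integrable \<alpha> (\<lambda>x. max 0 (u x) * g x)" if u: "integrable \<alpha> u" for u :: "'a \<Rightarrow> real"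
  proof (rule Bochner_Integration.integrable_bound)
    show "integrable \<alpha> (\<lambda>x. C * u x)"
      using u by simp
    have [measurable]: "u \<in> borel_measurable \<alpha>"
      using u by auto
    show "(\<lambda>x. max 0 (u x) * g x) \<in> borel_measurable \<alpha>"
      by measurable
    show "AE x in \<alpha>. norm (max 0 (u x) * g x) \<le> norm (C * u x)"
    proof (rule AE_I2)
      fix x assume "x \<in> space \<alpha>"
      then have "\<bar>g x\<bar> \<le> C"
        using bd S(3) by simp
      moreover have "\<bar>max 0 (u x)\<bar> \<le> \<bar>u x\<bar>"
        by (simp add: max_def)
      ultimately have "\<bar>g x\<bar> * \<bar>max 0 (u x)\<bar> \<le> \<bar>C\<bar> * \<bar>u x\<bar>"
        by (intro mult_mono) auto
      then show "norm (max 0 (u x) * g x) \<le> norm (C * u x)"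
        by (simp add: abs_mult mult.commute)
    qed
  qed
  have neg: "pos_part \<Omega> (\<lambda>A. - \<nu> A) = density \<alpha> (\<lambda>x. ennreal (max 0 (- k x)))"
    by (rule pos_part_density[OF \<alpha>]) (use k \<nu> in \<open>auto simp: set_lebesgue_integral_def\<close>)
  have "signed_integral \<Omega> \<nu> g = (\<integral>x. max 0 (k x) * g x \<partial>\<alpha>) - (\<integral>x. max 0 (- k x) * g x \<partial>\<alpha>)"
    unfolding signed_integral_def neg pos_part_density[OF \<alpha> k \<nu>, simplified]
    by (subst (1 2) integral_density) auto
  also have "\<dots> = (\<integral>x. max 0 (k x) * g x - max 0 (- k x) * g x \<partial>\<alpha>)"
    using int[OF k] int[of "\<lambda>x. - k x"] k by (simp add: Bochner_Integration.integral_diff)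
  also have "\<dots> = (\<integral>x. g x * k x \<partial>\<alpha>)"
    by (intro Bochner_Integration.integral_cong) (auto simp: max_def)
  finally show ?thesis .
qed

text \<open>The value 0 off the sigma-algebra follows the convention of
  \<open>vector_measures\<close>, so that a measure and its representation by a density can be equal
  as functions.\<close>

definition density_vector :: "'a measure \<Rightarrow> ('a \<Rightarrow> 'b::euclidean_space) \<Rightarrow> 'a set \<Rightarrow> 'b"
  where "density_vector \<alpha> g A = (if A \<in> sets \<alpha> then LINT x:A|\<alpha>. g x else 0)"

lemma density_vector_inner:
  assumes "integrable \<alpha> g" "A \<in> sets \<alpha>"
  shows "density_vector \<alpha> g A \<bullet> b = (LINT x:A|\<alpha>. g x \<bullet> b)"
proof -
  have "(\<integral>x. (indicator A x *\<^sub>R g x) \<bullet> b \<partial>\<alpha>) = (LINT x:A|\<alpha>. g x) \<bullet> b"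
    using set_integrable_of_integrable[OF assms] unfolding set_lebesgue_integral_def set_integrable_def
    by (intro integral_inner_left) auto
  then show ?thesis
    using assms by (simp add: density_vector_def set_lebesgue_integral_def)
qed

lemma density_vector_in_vector_measures:
  assumes \<alpha>: "\<alpha> \<in> nonneg_measures \<Omega>" and g: "integrable \<alpha> g"
  shows "density_vector \<alpha> g \<in> vector_measures \<Omega>"
proof -
  note S = nonneg_measuresD[OF \<alpha>]
  have "(\<lambda>n. density_vector \<alpha> g (A n)) sums density_vector \<alpha> g (\<Union>n. A n)"
    if A: "range A \<subseteq> sets \<alpha>" "disjoint_family A" for A :: "nat \<Rightarrow> 'a set"
  proof -
    have U: "(\<Union>n. A n) \<in> sets \<alpha>" and A': "\<And>n. A n \<in> sets \<alpha>"
      using A by auto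
    have "(\<lambda>n. LINT x:A n|\<alpha>. g x) sums (LINT x:(\<Union>n. A n)|\<alpha>. g x)"
    proof -
      have "(\<lambda>n. LINT x:(\<Union>i<n. A i)|\<alpha>. g x) \<longlonglongrightarrow> (LINT x:(\<Union>n. \<Union>i<n. A i)|\<alpha>. g x)"
        using A' U g by (intro set_integral_cont_up set_integrable_of_integrable)
          (auto simp: incseq_def intro: less_le_trans)
      also have "(\<Union>n. \<Union>i<n. A i) = (\<Union>n. A n)"
        by auto
      also have "(\<lambda>n. LINT x:(\<Union>i<n. A i)|\<alpha>. g x) = (\<lambda>n. \<Sum>i<n. LINT x:A i|\<alpha>. g x)"
        using A A' g
        by (intro ext set_integral_finite_Union set_integrable_of_integrable)
          (auto simp: disjoint_family_on_def)
      finally show ?thesis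
        by (simp add: sums_def)
    qed
    then show ?thesis
      using U A' by (simp add: density_vector_def)
  qed
  then show ?thesis
    using S by (auto simp: vector_measures_def density_vector_def)
qed

text \<open>Each coordinate of \<mu> is bounded by \<alpha> on every measurable set, since a
  coordinate is at most the norm and the norm is at most the variation. The scalar Radon-Nikodym
  argument then gives the density coordinatewise.\<close>

lemma vector_measure_density:
  fixes \<mu> :: "'a::euclidean_space set \<Rightarrow> 'b::euclidean_space"
  assumes \<alpha>: "\<alpha> \<in> nonneg_measures \<Omega>" and \<mu>: "\<mu> \<in> vector_measures \<Omega>"
    and le: "measure_le_on \<Omega> (total_variation \<Omega> \<mu>) \<alpha>"
  obtains g where "integrable \<alpha> g" "\<mu> = density_vector \<alpha> g"
proof -
  note S = nonneg_measuresD[OF \<alpha>]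
  interpret finite_measure \<alpha> by (rule S)
  have nle: "norm (\<mu> A) \<le> measure \<alpha> A" if A: "A \<in> sets \<alpha>" for A
  proof -
    have "ennreal (norm (\<mu> A)) \<le> emeasure (total_variation \<Omega> \<mu>) A"
      using A S norm_le_variation[of A \<Omega> \<mu>] emeasure_total_variation[OF \<mu>] vector_measures_empty[OF \<mu>]
      by simp
    also have "\<dots> \<le> emeasure \<alpha> A"
      using le A S by (simp add: measure_le_on_def)
    finally show ?thesis
      by (simp add: emeasure_eq_measure)
  qed
  have "\<exists>k. integrable \<alpha> k \<and> (\<forall>A\<in>sets \<alpha>. \<mu> A \<bullet> b = (LINT x:A|\<alpha>. k x))" if b: "b \<in> Basis" for b
  proof (rule signed_measure_density[OF \<alpha>, of "\<lambda>A. \<mu> A \<bullet> b"])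
    fix A :: "nat \<Rightarrow> 'a set" assume A: "range A \<subseteq> sets \<alpha>" "disjoint_family A"
    show "(\<lambda>n. \<mu> (A n) \<bullet> b) sums (\<mu> (\<Union>n. A n) \<bullet> b)"
      using A S by (intro bounded_linear.sums[OF bounded_linear_inner_left] vector_measures_sums[OF \<mu>]) auto
  next
    fix A assume "A \<in> sets \<alpha>"
    then show "\<bar>\<mu> A \<bullet> b\<bar> \<le> measure \<alpha> A"
      using nle[of A] Basis_le_norm[OF b, of "\<mu> A"] by linarith
  qed blast
  then obtain k where k: "\<And>b. b \<in> Basis \<Longrightarrow> integrable \<alpha> (k b)"
    and k': "\<And>b A. b \<in> Basis \<Longrightarrow> A \<in> sets \<alpha> \<Longrightarrow> \<mu> A \<bullet> b = (LINT x:A|\<alpha>. k b x)"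
    by metis
  define g where "g = (\<lambda>x. \<Sum>b\<in>Basis. k b x *\<^sub>R b)"
  have g: "integrable \<alpha> g"
    using k by (auto simp: g_def)
  show ?thesis
  proof (rule that[OF g], rule ext)
    fix A
    show "\<mu> A = density_vector \<alpha> g A"
    proof (cases "A \<in> sets \<alpha>")
      case True
      show ?thesis
      proof (rule euclidean_eqI)
        fix b :: 'b assume b: "b \<in> Basis"
        have "g x \<bullet> b = k b x" for x
          using b by (simp add: g_def)
        then show "\<mu> A \<bullet> b = density_vector \<alpha> g A \<bullet> b"
          using k'[OF b True] density_vector_inner[OF g True] by simp
      qed
    next
      case False
      then show ?thesis
        using \<mu> S by (simp add: density_vector_def vector_measures_def)
    qed
  qed
qed

lemma vector_integral_density:
  assumes \<alpha>: "\<alpha> \<in> nonneg_measures \<Omega>" and g: "integrable \<alpha> g"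
    and \<Phi>: "\<Phi> \<in> borel_measurable \<alpha>" and bd: "\<And>x. x \<in> \<Omega> \<Longrightarrow> norm (\<Phi> x) \<le> C"
  shows "vector_integral \<Omega> (density_vector \<alpha> g) \<Phi> = (\<integral>x. \<Phi> x \<bullet> g x \<partial>\<alpha>)"
proof -
  note S = nonneg_measuresD[OF \<alpha>]
  have "signed_integral \<Omega> (\<lambda>A. density_vector \<alpha> g A \<bullet> b) (\<lambda>x. \<Phi> x \<bullet> b) = (\<integral>x. (\<Phi> x \<bullet> b) * (g x \<bullet> b) \<partial>\<alpha>)"
    if b: "b \<in> Basis" for b
  proof (rule signed_integral_density[OF \<alpha>])
    show "\<bar>\<Phi> x \<bullet> b\<bar> \<le> C" if "x \<in> \<Omega>" for x
      using bd[OF that] Basis_le_norm[OF b, of "\<Phi> x"] by linarith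
  qed (use g \<Phi> density_vector_inner[OF g] in auto)
  then have "vector_integral \<Omega> (density_vector \<alpha> g) \<Phi> = (\<Sum>b\<in>Basis. \<integral>x. (\<Phi> x \<bullet> b) * (g x \<bullet> b) \<partial>\<alpha>)"
    unfolding vector_integral_def by simp
  also have "\<dots> = (\<integral>x. (\<Sum>b\<in>Basis. (\<Phi> x \<bullet> b) * (g x \<bullet> b)) \<partial>\<alpha>)"
  proof (rule Bochner_Integration.integral_sum[symmetric])
    fix b :: 'a assume b: "b \<in> Basis"
    show "integrable \<alpha> (\<lambda>x. (\<Phi> x \<bullet> b) * (g x \<bullet> b))"
    proof (rule Bochner_Integration.integrable_bound)
      show "integrable \<alpha> (\<lambda>x. C *\<^sub>R g x)"
        using g by simp
      show "(\<lambda>x. (\<Phi> x \<bullet> b) * (g x \<bullet> b)) \<in> borel_measurable \<alpha>"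
        using g \<Phi> by measurable
      show "AE x in \<alpha>. norm ((\<Phi> x \<bullet> b) * (g x \<bullet> b)) \<le> norm (C *\<^sub>R g x)"
      proof (rule AE_I2)
        fix x assume "x \<in> space \<alpha>"
        then have "\<bar>\<Phi> x \<bullet> b\<bar> \<le> \<bar>C\<bar>"
          using bd[of x] S(3) Basis_le_norm[OF b, of "\<Phi> x"] by fastforce
        then show "norm ((\<Phi> x \<bullet> b) * (g x \<bullet> b)) \<le> norm (C *\<^sub>R g x)"
          using Basis_le_norm[OF b, of "g x"] by (simp add: abs_mult mult_mono)
      qed
    qed
  qed
  also have "\<dots> = (\<integral>x. \<Phi> x \<bullet> g x \<partial>\<alpha>)"
    by (simp add: euclidean_inner[symmetric])
  finally show ?thesis .
qed

text \<open>One direction is the norm inequality for integrals on each piece of a partition. For the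
  other, \<open>A\<close> is cut into countably many pieces on which \<open>g\<close> stays within
  \<open>d\<close> of a constant vector; there the norm of the integral and the integral of the norm
  nearly agree.\<close>

lemma variation_density:
  assumes \<alpha>: "\<alpha> \<in> nonneg_measures \<Omega>" and g: "integrable \<alpha> g" and A: "A \<in> sets \<alpha>"
  shows "variation \<Omega> (density_vector \<alpha> g) A = emeasure (density \<alpha> (\<lambda>x. ennreal (norm (g x)))) A"
    (is "_ = emeasure ?D A")
proof (rule antisym)
  note S = nonneg_measuresD[OF \<alpha>]
  interpret finite_measure \<alpha> by (rule S)
  have g_meas[measurable]: "g \<in> borel_measurable \<alpha>"
    using g by auto
  have le: "ennreal (norm (density_vector \<alpha> g B)) \<le> emeasure ?D B" if B: "B \<in> sets \<alpha>" for B
  proof -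
    have "ennreal (norm (LINT x:B|\<alpha>. g x)) \<le> (\<integral>\<^sup>+x. norm (indicator B x *\<^sub>R g x) \<partial>\<alpha>)"
      unfolding set_lebesgue_integral_def
      by (intro integral_norm_bound_ennreal integrable_mult_indicator B g)
    also have "\<dots> = emeasure ?D B"
      using B by (subst emeasure_density) (auto intro!: nn_integral_cong split: split_indicator)
    finally show ?thesis
      using B by (simp add: density_vector_def)
  qed
  show "variation \<Omega> (density_vector \<alpha> g) A \<le> emeasure ?D A"
    unfolding variation_def
  proof (rule SUP_least)
    fix E assume E: "E \<in> partitions \<Omega> A"
    have "(\<Sum>n. ennreal (norm (density_vector \<alpha> g (E n)))) \<le> (\<Sum>n. emeasure ?D (E n))"
      using E S by (intro suminf_le le) (auto simp: partitions_def)
    also have "\<dots> = emeasure ?D (\<Union>n. E n)"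
      using E S by (intro suminf_emeasure) (auto simp: partitions_def)
    finally show "(\<Sum>n. ennreal (norm (density_vector \<alpha> g (E n)))) \<le> emeasure ?D A"
      using E by (simp add: partitions_def)
  qed
  show "emeasure ?D A \<le> variation \<Omega> (density_vector \<alpha> g) A"
  proof (rule ennreal_le_epsilon)
    fix e :: real assume "0 < e"
    \<comment> \<open>Chosen so that the total error \<open>2 * d * measure \<alpha> A\<close> stays
      below \<open>e\<close>; the summand 1 keeps the denominator positive when \<open>A\<close> is
      null.\<close>
    define d where "d = e / (2 * (measure \<alpha> A + 1))"
    have "0 < d"
      unfolding d_def using \<open>0 < e\<close> by (intro divide_pos_pos mult_pos_pos add_nonneg_pos) auto
    have dA: "2 * d * measure \<alpha> A \<le> e"
    proof -
      have "2 * d * (measure \<alpha> A + 1) = e"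
        using add_nonneg_pos[OF measure_nonneg[of \<alpha> A] zero_less_one] unfolding d_def
        by (simp del: distrib_left_numeral)
      with \<open>0 < d\<close> show ?thesis
        by (simp add: algebra_simps)
    qed
    obtain Q :: "'b set" where Q: "countable Q" "\<And>X. open X \<Longrightarrow> X \<noteq> {} \<Longrightarrow> \<exists>q\<in>Q. q \<in> X"
      using countable_dense_setE by blast
    define q where "q = from_nat_into Q"
    have "Q \<noteq> {}"
      using Q(2)[of UNIV] by auto
    have near: "\<exists>n. dist (q n) y < d" for y
    proof -
      obtain z where "z \<in> Q" "z \<in> ball y d"
        using Q(2)[of "ball y d"] \<open>0 < d\<close> by auto
      then show ?thesis
        using from_nat_into_surj[OF Q(1)] by (auto simp: q_def dist_commute)
    qed
    \<comment> \<open>The balls of radius \<open>d\<close> around a countable dense sequence cover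
      the space; \<open>disjointed\<close> assigns each point to the first ball that contains its
      value.\<close>
    define B where "B = (\<lambda>n. {x \<in> space \<alpha>. dist (q n) (g x) < d})"
    define E where "E = (\<lambda>n. A \<inter> disjointed B n)"
    have Bs: "range B \<subseteq> sets \<alpha>"
      by (auto simp: B_def)
    have Es: "E n \<in> sets \<alpha>" for n
      using A sets.range_disjointed_sets[OF Bs] by (auto simp: E_def)
    have Ed: "disjoint_family E"
      using disjoint_family_disjointed[of B] by (fastforce simp: disjoint_family_on_def E_def)
    have UB: "(\<Union>n. B n) = space \<alpha>"
      using near by (auto simp: B_def)
    have UE: "(\<Union>n. E n) = A"
      using sets.sets_into_space[OF A] UB UN_disjointed_eq[of B] by (auto simp: E_def)
    have EB: "dist (q n) (g x) < d" if "x \<in> E n" for x n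
      using that disjointed_subset[of B n] by (auto simp: E_def B_def)
    have E1: "emeasure ?D (E n) \<le> ennreal (norm (density_vector \<alpha> g (E n))) + ennreal (2 * d) * emeasure \<alpha> (E n)" for n
    proof -
      have int: "set_integrable \<alpha> (E n) g" "set_integrable \<alpha> (E n) (\<lambda>x. norm (g x))"
        using Es g integrable_norm[OF g] by (auto intro!: set_integrable_of_integrable)
      have const: "set_integrable \<alpha> (E n) (\<lambda>_. q n)" "set_integrable \<alpha> (E n) (\<lambda>_. c)" for c :: real
        using Es by (auto intro!: set_integrable_of_integrable)
      have m: "(LINT x:E n|\<alpha>. q n) = measure \<alpha> (E n) *\<^sub>R q n" "(LINT x:E n|\<alpha>. c) = measure \<alpha> (E n) * c"
        for c :: real
      proof -
        have i: "integrable \<alpha> (indicat_real (E n))"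
          using Es[of n] by (auto intro!: integrable_real_indicator simp: emeasure_eq_measure)
        show "(LINT x:E n|\<alpha>. q n) = measure \<alpha> (E n) *\<^sub>R q n" "(LINT x:E n|\<alpha>. c) = measure \<alpha> (E n) * c"
          using sets.sets_into_space[OF Es[of n]] integral_scaleR_left[of "q n" \<alpha> "indicat_real (E n)"] i
          by (auto simp: set_lebesgue_integral_def Int_absorb2)
      qed
      have "norm (LINT x:E n|\<alpha>. g x - q n) \<le> (LINT x:E n|\<alpha>. norm (g x - q n))"
        using int const by (intro set_integral_norm_bound set_integral_diff) auto
      also have "\<dots> \<le> (LINT x:E n|\<alpha>. d)"
      proof (rule set_integral_mono)
        show "set_integrable \<alpha> (E n) (\<lambda>x. norm (g x - q n))"
          using integrable_norm[OF Bochner_Integration.integrable_diff[OF g integrable_const, of "q n"]] Es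
          by (auto intro!: set_integrable_of_integrable)
      qed (use EB const in \<open>auto simp: dist_norm norm_minus_commute intro: less_imp_le\<close>)
      finally have 1: "norm ((LINT x:E n|\<alpha>. g x) - measure \<alpha> (E n) *\<^sub>R q n) \<le> measure \<alpha> (E n) * d"
        using int const m by simp
      have "(LINT x:E n|\<alpha>. norm (g x)) \<le> (LINT x:E n|\<alpha>. norm (q n) + d)"
      proof (rule set_integral_mono)
        fix x assume "x \<in> E n"
        then show "norm (g x) \<le> norm (q n) + d"
          using EB[of x n] norm_triangle_sub[of "g x" "q n"] by (simp add: dist_norm norm_minus_commute)
      qed (use int const in auto)
      then have 2: "(LINT x:E n|\<alpha>. norm (g x)) \<le> norm (measure \<alpha> (E n) *\<^sub>R q n) + measure \<alpha> (E n) * d"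
        unfolding m by (simp add: algebra_simps)
      \<comment> \<open>The constant replaces \<open>g\<close> once under the norm and once outside
        it, each time at the cost \<open>d * measure \<alpha> (E n)\<close>; hence the factor
        2.\<close>
      have 3: "(LINT x:E n|\<alpha>. norm (g x)) \<le> norm (LINT x:E n|\<alpha>. g x) + 2 * d * measure \<alpha> (E n)"
        using 1 2 norm_triangle_sub[of "measure \<alpha> (E n) *\<^sub>R q n" "LINT x:E n|\<alpha>. g x"]
        by (simp add: norm_minus_commute algebra_simps)
      have "emeasure ?D (E n) = ennreal (LINT x:E n|\<alpha>. norm (g x))"
        using int(2) Es unfolding set_lebesgue_integral_def set_integrable_def
        by (subst nn_integral_eq_integral[symmetric])
          (auto simp: emeasure_density intro!: nn_integral_cong split: split_indicator)
      also have "\<dots> \<le> ennreal (norm (LINT x:E n|\<alpha>. g x) + 2 * d * measure \<alpha> (E n))"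
        by (rule ennreal_leI[OF 3])
      finally show ?thesis
        using \<open>0 < d\<close> Es
        by (simp add: density_vector_def emeasure_eq_measure ennreal_mult'[symmetric])
    qed
    have "emeasure ?D A = (\<Sum>n. emeasure ?D (E n))"
      using suminf_emeasure[of E ?D] Es Ed UE by (simp add: image_subset_iff)
    also have "\<dots> \<le> (\<Sum>n. ennreal (norm (density_vector \<alpha> g (E n))) + ennreal (2 * d) * emeasure \<alpha> (E n))"
      by (intro suminf_le E1) auto
    also have "\<dots> = (\<Sum>n. ennreal (norm (density_vector \<alpha> g (E n)))) + ennreal (2 * d) * (\<Sum>n. emeasure \<alpha> (E n))"
      by (simp add: suminf_add[symmetric])
    also have "(\<Sum>n. emeasure \<alpha> (E n)) = emeasure \<alpha> A"
      using suminf_emeasure[of E \<alpha>] Es Ed UE by (simp add: image_subset_iff)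
    also have "ennreal (2 * d) * emeasure \<alpha> A \<le> ennreal e"
      using dA \<open>0 < d\<close> by (simp add: emeasure_eq_measure ennreal_mult'[symmetric] ennreal_leI)
    also have "(\<Sum>n. ennreal (norm (density_vector \<alpha> g (E n)))) \<le> variation \<Omega> (density_vector \<alpha> g) A"
      unfolding variation_def using Es Ed UE S by (intro SUP_upper) (auto simp: partitions_def)
    finally show "emeasure ?D A \<le> variation \<Omega> (density_vector \<alpha> g) A + ennreal e"
      by (simp add: add_mono)
  qed
qed

lemma total_variation_density:
  assumes \<alpha>: "\<alpha> \<in> nonneg_measures \<Omega>" and g: "integrable \<alpha> g"
  shows "total_variation \<Omega> (density_vector \<alpha> g) = density \<alpha> (\<lambda>x. ennreal (norm (g x)))"
    (is "_ = ?D")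
proof -
  note S = nonneg_measuresD[OF \<alpha>]
  have "total_variation \<Omega> (density_vector \<alpha> g) = measure_of (space ?D) (sets ?D) (emeasure ?D)"
    unfolding total_variation_eq S(1)[symmetric]
    using variation_density[OF \<alpha> g] sets.sigma_sets_eq[of \<alpha>] sets.space_closed[of \<alpha>] S(3)
    by (auto intro!: measure_of_eq)
  then show ?thesis
    by (simp only: measure_of_of_measure)
qed

text \<open>On the set \<open>B\<close> where \<open>norm (g x) > 1\<close> the domination gives a
  non-positive integral of the positive function \<open>norm (g x) - 1\<close>, so \<open>B\<close>
  must be null.\<close>

lemma density_norm_le_iff:
  fixes g :: "'a::euclidean_space \<Rightarrow> 'b::euclidean_space"
  assumes \<alpha>: "\<alpha> \<in> nonneg_measures \<Omega>" and g: "integrable \<alpha> g"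
  shows "measure_le_on \<Omega> (density \<alpha> (\<lambda>x. ennreal (norm (g x)))) \<alpha> \<longleftrightarrow> (AE x in \<alpha>. norm (g x) \<le> 1)"
proof -
  note S = nonneg_measuresD[OF \<alpha>]
  interpret finite_measure \<alpha> by (rule S)
  have g_meas[measurable]: "g \<in> borel_measurable \<alpha>"
    using g by auto
  show ?thesis
  proof
    assume le: "measure_le_on \<Omega> (density \<alpha> (\<lambda>x. ennreal (norm (g x)))) \<alpha>"
    define B where "B = {x \<in> space \<alpha>. 1 < norm (g x)}"
    have B[measurable]: "B \<in> sets \<alpha>"
      by (simp add: B_def)
    have iB: "set_integrable \<alpha> B (\<lambda>x. norm (g x))" "set_integrable \<alpha> B (\<lambda>x. 1::real)"
      using integrable_norm[OF g] by (auto intro!: set_integrable_of_integrable)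
    have "ennreal (LINT x:B|\<alpha>. norm (g x)) = emeasure (density \<alpha> (\<lambda>x. ennreal (norm (g x)))) B"
      using iB(1) unfolding set_lebesgue_integral_def set_integrable_def
      by (subst nn_integral_eq_integral[symmetric])
        (auto simp: emeasure_density intro!: nn_integral_cong split: split_indicator)
    also have "\<dots> \<le> emeasure \<alpha> B"
      using le B S by (auto simp: measure_le_on_def)
    finally have "(LINT x:B|\<alpha>. norm (g x)) \<le> measure \<alpha> B"
      by (simp add: emeasure_eq_measure)
    moreover have "(LINT x:B|\<alpha>. 1::real) = measure \<alpha> B"
      using B sets.sets_into_space[OF B] by (simp add: set_lebesgue_integral_def Int_absorb2)
    ultimately have "(LINT x:B|\<alpha>. norm (g x) - 1) \<le> 0"
      using iB by simp
    moreover have "0 \<le> (LINT x:B|\<alpha>. norm (g x) - 1)"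
      unfolding set_lebesgue_integral_def by (intro integral_nonneg_AE) (auto simp: B_def split: split_indicator)
    ultimately have "(\<integral>x. indicator B x *\<^sub>R (norm (g x) - 1) \<partial>\<alpha>) = 0"
      unfolding set_lebesgue_integral_def by simp
    moreover have "integrable \<alpha> (\<lambda>x. indicator B x *\<^sub>R (norm (g x) - 1))"
      using set_integral_diff(1)[OF iB] by (simp add: set_integrable_def)
    ultimately have "AE x in \<alpha>. indicator B x *\<^sub>R (norm (g x) - 1) = 0"
      by (subst (asm) integral_nonneg_eq_0_iff_AE) (auto simp: B_def split: split_indicator)
    then show "AE x in \<alpha>. norm (g x) \<le> 1"
      using AE_space by eventually_elim (auto simp: B_def indicator_def split: if_splits)
  next
    assume le: "AE x in \<alpha>. norm (g x) \<le> 1"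
    show "measure_le_on \<Omega> (density \<alpha> (\<lambda>x. ennreal (norm (g x)))) \<alpha>"
      unfolding measure_le_on_def S(1)[symmetric]
    proof
      fix A assume A[measurable]: "A \<in> sets \<alpha>"
      have "emeasure (density \<alpha> (\<lambda>x. ennreal (norm (g x)))) A = (\<integral>\<^sup>+x. ennreal (norm (g x)) * indicator A x \<partial>\<alpha>)"
        by (simp add: emeasure_density)
      also have "\<dots> \<le> (\<integral>\<^sup>+x. indicator A x \<partial>\<alpha>)"
        using le by (intro nn_integral_mono_AE, eventually_elim) (auto split: split_indicator)
      finally show "emeasure (density \<alpha> (\<lambda>x. ennreal (norm (g x)))) A \<le> emeasure \<alpha> A"
        by simp
    qed
  qed
qed

subsection \<open>Uniform convexity of \<open>\<bar>t\<bar>\<^sup>p\<close>\<close>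

text \<open>The mean value theorem on the two halves compares the increments through the strictly
  increasing derivative. The intermediate points are positive even for \<open>a = 0\<close>, where
  only continuity is used.\<close>

lemma powr_midpoint_strict:
  fixes a b p :: real
  assumes "1 < p" "0 \<le> a" "a < b"
  shows "((a + b) / 2) powr p < (a powr p + b powr p) / 2"
proof -
  define m where "m = (a + b) / 2"
  have m: "a < m" "m < b" "0 < m" "m - a = b - m"
    using assms by (auto simp: m_def field_simps)
  have deriv: "((\<lambda>x. x powr p) has_real_derivative p * x powr (p - 1)) (at x)" if "0 < x" for x
    using that by (auto intro!: derivative_eq_intros)
  have cont: "continuous_on {u..v} (\<lambda>x::real. x powr p)" if "0 \<le> u" for u v
    using assms(1) that by (intro continuous_on_powr') (auto intro!: continuous_intros)
  have mvt: "\<exists>z. u < z \<and> z < v \<and> v powr p - u powr p = (v - u) * (p * z powr (p - 1))"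
    if uv: "0 \<le> u" "u < v" for u v
  proof -
    obtain l z where z: "u < z" "z < v" "((\<lambda>x. x powr p) has_real_derivative l) (at z)"
        "v powr p - u powr p = (v - u) * l"
      using MVT[OF uv(2) cont[OF uv(1)]] deriv uv
      by (metis le_less_trans real_differentiable_def)
    then have "l = p * z powr (p - 1)"
      using deriv[of z] z uv by (intro DERIV_unique[OF z(3)]) auto
    then show ?thesis
      using z by auto
  qed
  obtain y where y: "a < y" "y < m" "m powr p - a powr p = (m - a) * (p * y powr (p - 1))"
    using mvt[OF assms(2) m(1)] by auto
  obtain z where z: "m < z" "z < b" "b powr p - m powr p = (b - m) * (p * z powr (p - 1))"
    using mvt[of m b] m by auto
  have "y powr (p - 1) < z powr (p - 1)"
    using y z assms by (intro powr_less_mono2) auto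
  then have "m powr p - a powr p < b powr p - m powr p"
    unfolding y(3) z(3) m(4) using assms m by simp
  then show ?thesis
    by (simp add: m_def)
qed

lemma abs_powr_midpoint_le:
  fixes u v p :: real
  assumes "1 < p"
  shows "\<bar>(u + v) / 2\<bar> powr p \<le> (\<bar>u\<bar> powr p + \<bar>v\<bar> powr p) / 2"
proof -
  have "\<bar>(u + v) / 2\<bar> powr p \<le> ((\<bar>u\<bar> + \<bar>v\<bar>) / 2) powr p"
    using assms by (intro powr_mono2) auto
  also have "\<dots> \<le> (\<bar>u\<bar> powr p + \<bar>v\<bar> powr p) / 2"
    using powr_midpoint_strict[OF assms, of "\<bar>u\<bar>" "\<bar>v\<bar>"] powr_midpoint_strict[OF assms, of "\<bar>v\<bar>" "\<bar>u\<bar>"]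
    by (cases "\<bar>u\<bar>" "\<bar>v\<bar>" rule: linorder_cases) (auto simp: add.commute)
  finally show ?thesis .
qed

text \<open>If the absolute values agree, then \<open>v = - u\<close> and the left side is 0;
  otherwise strictness comes from unequal non-negative numbers.\<close>

lemma abs_powr_midpoint_strict:
  fixes u v p :: real
  assumes "1 < p" "u \<noteq> v"
  shows "\<bar>(u + v) / 2\<bar> powr p < (\<bar>u\<bar> powr p + \<bar>v\<bar> powr p) / 2"
proof (cases "\<bar>u\<bar> = \<bar>v\<bar>")
  case True
  then have "v = - u" "u \<noteq> 0"
    using assms(2) by auto
  then show ?thesis
    using assms(1) by simp
next
  case False
  have "\<bar>(u + v) / 2\<bar> powr p \<le> ((\<bar>u\<bar> + \<bar>v\<bar>) / 2) powr p"
    using assms by (intro powr_mono2) auto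
  also have "\<dots> < (\<bar>u\<bar> powr p + \<bar>v\<bar> powr p) / 2"
    using False powr_midpoint_strict[OF assms(1), of "\<bar>u\<bar>" "\<bar>v\<bar>"] powr_midpoint_strict[OF assms(1), of "\<bar>v\<bar>" "\<bar>u\<bar>"]
    by (cases "\<bar>u\<bar>" "\<bar>v\<bar>" rule: linorder_cases) (auto simp: add.commute)
  finally show ?thesis .
qed

lemma abs_diff_powr_le:
  fixes u v p :: real
  assumes "0 < p"
  shows "\<bar>u - v\<bar> powr p \<le> 2 powr p * (\<bar>u\<bar> powr p + \<bar>v\<bar> powr p)"
proof -
  have "\<bar>u - v\<bar> powr p \<le> (2 * max \<bar>u\<bar> \<bar>v\<bar>) powr p"
    using assms by (intro powr_mono2) auto
  also have "\<dots> = 2 powr p * (max \<bar>u\<bar> \<bar>v\<bar>) powr p"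
    by (simp add: powr_mult)
  also have "\<dots> \<le> 2 powr p * (\<bar>u\<bar> powr p + \<bar>v\<bar> powr p)"
    by (simp add: max_def)
  finally show ?thesis .
qed

text \<open>A substitute for the Clarkson inequalities that treats all exponents \<open>p > 1\<close> at once:
  by homogeneity it suffices to consider a compact set of pairs, where the strict convexity of
  \<open>\<bar>t\<bar>\<^sup>p\<close> gives a positive lower bound of the convexity gap.\<close>

lemma abs_powr_uniform_convexity:
  fixes p \<epsilon> :: real
  assumes p: "1 < p" and \<epsilon>: "0 < \<epsilon>"
  obtains C where "0 < C"
    "\<And>u v :: real. \<bar>u - v\<bar> powr p \<le> \<epsilon> * (\<bar>u\<bar> powr p + \<bar>v\<bar> powr p)
       + C * ((\<bar>u\<bar> powr p + \<bar>v\<bar> powr p) / 2 - \<bar>(u + v) / 2\<bar> powr p)"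
proof -
  define gap where "gap = (\<lambda>(u, v). (\<bar>u\<bar> powr p + \<bar>v\<bar> powr p) / 2 - \<bar>(u + v) / 2\<bar> powr p)"
  \<comment> \<open>After normalisation these are exactly the pairs for which the summand with
    \<epsilon> is not already strictly larger than the left side. The diagonal is excluded because
    \<epsilon> is positive, so the gap cannot vanish on this set.\<close>
  define S where "S = {(u, v). \<bar>u\<bar> powr p + \<bar>v\<bar> powr p = 1 \<and> \<epsilon> \<le> \<bar>u - v\<bar> powr p}"
  have cont: "continuous_on T (\<lambda>x. \<bar>f x\<bar> powr p)" if "continuous_on T f" for T and f :: "real \<times> real \<Rightarrow> real"
    using that p by (intro continuous_on_powr') (auto intro!: continuous_intros)
  have "closed S"
    unfolding S_def case_prod_beta'
    by (intro closed_Collect_conj closed_Collect_eq closed_Collect_le continuous_intros cont)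
  moreover have "S \<subseteq> {-1..1} \<times> {-1..1}"
  proof (clarsimp simp: S_def)
    fix u v :: real assume *: "\<bar>u\<bar> powr p + \<bar>v\<bar> powr p = 1"
    have "\<bar>w\<bar> \<le> 1" if "\<bar>w\<bar> powr p \<le> 1" for w :: real
    proof (rule ccontr)
      assume "\<not> \<bar>w\<bar> \<le> 1"
      then have "1 < \<bar>w\<bar> powr p"
        using p by (intro gr_one_powr) auto
      with that show False by simp
    qed
    then have "\<bar>u\<bar> \<le> 1" "\<bar>v\<bar> \<le> 1"
      using * powr_ge_zero[of "\<bar>u\<bar>" p] powr_ge_zero[of "\<bar>v\<bar>" p] by (smt (verit))+
    then show "-1 \<le> u \<and> u \<le> 1 \<and> -1 \<le> v \<and> v \<le> 1"
      by linarith
  qed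
  ultimately have "compact S"
    by (metis compact_Icc compact_Times compact_Int_closed inf.absorb_iff2)
  have contg: "continuous_on S gap"
    unfolding gap_def case_prod_beta' by (intro continuous_intros cont)  auto
  have pos: "0 < gap x" if "x \<in> S" for x
    using that \<epsilon> abs_powr_midpoint_strict[OF p, of "fst x" "snd x"]
    by (cases "fst x = snd x") (auto simp: S_def gap_def case_prod_beta')
  obtain d where d: "0 < d" "\<And>x. x \<in> S \<Longrightarrow> d \<le> gap x"
  proof (cases "S = {}")
    case True
    then show ?thesis using that[of 1] by auto
  next
    case False
    then obtain x where "x \<in> S" "\<And>y. y \<in> S \<Longrightarrow> gap x \<le> gap y"
      using continuous_attains_inf[OF \<open>compact S\<close> False contg] by auto
    then show ?thesis using that[of "gap x"] pos by auto
  qed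
  \<comment> \<open>The left side never exceeds \<open>2 powr p * t\<close>, and the gap is at least
    \<open>d * t\<close> in the critical case; the quotient of the two is the constant.\<close>
  define C where "C = 2 powr p / d"
  show ?thesis
  proof (rule that[of C])
    show "0 < C"
      using d by (simp add: C_def)
    fix u v :: real
    define t where "t = \<bar>u\<bar> powr p + \<bar>v\<bar> powr p"
    define g where "g = t / 2 - \<bar>(u + v) / 2\<bar> powr p"
    have "0 \<le> t" "0 \<le> g"
      using abs_powr_midpoint_le[OF p, of u v] by (auto simp: t_def g_def)
    have "\<bar>u - v\<bar> powr p \<le> \<epsilon> * t + C * g"
    proof (cases "\<bar>u - v\<bar> powr p \<le> \<epsilon> * t")
      case True
      then show ?thesis
        using \<open>0 < C\<close> \<open>0 \<le> g\<close> by (smt (verit) mult_nonneg_nonneg)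
    next
      case False
      have "t \<noteq> 0"
      proof
        assume "t = 0"
        then have "u = 0" "v = 0"
          unfolding t_def by (auto simp: add_nonneg_eq_0_iff)
        with False show False by (simp add: t_def)
      qed
      with \<open>0 \<le> t\<close> have "0 < t" by simp
      \<comment> \<open>Both the gap and the left side are homogeneous of degree \<open>p\<close>,
        so division by the \<open>p\<close>-th root of \<open>t\<close> moves the pair into
        \<open>S\<close>.\<close>
      define s where "s = t powr (1 / p)"
      have "0 < s" and sp: "s powr p = t"
        using \<open>0 < t\<close> p by (auto simp: s_def powr_powr)
      have scale: "\<bar>w / s\<bar> powr p = \<bar>w\<bar> powr p / t" for w
        using \<open>0 < s\<close> by (simp add: powr_divide sp)
      have "(u / s, v / s) \<in> S"
      proof -
        have "\<bar>u / s\<bar> powr p + \<bar>v / s\<bar> powr p = 1"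
          unfolding scale using \<open>0 < t\<close> by (simp add: add_divide_distrib[symmetric] t_def[symmetric])
        moreover have "\<epsilon> \<le> \<bar>u / s - v / s\<bar> powr p"
          unfolding diff_divide_distrib[symmetric] scale using False \<open>0 < t\<close> by (simp add: field_simps)
        ultimately show ?thesis by (simp add: S_def)
      qed
      then have "d \<le> gap (u / s, v / s)"
        by (rule d)
      also have "gap (u / s, v / s) = g / t"
      proof -
        have eq: "(u / s + v / s) / 2 = ((u + v) / 2) / s"
          by (simp add: add_divide_distrib)
        have "gap (u / s, v / s) = (\<bar>u\<bar> powr p / t + \<bar>v\<bar> powr p / t) / 2 - \<bar>(u + v) / 2\<bar> powr p / t"
          unfolding gap_def split eq scale ..
        also have "\<dots> = ((\<bar>u\<bar> powr p + \<bar>v\<bar> powr p) / 2 - \<bar>(u + v) / 2\<bar> powr p) / t"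
          by (simp add: add_divide_distrib diff_divide_distrib)
        also have "\<dots> = g / t"
          by (simp only: g_def t_def)
        finally show ?thesis .
      qed
      finally have "d * t \<le> g"
        using \<open>0 < t\<close> by (simp add: field_simps)
      have "\<bar>u - v\<bar> powr p \<le> 2 powr p * t"
        unfolding t_def using p by (intro abs_diff_powr_le) auto
      also have "\<dots> = C * (d * t)"
        using d by (simp add: C_def)
      also have "\<dots> \<le> C * g"
        using \<open>d * t \<le> g\<close> \<open>0 < C\<close> by simp
      finally show ?thesis
        using \<epsilon> \<open>0 < t\<close> by (smt (verit) mult_pos_pos)
    qed
    then show "\<bar>u - v\<bar> powr p \<le> \<epsilon> * (\<bar>u\<bar> powr p + \<bar>v\<bar> powr p)
       + C * ((\<bar>u\<bar> powr p + \<bar>v\<bar> powr p) / 2 - \<bar>(u + v) / 2\<bar> powr p)"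
      by (simp add: t_def g_def)
  qed
qed

subsection \<open>Minimising sequences and convergence in \<open>L\<^sup>p\<close>\<close>

text \<open>Along a fast subsequence the weighted \<open>p\<close>-th powers of consecutive
  differences have an integrable sum. Hence at almost every point the differences are eventually
  below \<open>(1/2) ^ n\<close>, and the telescoping series converges absolutely. Working with
  \<open>p\<close>-th powers throughout makes a triangle inequality for the \<open>L^p\<close> norm
  dispensable.\<close>

lemma AE_convergent_subseq:
  fixes u :: "nat \<Rightarrow> 'a \<Rightarrow> 'b::{banach, second_countable_topology}" and p :: real
  assumes [measurable]: "\<And>n. u n \<in> borel_measurable M" and p: "0 < p"
    and Cauchy: "\<And>e. 0 < e \<Longrightarrow> \<exists>N. \<forall>i\<ge>N. \<forall>j\<ge>N. (\<integral>\<^sup>+x. ennreal (norm (u i x - u j x) powr p) \<partial>M) < ennreal e"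
  obtains r where "strict_mono r" "AE x in M. convergent (\<lambda>n. u (r n) x)"
proof -
  \<comment> \<open>The weight is a \<open>p\<close>-th power, so that
    \<open>D n x powr p < c n\<close> gives \<open>D n x < (1/2) ^ n\<close> by
    monotonicity.\<close>
  define c where "c = (\<lambda>n. ((1/2)^n) powr p :: real)"
  have c: "0 < c n" for n
    by (simp add: c_def)
  have "\<exists>N. \<forall>i\<ge>N. \<forall>j\<ge>N. (\<integral>\<^sup>+x. ennreal (norm (u i x - u j x) powr p) \<partial>M) < ennreal ((1/2)^n * c n)" for n
    using c[of n] by (intro Cauchy) simp
  then obtain N where N: "\<And>n i j. N n \<le> i \<Longrightarrow> N n \<le> j \<Longrightarrow>
      (\<integral>\<^sup>+x. ennreal (norm (u i x - u j x) powr p) \<partial>M) < ennreal ((1/2)^n * c n)"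
    by metis
  \<comment> \<open>The sum dominates every threshold \<open>N k\<close> with
    \<open>k \<le> n\<close>, and the summand \<open>n\<close> makes the sequence strictly
    increasing.\<close>
  define r where "r = (\<lambda>n. (\<Sum>k\<le>n. N k) + n)"
  have r: "strict_mono r"
    by (auto simp: r_def strict_mono_Suc_iff)
  have rN: "N n \<le> r m" if "n \<le> m" for n m
    using member_le_sum[of n "{..m}" N] that by (simp add: r_def)
  define D where "D = (\<lambda>n x. norm (u (r (Suc n)) x - u (r n) x))"
  have [measurable]: "D n \<in> borel_measurable M" for n
    by (simp add: D_def)
  have "(\<integral>\<^sup>+x. (\<Sum>n. ennreal (D n x powr p / c n)) \<partial>M) = (\<Sum>n. \<integral>\<^sup>+x. ennreal (D n x powr p / c n) \<partial>M)"
    by (intro nn_integral_suminf) simp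
  also have "\<dots> \<le> (\<Sum>n. ennreal ((1/2)^n))"
  proof (intro suminf_le)
    fix n
    have "(\<integral>\<^sup>+x. ennreal (D n x powr p / c n) \<partial>M) = (\<integral>\<^sup>+x. ennreal (1 / c n) * ennreal (D n x powr p) \<partial>M)"
      using c[of n] by (intro nn_integral_cong) (simp add: ennreal_mult'[symmetric])
    also have "\<dots> = ennreal (1 / c n) * (\<integral>\<^sup>+x. ennreal (D n x powr p) \<partial>M)"
      by (intro nn_integral_cmult) simp
    also have "\<dots> \<le> ennreal (1 / c n) * ennreal ((1/2)^n * c n)"
      unfolding D_def using rN by (intro mult_left_mono less_imp_le[OF N]) auto
    also have "\<dots> = ennreal ((1/2)^n)"
      using c[of n] by (simp add: ennreal_mult'[symmetric])
    finally show "(\<integral>\<^sup>+x. ennreal (D n x powr p / c n) \<partial>M) \<le> ennreal ((1/2)^n)" .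
  qed auto
  also have "\<dots> < \<infinity>"
    by (simp add: less_top ennreal_suminf_neq_top)
  finally have "AE x in M. (\<Sum>n. ennreal (D n x powr p / c n)) \<noteq> \<infinity>"
    by (intro nn_integral_PInf_AE) auto
  then have "AE x in M. convergent (\<lambda>n. u (r n) x)"
  proof eventually_elim
    case (elim x)
    have "summable (\<lambda>n. D n x powr p / c n)"
      using elim c by (intro summable_suminf_not_top) (auto simp: less_imp_le)
    then have "(\<lambda>n. D n x powr p / c n) \<longlonglongrightarrow> 0"
      by (rule summable_LIMSEQ_zero)
    then have "\<forall>\<^sub>F n in sequentially. D n x powr p / c n < 1"
      by (rule order_tendstoD) simp
    then have "\<forall>\<^sub>F n in sequentially. norm (D n x) \<le> (1/2)^n"
    proof eventually_elim
      case (elim n)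
      then have "D n x powr p < ((1/2)^n) powr p"
        using c[of n] by (simp add: c_def)
      then have "D n x < (1/2)^n"
        using p powr_mono2[of p "(1/2)^n" "D n x"] by (force simp: not_less[symmetric])
      then show ?case
        by (simp add: D_def)
    qed
    then have "summable (\<lambda>n. D n x)"
      by (rule summable_comparison_test_ev) simp
    then have "summable (\<lambda>n. u (r (Suc n)) x - u (r n) x)"
      unfolding D_def by (rule summable_norm_cancel)
    then have "convergent (\<lambda>n. u (r n) x - u (r 0) x)"
      by (simp add: summable_iff_convergent sum_lessThan_telescope[of "\<lambda>n. u (r n) x"])
    then show ?case
      using convergent_diff_const_right_iff by blast
  qed
  with r show ?thesis by (rule that)
qed

text \<open>Minimise \<open>\<Phi>\<close> approximately over the sublevel sets \<open>{J \<le> inf J + 1/k}\<close>: these are nested,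
  so midpoints of late terms compete with early ones.\<close>

lemma minimizing_sequence_small_gap:
  fixes J \<Phi> :: "'x \<Rightarrow> real" and mid :: "'x \<Rightarrow> 'x \<Rightarrow> 'x"
  assumes ne: "K \<noteq> {}"
    and mid: "\<And>x y. x \<in> K \<Longrightarrow> y \<in> K \<Longrightarrow> mid x y \<in> K"
    and conv: "\<And>x y. x \<in> K \<Longrightarrow> y \<in> K \<Longrightarrow> J (mid x y) \<le> (J x + J y) / 2"
    and J: "\<And>x. x \<in> K \<Longrightarrow> 0 \<le> J x" and \<Phi>: "\<And>x. x \<in> K \<Longrightarrow> 0 \<le> \<Phi> x"
    and bd: "\<And>x. x \<in> K \<Longrightarrow> \<Phi> x \<le> A + B * J x" and B: "0 \<le> B"
  obtains x where "\<And>k::nat. x k \<in> K" "(\<lambda>k. J (x k)) \<longlonglongrightarrow> Inf (J ` K)"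
    "\<And>e. 0 < e \<Longrightarrow> \<exists>N. \<forall>i\<ge>N. \<forall>j\<ge>N. (\<Phi> (x i) + \<Phi> (x j)) / 2 - \<Phi> (mid (x i) (x j)) < e"
proof -
  define m where "m = Inf (J ` K)"
  have bdJ: "bdd_below (J ` K)"
    using J by (auto intro!: bdd_belowI[of _ 0])
  have mle: "m \<le> J x" if "x \<in> K" for x
    unfolding m_def using that by (intro cInf_lower bdJ) auto
  define C where "C = (\<lambda>k. {x \<in> K. J x \<le> m + 1 / real (Suc k)})"
  have Cne: "C k \<noteq> {}" for k
  proof -
    have "\<exists>y\<in>J ` K. y < m + 1 / real (Suc k)"
      unfolding m_def using ne bdJ by (intro cInf_lessD) auto
    then show ?thesis
      by (force simp: C_def)
  qed
  have Cmono: "C l \<subseteq> C k" if "k \<le> l" for k l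
  proof -
    have "1 / real (Suc l) \<le> 1 / real (Suc k)"
      using that by (intro divide_left_mono) auto
    then show ?thesis
      by (auto simp: C_def)
  qed
  define w where "w = (\<lambda>k. Inf (\<Phi> ` C k))"
  have bdP: "bdd_below (\<Phi> ` C k)" for k
    using \<Phi> by (auto simp: C_def intro!: bdd_belowI[of _ 0])
  have wle: "w k \<le> \<Phi> x" if "x \<in> C k" for x k
    unfolding w_def using that by (intro cInf_lower bdP) auto
  have "incseq w"
    unfolding w_def incseq_def using Cne bdP Cmono
    by (intro allI impI cInf_superset_mono image_mono) auto
  \<comment> \<open>The increasing infima converge because the growth bound on \<Phi> applies to any
    element of \<open>C k\<close>, where \<open>J\<close> is at most \<open>m + 1\<close>.\<close>
  have "w k \<le> A + B * (m + 1)" for k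
  proof -
    obtain x where x: "x \<in> C k"
      using Cne by blast
    then have "J x \<le> m + 1 / real (Suc k)"
      by (simp add: C_def)
    also have "\<dots> \<le> m + 1"
      by simp
    finally have "J x \<le> m + 1" .
    then have "A + B * J x \<le> A + B * (m + 1)"
      using B by (simp add: mult_left_mono)
    then show ?thesis
      using wle[OF x] bd[of x] x by (auto simp: C_def)
  qed
  then obtain W where W: "w \<longlonglongrightarrow> W" "\<And>k. w k \<le> W"
    using incseq_convergent[OF \<open>incseq w\<close>] by metis
  have "\<exists>x\<in>C k. \<Phi> x < w k + 1 / real (Suc k)" for k
  proof -
    have "\<exists>y\<in>\<Phi> ` C k. y < w k + 1 / real (Suc k)"
      unfolding w_def using Cne bdP by (intro cInf_lessD) auto
    then show ?thesis by auto
  qed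
  then obtain x where xC: "\<And>k. x k \<in> C k" and x\<Phi>: "\<And>k. \<Phi> (x k) < w k + 1 / real (Suc k)"
    by metis
  have inv0: "(\<lambda>n. 1 / real (Suc n)) \<longlonglongrightarrow> 0"
    using LIMSEQ_inverse_real_of_nat by (simp add: inverse_eq_divide)
  show ?thesis
  proof (rule that)
    show xK: "x k \<in> K" for k
      using xC[of k] by (simp add: C_def)
    have "(\<lambda>k. J (x k)) \<longlonglongrightarrow> m"
    proof (rule real_tendsto_sandwich)
      show "\<forall>\<^sub>F k in sequentially. m \<le> J (x k)"
        using mle xK by simp
      show "\<forall>\<^sub>F k in sequentially. J (x k) \<le> m + 1 / real (Suc k)"
        using xC by (simp add: C_def)
      show "(\<lambda>k. m + 1 / real (Suc k)) \<longlonglongrightarrow> m"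
        using tendsto_add[OF tendsto_const inv0, of m] by simp
    qed simp
    then show "(\<lambda>k. J (x k)) \<longlonglongrightarrow> Inf (J ` K)"
      by (simp add: m_def)
    fix e :: real assume "0 < e"
    have "(\<lambda>n. W - w n + 1 / real (Suc n)) \<longlonglongrightarrow> W - W + 0"
      by (intro tendsto_intros W inv0)
    then have "\<forall>\<^sub>F n in sequentially. W - w n + 1 / real (Suc n) < e"
      using \<open>0 < e\<close> by (intro order_tendstoD(2)[of _ 0]) auto
    then obtain N where N: "W - w N + 1 / real (Suc N) < e"
      by (auto simp: eventually_sequentially)
    \<comment> \<open>By convexity of \<open>J\<close> the midpoint remains in \<open>C N\<close>,
      so its value is at least \<open>w N\<close>; the values at \<open>x i\<close> and
      \<open>x j\<close> are at most \<open>W + 1 / (N + 1)\<close>. The difference of these bounds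
      is small because \<open>w N\<close> is close to \<open>W\<close>.\<close>
    have "(\<Phi> (x i) + \<Phi> (x j)) / 2 - \<Phi> (mid (x i) (x j)) < e" if ij: "N \<le> i" "N \<le> j" for i j
    proof -
      have up: "\<Phi> (x k) \<le> W + 1 / real (Suc N)" if "N \<le> k" for k
      proof -
        have "1 / real (Suc k) \<le> 1 / real (Suc N)"
          using that by (intro divide_left_mono) auto
        then show ?thesis
          using x\<Phi>[of k] W(2)[of k] by linarith
      qed
      have xN: "x i \<in> C N" "x j \<in> C N"
        using xC Cmono ij by blast+
      have "mid (x i) (x j) \<in> C N"
        using xN mid[of "x i" "x j"] conv[of "x i" "x j"] by (auto simp: C_def)
      then have "w N \<le> \<Phi> (mid (x i) (x j))"
        by (rule wle)
      then show ?thesis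
        using up[OF ij(1)] up[OF ij(2)] N by argo
    qed
    then show "\<exists>N. \<forall>i\<ge>N. \<forall>j\<ge>N. (\<Phi> (x i) + \<Phi> (x j)) / 2 - \<Phi> (mid (x i) (x j)) < e"
      by blast
  qed
qed

section \<open>The spaces \<open>L^p\<close> and their pairing with bounded functions of finite
  support\<close>

definition p_integrable :: "'a measure \<Rightarrow> real \<Rightarrow> ('a \<Rightarrow> real) \<Rightarrow> bool"
  where "p_integrable M p h \<longleftrightarrow> h \<in> borel_measurable M \<and> integrable M (\<lambda>x. \<bar>h x\<bar> powr p)"

lemma p_integrable_cmult:
  assumes "p_integrable M p h"
  shows "p_integrable M p (\<lambda>x. c * h x)"
  using assms by (auto simp: p_integrable_def abs_mult powr_mult)

lemma p_integrable_diff: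
  assumes "0 < p" "p_integrable M p u" "p_integrable M p v"
  shows "p_integrable M p (\<lambda>x. u x - v x)"
  unfolding p_integrable_def
proof
  show "(\<lambda>x. u x - v x) \<in> borel_measurable M"
    using assms by (auto simp: p_integrable_def)
  show "integrable M (\<lambda>x. \<bar>u x - v x\<bar> powr p)"
  proof (rule Bochner_Integration.integrable_bound)
    show "integrable M (\<lambda>x. 2 powr p * (\<bar>u x\<bar> powr p + \<bar>v x\<bar> powr p))"
      using assms by (auto simp: p_integrable_def)
    have [measurable]: "u \<in> borel_measurable M" "v \<in> borel_measurable M"
      using assms by (auto simp: p_integrable_def)
    show "(\<lambda>x. \<bar>u x - v x\<bar> powr p) \<in> borel_measurable M"
      by measurable
    show "AE x in M. norm (\<bar>u x - v x\<bar> powr p) \<le> norm (2 powr p * (\<bar>u x\<bar> powr p + \<bar>v x\<bar> powr p))"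
      using abs_diff_powr_le[OF assms(1)] by (intro AE_I2) simp
  qed
qed

lemma p_integrable_add:
  assumes "0 < p" "p_integrable M p u" "p_integrable M p v"
  shows "p_integrable M p (\<lambda>x. u x + v x)"
  using p_integrable_diff[OF assms(1,2) p_integrable_cmult[OF assms(3), of "-1"]] by simp

text \<open>Such functions induce continuous linear functionals on \<open>L^p\<close> for every
  \<open>p > 1\<close>, even over a measure of infinite total mass.\<close>

definition bounded_finite_support :: "'a measure \<Rightarrow> ('a \<Rightarrow> real) \<Rightarrow> bool"
  where "bounded_finite_support M \<phi> \<longleftrightarrow> \<phi> \<in> borel_measurable M \<and>
    (\<exists>C S. S \<in> sets M \<and> emeasure M S < \<infinity> \<and> (\<forall>x\<in>space M. \<bar>\<phi> x\<bar> \<le> C * indicator S x))"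

text \<open>Above the threshold \<epsilon> the factor \<open>\<bar>y\<bar> powr (1 - p)\<close> is
  at most \<open>\<epsilon> powr (1 - p)\<close>, as the exponent is negative.\<close>

lemma abs_le_powr_bound:
  fixes y \<epsilon> p :: real
  assumes "0 < \<epsilon>" "1 < p"
  shows "\<bar>y\<bar> \<le> \<epsilon> + \<epsilon> powr (1 - p) * \<bar>y\<bar> powr p"
proof (cases "\<bar>y\<bar> \<le> \<epsilon>")
  case True
  then show ?thesis
    using assms by (smt (verit) mult_nonneg_nonneg powr_ge_zero)
next
  case False
  have "\<bar>y\<bar> = \<bar>y\<bar> powr (1 - p) * \<bar>y\<bar> powr p"
    using False assms by (simp add: powr_add[symmetric])
  also have "\<dots> \<le> \<epsilon> powr (1 - p) * \<bar>y\<bar> powr p"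
    using False assms by (intro mult_right_mono powr_mono2') auto
  finally show ?thesis
    using assms by linarith
qed

text \<open>A stand-in for the Hoelder inequality, obtained by integrating
  \<open>abs_le_powr_bound\<close> over the support. The constant depends on neither
  \<open>h\<close> nor \<epsilon>: fixing a small \<epsilon> and then letting the
  \<open>p\<close>-th power integral tend to 0 gives continuity of the pairing.\<close>

lemma pairing_bound:
  assumes \<phi>: "bounded_finite_support M \<phi>" and p: "1 < p"
  obtains D where "0 \<le> D"
    "\<And>h. p_integrable M p h \<Longrightarrow> integrable M (\<lambda>x. \<phi> x * h x)"
    "\<And>h \<epsilon>. p_integrable M p h \<Longrightarrow> 0 < \<epsilon> \<Longrightarrow>
       \<bar>\<integral>x. \<phi> x * h x \<partial>M\<bar> \<le> D * (\<epsilon> + \<epsilon> powr (1 - p) * (\<integral>x. \<bar>h x\<bar> powr p \<partial>M))"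
proof -
  obtain C S where S: "S \<in> sets M" "emeasure M S < \<infinity>" and C: "\<And>x. x \<in> space M \<Longrightarrow> \<bar>\<phi> x\<bar> \<le> C * indicator S x"
    and [measurable]: "\<phi> \<in> borel_measurable M"
    using \<phi> by (auto simp: bounded_finite_support_def)
  have iS: "integrable M (indicat_real S)"
    using S by (intro integrable_real_indicator) auto
  \<comment> \<open>The factor \<open>measure M S + 1\<close> bounds both the coefficient
    \<open>measure M S\<close> of \<epsilon> and the coefficient 1 of the integral.\<close>
  define D where "D = \<bar>C\<bar> * (measure M S + 1)"
  have int: "integrable M (\<lambda>x. \<phi> x * h x)"
    and bd: "\<bar>\<integral>x. \<phi> x * h x \<partial>M\<bar> \<le> D * (\<epsilon> + \<epsilon> powr (1 - p) * (\<integral>x. \<bar>h x\<bar> powr p \<partial>M))"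
    if h: "p_integrable M p h" and \<epsilon>: "0 < \<epsilon>" for h \<epsilon>
  proof -
    let ?b = "\<lambda>x. \<bar>C\<bar> * (\<epsilon> * indicator S x + \<epsilon> powr (1 - p) * \<bar>h x\<bar> powr p)"
    have [measurable]: "h \<in> borel_measurable M" and ih: "integrable M (\<lambda>x. \<bar>h x\<bar> powr p)"
      using h by (auto simp: p_integrable_def)
    have ib: "integrable M ?b"
      using iS ih by (intro integrable_mult_right Bochner_Integration.integrable_add) auto
    have le: "\<bar>\<phi> x * h x\<bar> \<le> ?b x" if "x \<in> space M" for x
    proof (cases "x \<in> S")
      case True
      then have "\<bar>\<phi> x * h x\<bar> \<le> \<bar>C\<bar> * (\<epsilon> + \<epsilon> powr (1 - p) * \<bar>h x\<bar> powr p)"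
        unfolding abs_mult using C[OF that] abs_le_powr_bound[OF \<epsilon> p, of "h x"] by (intro mult_mono) auto
      then show ?thesis
        using True by simp
    next
      case False
      then show ?thesis
        using C[OF that] \<epsilon> by simp
    qed
    show i: "integrable M (\<lambda>x. \<phi> x * h x)"
      using ib le by (intro Bochner_Integration.integrable_bound[OF ib]) (auto intro!: AE_I2 order_trans[OF _ abs_ge_self])
    have "\<bar>\<integral>x. \<phi> x * h x \<partial>M\<bar> \<le> (\<integral>x. \<bar>\<phi> x * h x\<bar> \<partial>M)"
      by (rule integral_abs_bound)
    also have "\<dots> \<le> (\<integral>x. ?b x \<partial>M)"
      using i ib le by (intro integral_mono) auto
    also have "\<dots> = \<bar>C\<bar> * (\<epsilon> * measure M S + \<epsilon> powr (1 - p) * (\<integral>x. \<bar>h x\<bar> powr p \<partial>M))"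
      using iS ih S sets.sets_into_space[OF S(1)] by (simp add: Int_absorb2)
    also have "\<dots> \<le> \<bar>C\<bar> * ((measure M S + 1) * (\<epsilon> + \<epsilon> powr (1 - p) * (\<integral>x. \<bar>h x\<bar> powr p \<partial>M)))"
    proof (rule mult_left_mono)
      have "0 \<le> \<epsilon> powr (1 - p) * (\<integral>x. \<bar>h x\<bar> powr p \<partial>M)"
        by (intro mult_nonneg_nonneg integral_nonneg_AE) auto
      then show "\<epsilon> * measure M S + \<epsilon> powr (1 - p) * (\<integral>x. \<bar>h x\<bar> powr p \<partial>M) \<le> (measure M S + 1) * (\<epsilon> + \<epsilon> powr (1 - p) * (\<integral>x. \<bar>h x\<bar> powr p \<partial>M))"
        using \<epsilon> measure_nonneg[of M S] by (simp add: algebra_simps)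
    qed simp
    finally show "\<bar>\<integral>x. \<phi> x * h x \<partial>M\<bar> \<le> D * (\<epsilon> + \<epsilon> powr (1 - p) * (\<integral>x. \<bar>h x\<bar> powr p \<partial>M))"
      by (simp add: D_def mult.assoc)
  qed
  show ?thesis
    using int[OF _ zero_less_one] bd by (intro that[of D]) (auto simp: D_def)
qed

lemma pairing_tendsto:
  assumes \<phi>: "bounded_finite_support M \<phi>" and p: "1 < p"
    and v: "\<And>n. p_integrable M p (v n)" and h: "p_integrable M p h"
    and lim: "(\<lambda>n. \<integral>x. \<bar>v n x - h x\<bar> powr p \<partial>M) \<longlonglongrightarrow> 0"
  shows "(\<lambda>n. \<integral>x. \<phi> x * v n x \<partial>M) \<longlonglongrightarrow> (\<integral>x. \<phi> x * h x \<partial>M)"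
proof -
  obtain D where D: "0 \<le> D"
    and int: "\<And>h. p_integrable M p h \<Longrightarrow> integrable M (\<lambda>x. \<phi> x * h x)"
    and bd: "\<And>h \<epsilon>. p_integrable M p h \<Longrightarrow> 0 < \<epsilon> \<Longrightarrow>
       \<bar>\<integral>x. \<phi> x * h x \<partial>M\<bar> \<le> D * (\<epsilon> + \<epsilon> powr (1 - p) * (\<integral>x. \<bar>h x\<bar> powr p \<partial>M))"
    using pairing_bound[OF \<phi> p] by blast
  show ?thesis
  proof (rule LIMSEQ_I)
    fix e :: real assume e: "0 < e"
    define \<epsilon> where "\<epsilon> = e / (2 * (D + 1))"
    have \<epsilon>: "0 < \<epsilon>" and D\<epsilon>: "D * \<epsilon> < e"
      using e D mult_nonneg_nonneg[of D e] by (auto simp: \<epsilon>_def field_simps intro: add_nonneg_pos)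
    have "(\<lambda>n. D * (\<epsilon> + \<epsilon> powr (1 - p) * (\<integral>x. \<bar>v n x - h x\<bar> powr p \<partial>M))) \<longlonglongrightarrow> D * (\<epsilon> + \<epsilon> powr (1 - p) * 0)"
      by (intro tendsto_intros lim)
    then have "\<forall>\<^sub>F n in sequentially. D * (\<epsilon> + \<epsilon> powr (1 - p) * (\<integral>x. \<bar>v n x - h x\<bar> powr p \<partial>M)) < e"
      using D\<epsilon> by (intro order_tendstoD(2)[of _ "D * \<epsilon>"]) auto
    then obtain N where N: "\<And>n. N \<le> n \<Longrightarrow> D * (\<epsilon> + \<epsilon> powr (1 - p) * (\<integral>x. \<bar>v n x - h x\<bar> powr p \<partial>M)) < e"
      by (auto simp: eventually_sequentially)
    have "norm ((\<integral>x. \<phi> x * v n x \<partial>M) - (\<integral>x. \<phi> x * h x \<partial>M)) < e" if "N \<le> n" for n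
    proof -
      have "(\<integral>x. \<phi> x * v n x \<partial>M) - (\<integral>x. \<phi> x * h x \<partial>M) = (\<integral>x. \<phi> x * (v n x - h x) \<partial>M)"
        using int[OF v[of n]] int[OF h] by (simp add: right_diff_distrib)
      then show ?thesis
        using bd[OF p_integrable_diff[OF _ v[of n] h] \<epsilon>] N[OF that] p by simp
    qed
    then show "\<exists>N. \<forall>n\<ge>N. norm ((\<integral>x. \<phi> x * v n x \<partial>M) - (\<integral>x. \<phi> x * h x \<partial>M)) < e"
      by blast
  qed
qed

subsection \<open>Constrained minimisation\<close>

text \<open>The two components converge differently. The functions \<open>g\<close> are bounded by 1
  over a finite measure, so dominated convergence handles every term in \<open>g\<close>; the
  functions \<open>h\<close> converge in \<open>L^p\<close>, which suffices for the pairings. Only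
  the \<open>p\<close>-th power term is passed to the limit by a one-sided estimate.\<close>

lemma constrained_minimizer:
  fixes \<alpha> :: "'a measure" and M :: "'c measure" and p :: real
    and T :: "(('a \<Rightarrow> 'b::euclidean_space) \<times> ('c \<Rightarrow> real)) set"
  assumes \<alpha>: "finite_measure \<alpha>" and p: "1 < p" and f: "p_integrable M p f"
    and \<beta>[measurable]: "\<beta> \<in> borel_measurable \<alpha>" and \<beta>_bd: "\<And>x. x \<in> space \<alpha> \<Longrightarrow> 0 \<le> \<beta> x \<and> \<beta> x \<le> B"
    and T: "\<And>G \<phi>. (G, \<phi>) \<in> T \<Longrightarrow> G \<in> borel_measurable \<alpha> \<and> (\<exists>C. \<forall>x\<in>space \<alpha>. norm (G x) \<le> C) \<and>
      bounded_finite_support M \<phi>"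
  defines "K \<equiv> {(g, h). g \<in> borel_measurable \<alpha> \<and> (\<forall>x. norm (g x) \<le> 1) \<and> p_integrable M p h \<and>
      (\<forall>(G, \<phi>)\<in>T. (\<integral>x. G x \<bullet> g x \<partial>\<alpha>) + (\<integral>x. \<phi> x * h x \<partial>M) = 0)}"
    and "J \<equiv> \<lambda>(g, h). 1 / p * (\<integral>x. \<bar>h x - f x\<bar> powr p \<partial>M) + (\<integral>x. norm (g x) * \<beta> x \<partial>\<alpha>)"
  shows "\<exists>z\<in>K. \<forall>w\<in>K. J z \<le> J w"
proof -
  interpret finite_measure \<alpha> by (rule \<alpha>)
  define \<Psi> where "\<Psi> = (\<lambda>h. \<integral>x. \<bar>h x - f x\<bar> powr p \<partial>M)"
  \<comment> \<open>The squared norm adds uniform convexity in \<open>g\<close>. The part in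
    \<open>h\<close> is \<open>p\<close> times the corresponding term of \<open>J\<close>, which
    bounds \<Phi> by the mass of \<alpha> plus \<open>p * J\<close>, as the choice of the sequence
    demands.\<close>
  define \<Phi> where "\<Phi> = (\<lambda>z :: ('a \<Rightarrow> 'b) \<times> ('c \<Rightarrow> real). (\<integral>x. fst z x \<bullet> fst z x \<partial>\<alpha>) + \<Psi> (snd z))"
  define mid where "mid = (\<lambda>z w :: ('a \<Rightarrow> 'b) \<times> ('c \<Rightarrow> real).
    (\<lambda>x. (1/2) *\<^sub>R (fst z x + fst w x), \<lambda>x. (snd z x + snd w x) / 2))"
  have J_eq: "J (g, h) = 1 / p * \<Psi> h + (\<integral>x. norm (g x) * \<beta> x \<partial>\<alpha>)" for g h
    by (simp add: J_def \<Psi>_def)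
  have KD: "g \<in> borel_measurable \<alpha>" "\<And>x. norm (g x) \<le> 1" "p_integrable M p h"
    "\<And>G \<phi>. (G, \<phi>) \<in> T \<Longrightarrow> (\<integral>x. G x \<bullet> g x \<partial>\<alpha>) + (\<integral>x. \<phi> x * h x \<partial>M) = 0"
    if "(g, h) \<in> K" for g h
    using that by (auto simp: K_def)
  have ig: "integrable \<alpha> (\<lambda>x. norm (g x) * \<beta> x)" "integrable \<alpha> (\<lambda>x. g x \<bullet> g' x)"
    "(G, \<phi>) \<in> T \<Longrightarrow> integrable \<alpha> (\<lambda>x. G x \<bullet> g x)"
    if [measurable]: "g \<in> borel_measurable \<alpha>" "g' \<in> borel_measurable \<alpha>"
      and n: "\<And>x. norm (g x) \<le> 1" "\<And>x. norm (g' x) \<le> 1" for g g' :: "'a \<Rightarrow> 'b" and G \<phi>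
  proof -
    show "integrable \<alpha> (\<lambda>x. norm (g x) * \<beta> x)"
    proof (rule integrable_const_bound[where B = "B"])
      show "AE x in \<alpha>. norm (norm (g x) * \<beta> x) \<le> B"
      proof (rule AE_I2)
        fix x assume "x \<in> space \<alpha>"
        then show "norm (norm (g x) * \<beta> x) \<le> B"
          using mult_mono[OF n(1)[of x], of "\<beta> x" B] \<beta>_bd[of x] by simp
      qed
    qed simp
    show "integrable \<alpha> (\<lambda>x. g x \<bullet> g' x)"
    proof (rule integrable_const_bound[where B = 1])
      have "\<bar>g x \<bullet> g' x\<bar> \<le> 1" for x
        using Cauchy_Schwarz_ineq2[of "g x" "g' x"] mult_mono[OF n(1)[of x] n(2)[of x]] by simp
      then show "AE x in \<alpha>. norm (g x \<bullet> g' x) \<le> 1"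
        by simp
    qed simp
    show "integrable \<alpha> (\<lambda>x. G x \<bullet> g x)" if GT: "(G, \<phi>) \<in> T"
    proof -
      obtain C where [measurable]: "G \<in> borel_measurable \<alpha>" and C: "\<And>x. x \<in> space \<alpha> \<Longrightarrow> norm (G x) \<le> C"
        using T[OF GT] by blast
      show ?thesis
      proof (rule integrable_const_bound[where B = C])
        show "AE x in \<alpha>. norm (G x \<bullet> g x) \<le> C"
        proof (rule AE_I2)
          fix x assume "x \<in> space \<alpha>"
          then have "norm (G x) * norm (g x) \<le> C * 1"
            using C n(1)[of x] by (intro mult_mono) (auto intro: order_trans[OF norm_ge_zero])
          then show "norm (G x \<bullet> g x) \<le> C"
            using Cauchy_Schwarz_ineq2[of "G x" "g x"] by simp
        qed
      qed simp
    qed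
  qed
  have i\<phi>: "integrable M (\<lambda>x. \<phi> x * h x)" if "(G, \<phi>) \<in> T" "p_integrable M p h" for G \<phi> h
    using pairing_bound[of M \<phi> p] T[OF that(1)] p that(2) by metis
  have ih: "integrable M (\<lambda>x. \<bar>h x - f x\<bar> powr p)" if "p_integrable M p h" for h
    using p_integrable_diff[OF _ that f] p by (auto simp: p_integrable_def)
  have \<Psi>_nn: "0 \<le> \<Psi> h" for h
    by (simp add: \<Psi>_def)
  have \<beta>_nn: "0 \<le> (\<integral>x. norm (g x) * \<beta> x \<partial>\<alpha>)" for g :: "'a \<Rightarrow> 'b"
    using \<beta>_bd by (intro integral_nonneg_AE) auto
  have \<Psi>_le: "\<Psi> h \<le> p * J (g, h)" for g h
    using p \<beta>_nn[of g] by (simp add: J_eq distrib_left)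
  have phm: "p_integrable M p (\<lambda>x. (h x + h' x) / 2)" if "p_integrable M p h" "p_integrable M p h'" for h h'
    using p_integrable_cmult[OF p_integrable_add[OF _ that], of "1/2"] p by simp
  have nm: "norm ((1/2) *\<^sub>R (g x + g' x)) \<le> 1"
    if "\<And>x. norm (g x) \<le> 1" "\<And>x. norm (g' x) \<le> 1" for x and g g' :: "'a \<Rightarrow> 'b"
    using norm_triangle_ineq[of "g x" "g' x"] that(1)[of x] that(2)[of x] by simp
  have "K \<noteq> {}"
  proof -
    have "((\<lambda>_. 0), (\<lambda>_. 0)) \<in> K"
      using p by (auto simp: K_def p_integrable_def)
    then show ?thesis by blast
  qed
  have midK: "mid z w \<in> K" if "z \<in> K" "w \<in> K" for z w
  proof -
    obtain g h g' h' where zw: "z = (g, h)" "w = (g', h')"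
      by (metis surj_pair)
    note gh = KD[OF that(1)[unfolded zw]] and gh' = KD[OF that(2)[unfolded zw]]
    have "(\<integral>x. G x \<bullet> ((1/2) *\<^sub>R (g x + g' x)) \<partial>\<alpha>) + (\<integral>x. \<phi> x * ((h x + h' x) / 2) \<partial>M) = 0"
      if GT: "(G, \<phi>) \<in> T" for G \<phi>
    proof -
      have 1: "(\<integral>x. G x \<bullet> ((1/2) *\<^sub>R (g x + g' x)) \<partial>\<alpha>) = ((\<integral>x. G x \<bullet> g x \<partial>\<alpha>) + (\<integral>x. G x \<bullet> g' x \<partial>\<alpha>)) / 2"
        using ig(3)[OF gh(1,1,2,2) GT] ig(3)[OF gh'(1,1,2,2) GT] by (simp add: inner_add_right)
      have 2: "(\<integral>x. \<phi> x * ((h x + h' x) / 2) \<partial>M) = ((\<integral>x. \<phi> x * h x \<partial>M) + (\<integral>x. \<phi> x * h' x \<partial>M)) / 2"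
        using i\<phi>[OF GT gh(3)] i\<phi>[OF GT gh'(3)] by (simp add: distrib_left)
      show ?thesis
        unfolding 1 2 using gh(4)[OF GT] gh'(4)[OF GT] by argo
    qed
    then show ?thesis
      using gh(1-3) gh'(1-3) nm[of g g'] phm[of h h'] by (auto simp: K_def mid_def zw)
  qed
  have conv: "J (mid z w) \<le> (J z + J w) / 2" if "z \<in> K" "w \<in> K" for z w
  proof -
    obtain g h g' h' where zw: "z = (g, h)" "w = (g', h')"
      by (metis surj_pair)
    note gh = KD[OF that(1)[unfolded zw]] and gh' = KD[OF that(2)[unfolded zw]]
    have "\<Psi> (\<lambda>x. (h x + h' x) / 2) \<le> (\<integral>x. (\<bar>h x - f x\<bar> powr p + \<bar>h' x - f x\<bar> powr p) / 2 \<partial>M)"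
      unfolding \<Psi>_def
    proof (rule integral_mono)
      fix x
      have "(h x + h' x) / 2 - f x = ((h x - f x) + (h' x - f x)) / 2"
        by (simp add: field_simps)
      then show "\<bar>(h x + h' x) / 2 - f x\<bar> powr p \<le> (\<bar>h x - f x\<bar> powr p + \<bar>h' x - f x\<bar> powr p) / 2"
        by (simp only: abs_powr_midpoint_le[OF p])
    qed (use ih[OF phm[OF gh(3) gh'(3)]] ih[OF gh(3)] ih[OF gh'(3)] in auto)
    also have "\<dots> = (\<Psi> h + \<Psi> h') / 2"
      using ih[OF gh(3)] ih[OF gh'(3)] by (simp add: \<Psi>_def)
    finally have 1: "\<Psi> (\<lambda>x. (h x + h' x) / 2) \<le> (\<Psi> h + \<Psi> h') / 2" .
    have nmg: "norm ((1/2) *\<^sub>R (g x + g' x)) \<le> 1" for x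
      by (rule nm; rule gh(2) gh'(2))
    have gm: "(\<lambda>x. (1/2) *\<^sub>R (g x + g' x)) \<in> borel_measurable \<alpha>"
      using gh(1) gh'(1) by measurable
    have "(\<integral>x. norm ((1/2) *\<^sub>R (g x + g' x)) * \<beta> x \<partial>\<alpha>) \<le> (\<integral>x. (norm (g x) * \<beta> x + norm (g' x) * \<beta> x) / 2 \<partial>\<alpha>)"
    proof (rule integral_mono)
      fix x assume "x \<in> space \<alpha>"
      then show "norm ((1/2) *\<^sub>R (g x + g' x)) * \<beta> x \<le> (norm (g x) * \<beta> x + norm (g' x) * \<beta> x) / 2"
        using mult_right_mono[OF norm_triangle_ineq[of "g x" "g' x"], of "\<beta> x"] \<beta>_bd[of x]
        by (simp add: distrib_right)
    qed (use ig(1)[OF gm gm nmg nmg] ig(1)[OF gh(1,1,2,2)] ig(1)[OF gh'(1,1,2,2)] gh(2) gh'(2) in auto)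
    also have "\<dots> = ((\<integral>x. norm (g x) * \<beta> x \<partial>\<alpha>) + (\<integral>x. norm (g' x) * \<beta> x \<partial>\<alpha>)) / 2"
      using ig(1)[OF gh(1,1,2,2)] ig(1)[OF gh'(1,1,2,2)] by simp
    finally have 2: "(\<integral>x. norm ((1/2) *\<^sub>R (g x + g' x)) * \<beta> x \<partial>\<alpha>) \<le>
        ((\<integral>x. norm (g x) * \<beta> x \<partial>\<alpha>) + (\<integral>x. norm (g' x) * \<beta> x \<partial>\<alpha>)) / 2" .
    have "1 / p * \<Psi> (\<lambda>x. (h x + h' x) / 2) \<le> 1 / p * ((\<Psi> h + \<Psi> h') / 2)"
      using 1 p by (intro mult_left_mono) auto
    then have 3: "1 / p * \<Psi> (\<lambda>x. (h x + h' x) / 2) \<le> (1 / p * \<Psi> h + 1 / p * \<Psi> h') / 2"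
      by (simp add: add_divide_distrib)
    show ?thesis
      unfolding zw mid_def J_eq fst_conv snd_conv using 2 3 by argo
  qed
  have J_nn: "0 \<le> J z" for z
    using p \<Psi>_nn \<beta>_nn by (cases z) (simp add: J_eq)
  have \<Phi>_nn: "0 \<le> \<Phi> z" for z
    using \<Psi>_nn by (auto simp: \<Phi>_def)
  have \<Phi>_bd: "\<Phi> z \<le> measure \<alpha> (space \<alpha>) + p * J z" if "z \<in> K" for z
  proof -
    obtain g h where z: "z = (g, h)" by (metis surj_pair)
    note gh = KD[OF that[unfolded z]]
    have "(\<integral>x. g x \<bullet> g x \<partial>\<alpha>) \<le> (\<integral>x. 1 \<partial>\<alpha>)"
      using ig(2)[OF gh(1,1,2,2)] gh(2) by (intro integral_mono) (auto simp: dot_square_norm abs_square_le_1)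
    then show ?thesis
      using \<Psi>_le[of h g] by (simp add: \<Phi>_def z)
  qed
  \<comment> \<open>The midpoint gap of \<Phi> is the sum of the integrals of two non-negative gaps,
    \<open>b\<close> for \<open>g\<close> and \<open>a\<close> for \<open>h\<close>. Each is
    therefore controlled by the whole.\<close>
  have gap_h: "(\<integral>x. \<bar>h x - h' x\<bar> powr p \<partial>M) \<le> e * (\<Psi> h + \<Psi> h') + C * ((\<Phi> (g, h) + \<Phi> (g', h')) / 2 - \<Phi> (mid (g, h) (g', h')))"
    and gap_g: "(\<integral>x. (norm (g x - g' x))\<^sup>2 \<partial>\<alpha>) \<le> 4 * ((\<Phi> (g, h) + \<Phi> (g', h')) / 2 - \<Phi> (mid (g, h) (g', h')))"
    if K: "(g, h) \<in> K" "(g', h') \<in> K" and C: "0 < C" "\<And>u v. \<bar>u - v\<bar> powr p \<le> e * (\<bar>u\<bar> powr p + \<bar>v\<bar> powr p)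
       + C * ((\<bar>u\<bar> powr p + \<bar>v\<bar> powr p) / 2 - \<bar>(u + v) / 2\<bar> powr p)"
    for g h g' h' C e
  proof -
    note gh = KD[OF K(1)] and gh' = KD[OF K(2)]
    define a where "a = (\<lambda>x. (\<bar>h x - f x\<bar> powr p + \<bar>h' x - f x\<bar> powr p) / 2 - \<bar>(h x + h' x) / 2 - f x\<bar> powr p)"
    define b where "b = (\<lambda>x. (g x \<bullet> g x + g' x \<bullet> g' x) / 2 - ((1/2) *\<^sub>R (g x + g' x)) \<bullet> ((1/2) *\<^sub>R (g x + g' x)))"
    have nmg: "norm ((1/2) *\<^sub>R (g x + g' x)) \<le> 1" for x
      by (rule nm; rule gh(2) gh'(2))
    have gm: "(\<lambda>x. (1/2) *\<^sub>R (g x + g' x)) \<in> borel_measurable \<alpha>"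
      using gh(1) gh'(1) by measurable
    note ia = ih[OF phm[OF gh(3) gh'(3)]] ih[OF gh(3)] ih[OF gh'(3)]
    note ib = ig(2)[OF gh(1,1,2,2)] ig(2)[OF gh'(1,1,2,2)] ig(2)[OF gm gm nmg nmg]
    have gap: "(\<Phi> (g, h) + \<Phi> (g', h')) / 2 - \<Phi> (mid (g, h) (g', h')) = (\<integral>x. b x \<partial>\<alpha>) + (\<integral>x. a x \<partial>M)"
    proof -
      have "(\<integral>x. a x \<partial>M) = (\<Psi> h + \<Psi> h') / 2 - \<Psi> (\<lambda>x. (h x + h' x) / 2)"
        unfolding a_def \<Psi>_def using ia by (subst Bochner_Integration.integral_diff) auto
      moreover have "(\<integral>x. b x \<partial>\<alpha>) = ((\<integral>x. g x \<bullet> g x \<partial>\<alpha>) + (\<integral>x. g' x \<bullet> g' x \<partial>\<alpha>)) / 2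
          - (\<integral>x. ((1/2) *\<^sub>R (g x + g' x)) \<bullet> ((1/2) *\<^sub>R (g x + g' x)) \<partial>\<alpha>)"
        unfolding b_def using ib by (subst Bochner_Integration.integral_diff) auto
      ultimately show ?thesis
        unfolding \<Phi>_def mid_def fst_conv snd_conv by argo
    qed
    \<comment> \<open>Subtracting \<open>f\<close> commutes with taking midpoints, so the convexity
      estimates apply to \<open>h - f\<close> and \<open>h' - f\<close>.\<close>
    have shift: "(h x + h' x) / 2 - f x = ((h x - f x) + (h' x - f x)) / 2" for x
      by (simp add: field_simps)
    have a_nn: "0 \<le> a x" for x
      unfolding a_def shift by (simp only: diff_ge_0_iff_ge abs_powr_midpoint_le[OF p])
    \<comment> \<open>The parallelogram law: in the Hilbert space component the gap is exactly a
      quarter of the squared distance.\<close>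
    have b_eq: "b x = (norm (g x - g' x))\<^sup>2 / 4" for x
      by (simp add: b_def power2_norm_eq_inner inner_simps inner_commute field_simps)
    have int_a: "integrable M a"
      unfolding a_def using ia by auto
    have "0 \<le> (\<integral>x. b x \<partial>\<alpha>)" "0 \<le> (\<integral>x. a x \<partial>M)"
      using a_nn by (auto simp: b_eq)
    have "(\<integral>x. \<bar>h x - h' x\<bar> powr p \<partial>M) \<le> (\<integral>x. e * (\<bar>h x - f x\<bar> powr p + \<bar>h' x - f x\<bar> powr p) + C * a x \<partial>M)"
    proof (rule integral_mono)
      show "integrable M (\<lambda>x. \<bar>h x - h' x\<bar> powr p)"
        using p_integrable_diff[OF _ gh(3) gh'(3)] p by (auto simp: p_integrable_def)
      fix x
      show "\<bar>h x - h' x\<bar> powr p \<le> e * (\<bar>h x - f x\<bar> powr p + \<bar>h' x - f x\<bar> powr p) + C * a x"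
        using C(2)[of "h x - f x" "h' x - f x"] unfolding a_def shift by simp
    qed (use ia int_a in auto)
    also have "\<dots> = e * (\<Psi> h + \<Psi> h') + C * (\<integral>x. a x \<partial>M)"
      using ia int_a by (simp add: \<Psi>_def)
    also have "\<dots> \<le> e * (\<Psi> h + \<Psi> h') + C * ((\<integral>x. b x \<partial>\<alpha>) + (\<integral>x. a x \<partial>M))"
      using C \<open>0 \<le> (\<integral>x. b x \<partial>\<alpha>)\<close> by simp
    finally show "(\<integral>x. \<bar>h x - h' x\<bar> powr p \<partial>M) \<le> e * (\<Psi> h + \<Psi> h') + C * ((\<Phi> (g, h) + \<Phi> (g', h')) / 2 - \<Phi> (mid (g, h) (g', h')))"
      unfolding gap .
    have "(\<integral>x. (norm (g x - g' x))\<^sup>2 \<partial>\<alpha>) = 4 * (\<integral>x. b x \<partial>\<alpha>)"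
      by (simp add: b_eq)
    then show "(\<integral>x. (norm (g x - g' x))\<^sup>2 \<partial>\<alpha>) \<le> 4 * ((\<Phi> (g, h) + \<Phi> (g', h')) / 2 - \<Phi> (mid (g, h) (g', h')))"
      unfolding gap using \<open>0 \<le> (\<integral>x. a x \<partial>M)\<close> by simp
  qed
  obtain z where zK: "\<And>k::nat. z k \<in> K" and Jz: "(\<lambda>k. J (z k)) \<longlonglongrightarrow> Inf (J ` K)"
    and gap: "\<And>e. 0 < e \<Longrightarrow> \<exists>N. \<forall>i\<ge>N. \<forall>j\<ge>N. (\<Phi> (z i) + \<Phi> (z j)) / 2 - \<Phi> (mid (z i) (z j)) < e"
    using minimizing_sequence_small_gap[of K mid J \<Phi> "measure \<alpha> (space \<alpha>)" p,
        OF \<open>K \<noteq> {}\<close> midK conv J_nn \<Phi>_nn \<Phi>_bd] p by auto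
  define g where "g = (\<lambda>n. fst (z n))"
  define h where "h = (\<lambda>n. snd (z n))"
  have gh: "(g n, h n) \<in> K" for n
    using zK by (simp add: g_def h_def)
  have z_eq: "z n = (g n, h n)" for n
    by (simp add: g_def h_def)
  have [measurable]: "g n \<in> borel_measurable \<alpha>" and ng: "\<And>x. norm (g n x) \<le> 1"
    and hp: "p_integrable M p (h n)" and [measurable]: "h n \<in> borel_measurable M" for n
    using KD[OF gh[of n]] by (auto simp: p_integrable_def)
  have f_meas[measurable]: "f \<in> borel_measurable M"
    using f by (simp add: p_integrable_def)
  obtain R where R: "0 < R" "\<And>n. \<Psi> (h n) \<le> R"
  proof -
    obtain R where "0 < R" "\<And>n. norm (J (z n)) \<le> R"
      using convergent_imp_Bseq[OF convergentI[OF Jz]] BseqE by blast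
    then have "\<Psi> (h n) \<le> p * R" for n
      using \<Psi>_le[of "h n" "g n"] p by (smt (verit) mult_left_mono real_norm_def z_eq)
    then show ?thesis
      using that[of "p * R"] p \<open>0 < R\<close> by simp
  qed
  have Cauchy_h: "\<exists>N. \<forall>i\<ge>N. \<forall>j\<ge>N. (\<integral>x. \<bar>h i x - h j x\<bar> powr p \<partial>M) < e" if e: "0 < e" for e
  proof -
    \<comment> \<open>Since \<open>R + R\<close> bounds \<open>\<Psi> (h i) + \<Psi> (h j)\<close>,
      the \<epsilon>-term costs at most \<open>e / 2\<close>; the threshold
      \<open>e / (2 * C)\<close> for the gap leaves the other half to the second term.\<close>
    define \<epsilon> where "\<epsilon> = e / (4 * R)"
    have \<epsilon>: "0 < \<epsilon>" "\<epsilon> * (R + R) = e / 2"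
      using e R by (auto simp: \<epsilon>_def field_simps)
    obtain C where C: "0 < C" "\<And>u v. \<bar>u - v\<bar> powr p \<le> \<epsilon> * (\<bar>u\<bar> powr p + \<bar>v\<bar> powr p)
       + C * ((\<bar>u\<bar> powr p + \<bar>v\<bar> powr p) / 2 - \<bar>(u + v) / 2\<bar> powr p)"
      using abs_powr_uniform_convexity[OF p \<epsilon>(1)] by blast
    obtain N where N: "\<And>i j. N \<le> i \<Longrightarrow> N \<le> j \<Longrightarrow> (\<Phi> (z i) + \<Phi> (z j)) / 2 - \<Phi> (mid (z i) (z j)) < e / (2 * C)"
      using gap[OF divide_pos_pos[OF e, of "2 * C"]] C(1) by auto
    have "(\<integral>x. \<bar>h i x - h j x\<bar> powr p \<partial>M) < e" if "N \<le> i" "N \<le> j" for i j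
    proof -
      have "\<epsilon> * (\<Psi> (h i) + \<Psi> (h j)) \<le> e / 2"
        unfolding \<epsilon>(2)[symmetric] using \<epsilon>(1) R by (intro mult_left_mono add_mono) auto
      moreover have "C * ((\<Phi> (z i) + \<Phi> (z j)) / 2 - \<Phi> (mid (z i) (z j))) < C * (e / (2 * C))"
        using N[OF that] C by (intro mult_strict_left_mono) auto
      moreover have "C * (e / (2 * C)) = e / 2"
        using C by simp
      ultimately show ?thesis
        using gap_h[OF gh[of i] gh[of j] C] unfolding z_eq by argo
    qed
    then show ?thesis by blast
  qed
  have Cauchy_g: "\<exists>N. \<forall>i\<ge>N. \<forall>j\<ge>N. (\<integral>x. (norm (g i x - g j x))\<^sup>2 \<partial>\<alpha>) < e" if e: "0 < e" for e
  proof -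
    obtain C where C: "0 < C" "\<And>u v. \<bar>u - v\<bar> powr p \<le> 1 * (\<bar>u\<bar> powr p + \<bar>v\<bar> powr p)
       + C * ((\<bar>u\<bar> powr p + \<bar>v\<bar> powr p) / 2 - \<bar>(u + v) / 2\<bar> powr p)"
      using abs_powr_uniform_convexity[OF p zero_less_one] by blast
    obtain N where N: "\<And>i j. N \<le> i \<Longrightarrow> N \<le> j \<Longrightarrow> (\<Phi> (z i) + \<Phi> (z j)) / 2 - \<Phi> (mid (z i) (z j)) < e / 4"
      using gap[OF divide_pos_pos[OF e, of 4]] by auto
    have "(\<integral>x. (norm (g i x - g j x))\<^sup>2 \<partial>\<alpha>) < e" if "N \<le> i" "N \<le> j" for i j
      using gap_g[OF gh[of i] gh[of j] C] N[OF that] unfolding z_eq by argo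
    then show ?thesis by blast
  qed
  have nn_h: "(\<integral>\<^sup>+x. ennreal (\<bar>h i x - h j x\<bar> powr p) \<partial>M) = ennreal (\<integral>x. \<bar>h i x - h j x\<bar> powr p \<partial>M)" for i j
    using p_integrable_diff[OF _ hp[of i] hp[of j]] p
    by (intro nn_integral_eq_integral) (auto simp: p_integrable_def)
  have nn_g: "(\<integral>\<^sup>+x. ennreal (norm (g i x - g j x) powr 2) \<partial>\<alpha>) = ennreal (\<integral>x. (norm (g i x - g j x))\<^sup>2 \<partial>\<alpha>)" for i j
  proof -
    have "norm (g i x - g j x) \<le> 2" for x
      using norm_triangle_ineq4[of "g i x" "g j x"] ng[of i x] ng[of j x] by linarith
    then have "(norm (g i x - g j x))\<^sup>2 \<le> 2\<^sup>2" for x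
      by (intro power_mono) auto
    then have "integrable \<alpha> (\<lambda>x. (norm (g i x - g j x))\<^sup>2)"
      by (intro integrable_const_bound[where B = 4]) auto
    then show ?thesis
      by (simp add: nn_integral_eq_integral)
  qed
  obtain r1 where r1: "strict_mono r1" "AE x in \<alpha>. convergent (\<lambda>n. g (r1 n) x)"
  proof (rule AE_convergent_subseq[of g \<alpha> 2])
    show "\<exists>N. \<forall>i\<ge>N. \<forall>j\<ge>N. (\<integral>\<^sup>+x. ennreal (norm (g i x - g j x) powr 2) \<partial>\<alpha>) < ennreal e" if "0 < e" for e
      unfolding nn_g using Cauchy_g[OF that] by (auto intro!: ennreal_lessI that)
  qed auto
  have r1_ge: "n \<le> r1 n" for n
    using r1(1) by (rule strict_mono_imp_increasing)
  \<comment> \<open>A further subsequence of \<open>r1\<close>, along which the convergence of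
    \<open>g\<close> persists.\<close>
  obtain r2 where r2: "strict_mono r2" "AE x in M. convergent (\<lambda>n. h (r1 (r2 n)) x)"
  proof (rule AE_convergent_subseq[of "\<lambda>n. h (r1 n)" M p])
    show "\<exists>N. \<forall>i\<ge>N. \<forall>j\<ge>N. (\<integral>\<^sup>+x. ennreal (norm (h (r1 i) x - h (r1 j) x) powr p) \<partial>M) < ennreal e" if e: "0 < e" for e
    proof -
      obtain N where "\<And>i j. N \<le> i \<Longrightarrow> N \<le> j \<Longrightarrow> (\<integral>x. \<bar>h i x - h j x\<bar> powr p \<partial>M) < e"
        using Cauchy_h[OF e] by blast
      then show ?thesis
        unfolding real_norm_def nn_h using r1_ge e by (meson ennreal_lessI order_trans)
    qed
  qed (use p in auto)
  define r where "r = r1 \<circ> r2"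
  have r: "strict_mono r"
    unfolding r_def by (rule strict_mono_o[OF r1(1) r2(1)])
  have r_ge: "n \<le> r n" for n
    using r by (rule strict_mono_imp_increasing)
  have conv_h: "AE x in M. convergent (\<lambda>n. h (r n) x)"
    using r2(2) by (simp add: r_def)
  have conv_g: "AE x in \<alpha>. convergent (\<lambda>n. g (r n) x)"
    using r1(2)
  proof eventually_elim
    case (elim x)
    then show ?case
      using convergent_subseq_convergent[OF elim r2(1)] by (simp add: r_def o_def)
  qed
  define hs where "hs = (\<lambda>x. lim (\<lambda>n. h (r n) x))"
  \<comment> \<open>Membership in \<open>K\<close> demands the bound 1 at every point. Where the
    sequence diverges, \<open>lim\<close> is a default value that may violate it and is then
    replaced by 0.\<close>
  define gs where "gs = (\<lambda>x. if norm (lim (\<lambda>n. g (r n) x)) \<le> 1 then lim (\<lambda>n. g (r n) x) else 0)"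
  have [measurable]: "hs \<in> borel_measurable M"
    unfolding hs_def by (rule borel_measurable_lim_metric) simp
  have [measurable]: "(\<lambda>x. lim (\<lambda>n. g (r n) x)) \<in> borel_measurable \<alpha>"
    by (rule borel_measurable_lim_metric) simp
  have gs_meas[measurable]: "gs \<in> borel_measurable \<alpha>"
    unfolding gs_def by measurable
  have ngs: "norm (gs x) \<le> 1" for x
    by (simp add: gs_def)
  have lim_h: "AE x in M. (\<lambda>n. h (r n) x) \<longlonglongrightarrow> hs x"
    using conv_h by eventually_elim (simp add: hs_def convergent_LIMSEQ_iff)
  have lim_g: "AE x in \<alpha>. (\<lambda>n. g (r n) x) \<longlonglongrightarrow> gs x"
    using conv_g
  proof eventually_elim
    case (elim x)
    then have l: "(\<lambda>n. g (r n) x) \<longlonglongrightarrow> lim (\<lambda>n. g (r n) x)"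
      by (simp add: convergent_LIMSEQ_iff)
    have "norm (lim (\<lambda>n. g (r n) x)) \<le> 1"
      by (rule LIMSEQ_le_const2[OF tendsto_norm[OF l]]) (use ng in auto)
    then show ?case
      using l by (simp add: gs_def)
  qed
  \<comment> \<open>Used with \<open>u = h (r i)\<close>, where it turns the Cauchy property into
    closeness to \<open>hs\<close>, and with \<open>u = f\<close>, where it is the lower
    semicontinuity of \<Psi>.\<close>
  have fatou: "(\<integral>\<^sup>+x. ennreal (\<bar>u x - hs x\<bar> powr p) \<partial>M) \<le> ennreal c"
    if [measurable]: "u \<in> borel_measurable M" and le: "\<And>j. N \<le> j \<Longrightarrow> (\<integral>\<^sup>+x. ennreal (\<bar>u x - h (r j) x\<bar> powr p) \<partial>M) \<le> ennreal (C j)"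
      and C: "C \<longlonglongrightarrow> c" for u c N C
  proof -
    have "(\<integral>\<^sup>+x. ennreal (\<bar>u x - hs x\<bar> powr p) \<partial>M) = (\<integral>\<^sup>+x. liminf (\<lambda>j. ennreal (\<bar>u x - h (r j) x\<bar> powr p)) \<partial>M)"
    proof (rule nn_integral_cong_AE)
      show "AE x in M. ennreal (\<bar>u x - hs x\<bar> powr p) = liminf (\<lambda>j. ennreal (\<bar>u x - h (r j) x\<bar> powr p))"
        using lim_h
      proof eventually_elim
        case (elim x)
        have "(\<lambda>j. ennreal (\<bar>u x - h (r j) x\<bar> powr p)) \<longlonglongrightarrow> ennreal (\<bar>u x - hs x\<bar> powr p)"
          using elim p by (intro tendsto_ennrealI tendsto_powr' tendsto_intros) auto
        then show ?case
          by (intro lim_imp_Liminf[symmetric]) auto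
      qed
    qed
    also have "\<dots> \<le> liminf (\<lambda>j. \<integral>\<^sup>+x. ennreal (\<bar>u x - h (r j) x\<bar> powr p) \<partial>M)"
      by (rule nn_integral_liminf) simp
    also have "\<dots> \<le> liminf (\<lambda>j. ennreal (C j))"
      using le by (intro Liminf_mono eventually_sequentiallyI[of N]) auto
    also have "\<dots> = ennreal c"
      using C by (intro lim_imp_Liminf tendsto_ennrealI) auto
    finally show ?thesis .
  qed
  have to_int: "p_integrable M p (\<lambda>x. u x - hs x) \<and> (\<integral>x. \<bar>u x - hs x\<bar> powr p \<partial>M) \<le> c"
    if [measurable]: "u \<in> borel_measurable M" and le: "(\<integral>\<^sup>+x. ennreal (\<bar>u x - hs x\<bar> powr p) \<partial>M) \<le> ennreal c"
      and c: "0 \<le> c" for u c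
  proof -
    have i: "integrable M (\<lambda>x. \<bar>u x - hs x\<bar> powr p)"
      using le by (intro integrableI_nonneg) (auto simp: le_less_trans)
    then have "ennreal (\<integral>x. \<bar>u x - hs x\<bar> powr p \<partial>M) \<le> ennreal c"
      using le by (simp add: nn_integral_eq_integral)
    then show ?thesis
      using i c by (simp add: p_integrable_def ennreal_le_iff)
  qed
  have h_close: "\<exists>N. \<forall>i\<ge>N. p_integrable M p (\<lambda>x. h (r i) x - hs x) \<and> (\<integral>x. \<bar>h (r i) x - hs x\<bar> powr p \<partial>M) \<le> e" if e: "0 < e" for e
  proof -
    obtain N where N: "\<And>i j. N \<le> i \<Longrightarrow> N \<le> j \<Longrightarrow> (\<integral>x. \<bar>h i x - h j x\<bar> powr p \<partial>M) < e"
      using Cauchy_h[OF e] by blast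
    have "p_integrable M p (\<lambda>x. h (r i) x - hs x) \<and> (\<integral>x. \<bar>h (r i) x - hs x\<bar> powr p \<partial>M) \<le> e" if i: "N \<le> i" for i
    proof (rule to_int)
      show "(\<integral>\<^sup>+x. ennreal (\<bar>h (r i) x - hs x\<bar> powr p) \<partial>M) \<le> ennreal e"
      proof (rule fatou[where C = "\<lambda>_. e" and N = N])
        fix j assume "N \<le> j"
        then show "(\<integral>\<^sup>+x. ennreal (\<bar>h (r i) x - h (r j) x\<bar> powr p) \<partial>M) \<le> ennreal e"
          unfolding nn_h using N[of "r i" "r j"] r_ge[of i] r_ge[of j] i by (intro ennreal_leI) simp
      qed auto
    qed (use e in auto)
    then show ?thesis by blast
  qed
  \<comment> \<open>\<open>hs\<close> is the difference of \<open>h (r i)\<close> and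
    \<open>h (r i) - hs\<close>, both \<open>p\<close>-integrable for a suitable
    \<open>i\<close>.\<close>
  have hs_p: "p_integrable M p hs"
  proof -
    obtain i where "p_integrable M p (\<lambda>x. h (r i) x - hs x)"
      using h_close[OF zero_less_one] by blast
    from p_integrable_diff[OF _ hp[of "r i"] this] p show ?thesis by simp
  qed
  have lim_hp: "(\<lambda>n. \<integral>x. \<bar>h (r n) x - hs x\<bar> powr p \<partial>M) \<longlonglongrightarrow> 0"
  proof (rule LIMSEQ_I)
    fix e :: real assume "0 < e"
    then obtain N where N: "\<And>i. N \<le> i \<Longrightarrow> (\<integral>x. \<bar>h (r i) x - hs x\<bar> powr p \<partial>M) \<le> e / 2"
      using h_close[of "e/2"] by auto
    have "norm ((\<integral>x. \<bar>h (r n) x - hs x\<bar> powr p \<partial>M) - 0) < e" if "N \<le> n" for n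
    proof -
      have "0 \<le> (\<integral>x. \<bar>h (r n) x - hs x\<bar> powr p \<partial>M)"
        by (intro integral_nonneg_AE) auto
      then show ?thesis
        using N[OF that] \<open>0 < e\<close> by simp
    qed
    then show "\<exists>N. \<forall>n\<ge>N. norm ((\<integral>x. \<bar>h (r n) x - hs x\<bar> powr p \<partial>M) - 0) < e"
      by blast
  qed
  have sK: "(gs, hs) \<in> K"
  proof -
    have "(\<integral>x. G x \<bullet> gs x \<partial>\<alpha>) + (\<integral>x. \<phi> x * hs x \<partial>M) = 0" if GT: "(G, \<phi>) \<in> T" for G \<phi>
    proof -
      obtain C where [measurable]: "G \<in> borel_measurable \<alpha>" and C: "\<And>x. x \<in> space \<alpha> \<Longrightarrow> norm (G x) \<le> C"
        using T[OF GT] by blast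
      have "(\<lambda>n. \<integral>x. G x \<bullet> g (r n) x \<partial>\<alpha>) \<longlonglongrightarrow> (\<integral>x. G x \<bullet> gs x \<partial>\<alpha>)"
      proof (rule integral_dominated_convergence[where w = "\<lambda>_. C"])
        show "AE x in \<alpha>. (\<lambda>n. G x \<bullet> g (r n) x) \<longlonglongrightarrow> G x \<bullet> gs x"
          using lim_g by eventually_elim (intro tendsto_intros)
        show "AE x in \<alpha>. norm (G x \<bullet> g (r n) x) \<le> C" for n
        proof (rule AE_I2)
          fix x assume "x \<in> space \<alpha>"
          then have "norm (G x) * norm (g (r n) x) \<le> C * 1"
            using C ng[of "r n" x] by (intro mult_mono) (auto intro: order_trans[OF norm_ge_zero])
          then show "norm (G x \<bullet> g (r n) x) \<le> C"
            using Cauchy_Schwarz_ineq2[of "G x" "g (r n) x"] by simp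
        qed
      qed auto
      moreover have "(\<lambda>n. \<integral>x. \<phi> x * h (r n) x \<partial>M) \<longlonglongrightarrow> (\<integral>x. \<phi> x * hs x \<partial>M)"
        using T[OF GT] by (intro pairing_tendsto[OF _ p hp hs_p lim_hp]) auto
      ultimately have "(\<lambda>n. (\<integral>x. G x \<bullet> g (r n) x \<partial>\<alpha>) + (\<integral>x. \<phi> x * h (r n) x \<partial>M)) \<longlonglongrightarrow>
          (\<integral>x. G x \<bullet> gs x \<partial>\<alpha>) + (\<integral>x. \<phi> x * hs x \<partial>M)"
        by (rule tendsto_add)
      then show ?thesis
        using KD(4)[OF gh GT] by (simp add: LIMSEQ_const_iff)
    qed
    then show ?thesis
      using ngs hs_p gs_meas by (auto simp: K_def)
  qed
  have lim_\<beta>: "(\<lambda>n. \<integral>x. norm (g (r n) x) * \<beta> x \<partial>\<alpha>) \<longlonglongrightarrow> (\<integral>x. norm (gs x) * \<beta> x \<partial>\<alpha>)"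
  proof (rule integral_dominated_convergence[where w = "\<lambda>_. B"])
    show "AE x in \<alpha>. (\<lambda>n. norm (g (r n) x) * \<beta> x) \<longlonglongrightarrow> norm (gs x) * \<beta> x"
      using lim_g by eventually_elim (intro tendsto_intros)
    show "AE x in \<alpha>. norm (norm (g (r n) x) * \<beta> x) \<le> B" for n
    proof (rule AE_I2)
      fix x assume "x \<in> space \<alpha>"
      then show "norm (norm (g (r n) x) * \<beta> x) \<le> B"
        using mult_mono[OF ng[of "r n" x], of "\<beta> x" B] \<beta>_bd[of x] by simp
    qed
  qed auto
  \<comment> \<open>The limit of \<open>\<Psi> (h (r n))\<close>, read off from the limits of
    \<open>J\<close> and of the \<beta>-term. Thus \<open>\<Psi> hs \<le> L\<close> is all that is
    left for \<open>(gs, hs)\<close> to reach the infimum.\<close>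
  define L where "L = p * (Inf (J ` K) - (\<integral>x. norm (gs x) * \<beta> x \<partial>\<alpha>))"
  have lim_\<Psi>: "(\<lambda>n. \<Psi> (h (r n))) \<longlonglongrightarrow> L"
  proof -
    have "(\<lambda>n. p * (J (z (r n)) - (\<integral>x. norm (g (r n) x) * \<beta> x \<partial>\<alpha>))) \<longlonglongrightarrow> L"
      unfolding L_def by (intro tendsto_intros lim_\<beta> LIMSEQ_subseq_LIMSEQ[OF Jz r, unfolded o_def])
    also have "(\<lambda>n. p * (J (z (r n)) - (\<integral>x. norm (g (r n) x) * \<beta> x \<partial>\<alpha>))) = (\<lambda>n. \<Psi> (h (r n)))"
      using p by (simp add: z_eq J_eq)
    finally show ?thesis .
  qed
  \<comment> \<open>\<open>ennreal\<close> truncates negative numbers, so the sign is required to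
    turn the bound from \<open>fatou\<close> into one between reals.\<close>
  have "0 \<le> L"
    using lim_\<Psi> \<Psi>_nn by (intro LIMSEQ_le_const) auto
  have "\<Psi> hs \<le> L"
  proof -
    have "(\<integral>\<^sup>+x. ennreal (\<bar>f x - hs x\<bar> powr p) \<partial>M) \<le> ennreal L"
    proof (rule fatou[where C = "\<lambda>n. \<Psi> (h (r n))" and N = 0])
      fix j
      show "(\<integral>\<^sup>+x. ennreal (\<bar>f x - h (r j) x\<bar> powr p) \<partial>M) \<le> ennreal (\<Psi> (h (r j)))"
        unfolding \<Psi>_def using ih[OF hp[of "r j"]] by (subst abs_minus_commute) (simp add: nn_integral_eq_integral)
    qed (use lim_\<Psi> in auto)
    then show ?thesis
      using to_int[of f L] \<open>0 \<le> L\<close> by (simp add: \<Psi>_def abs_minus_commute)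
  qed
  then have "1 / p * \<Psi> hs \<le> 1 / p * L"
    using p by (intro mult_left_mono) auto
  then have "J (gs, hs) \<le> Inf (J ` K)"
    using p by (simp add: J_eq L_def)
  moreover have "Inf (J ` K) \<le> J w" if "w \<in> K" for w
    using that J_nn by (intro cInf_lower) (auto intro!: bdd_belowI[of _ 0])
  ultimately show ?thesis
    using sK by (intro bexI[of _ "(gs, hs)"]) (auto intro: order_trans)
qed

subsection \<open>Smooth functions approximating indicators of boxes\<close>

text \<open>The exponent \<open>m\<close> makes the family closed under differentiation up to linear
  combinations. For \<open>m = 0\<close> and \<open>c\<close> tending to 0 it approximates the
  indicator of the positive half-line.\<close>

definition flat :: "nat \<Rightarrow> real \<Rightarrow> real \<Rightarrow> real"
  where "flat m c t = (if 0 < t then exp (- c / t) / t ^ m else 0)"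

text \<open>With \<open>s = 1 / t\<close> this is the decay of a power of \<open>c * s\<close>
  divided by its exponential.\<close>

lemma flat_tendsto_0:
  fixes c :: real
  assumes "0 < c"
  shows "((\<lambda>t. exp (- c / t) / t ^ m) \<longlongrightarrow> 0) (at_right 0)"
proof -
  have "filterlim (\<lambda>s. c * s) at_top at_top"
    by (rule filterlim_tendsto_pos_mult_at_top[OF tendsto_const assms filterlim_ident])
  from filterlim_compose[OF tendsto_power_div_exp_0 this]
  have "((\<lambda>s. (1 / c) ^ m * ((c * s) ^ m / exp (c * s))) \<longlongrightarrow> (1 / c) ^ m * 0) at_top"
    by (intro tendsto_mult tendsto_const)
  then have "((\<lambda>t. (1 / c) ^ m * ((c * inverse t) ^ m / exp (c * inverse t))) \<longlongrightarrow> 0) (at_right 0)"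
    using filterlim_compose[OF _ filterlim_inverse_at_top_right] by fastforce
  then show ?thesis
    by (rule Lim_transform_eventually)
      (use assms in \<open>auto simp: eventually_at_filter field_simps exp_minus\<close>)
qed

lemma flat_has_derivative:
  assumes c: "0 < c"
  shows "(flat m c has_real_derivative c * flat (m + 2) c t - real m * flat (m + 1) c t) (at t)"
proof (cases t "0 :: real" rule: linorder_cases)
  case less
  have "((\<lambda>_. 0) has_real_derivative 0) (at t)"
    by simp
  then have "(flat m c has_real_derivative 0) (at t)"
    by (rule DERIV_cong_ev[OF refl _ refl, THEN iffD1, rotated])
      (use eventually_at_filter less order_tendstoD(2)[OF tendsto_ident_at less] in
        \<open>auto simp: flat_def eventually_nhds intro!: exI[of _ "{..<0}"]\<close>)
  then show ?thesis
    using less by (simp add: flat_def)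
next
  case greater
  have "((\<lambda>t. exp (- c / t) / t ^ m) has_real_derivative c * flat (m + 2) c t - real m * flat (m + 1) c t) (at t)"
  proof -
    have pw: "((\<lambda>t. t ^ m) has_real_derivative real m * t ^ m / t) (at t)"
      using greater by (intro DERIV_cong[OF DERIV_pow]) (cases m, auto)
    have ex: "((\<lambda>t. exp (- c / t)) has_real_derivative exp (- c / t) * (c / t\<^sup>2)) (at t)"
      using greater by (auto intro!: derivative_eq_intros simp: power2_eq_square)
    show ?thesis
      by (rule DERIV_cong[OF DERIV_divide[OF ex pw]])
        (use greater in \<open>auto simp: flat_def field_simps power_add power2_eq_square\<close>)
  qed
  then show ?thesis
    by (rule DERIV_cong_ev[OF refl _ refl, THEN iffD1, rotated])
      (use greater in \<open>auto simp: flat_def eventually_nhds intro!: exI[of _ "{0<..}"]\<close>)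
next
  case equal
  \<comment> \<open>At the origin the difference quotient is 0 from the left and
    \<open>flat (m + 1) c\<close> from the right.\<close>
  have "((\<lambda>h. flat m c h / h) \<longlongrightarrow> 0) (at 0)"
    unfolding filterlim_at_split
  proof
    show "((\<lambda>h. flat m c h / h) \<longlongrightarrow> 0) (at_left 0)"
      by (rule Lim_transform_eventually[OF tendsto_const])
        (auto simp: flat_def eventually_at_filter)
    show "((\<lambda>h. flat m c h / h) \<longlongrightarrow> 0) (at_right 0)"
      by (rule Lim_transform_eventually[OF flat_tendsto_0[OF c, of "Suc m"]])
        (auto simp: flat_def eventually_at_filter)
  qed
  then show ?thesis
    unfolding equal DERIV_def by (simp add: flat_def)
qed

text \<open>The class contains the bumps below and is closed under partial derivatives, hence consists of
  smooth functions.\<close>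

inductive_set smooth_fns :: "('a::euclidean_space \<Rightarrow> real) set" where
  const: "(\<lambda>_. k) \<in> smooth_fns"
| flat: "0 < c \<Longrightarrow> (\<lambda>x. flat m c (x \<bullet> v - a)) \<in> smooth_fns"
| add: "f \<in> smooth_fns \<Longrightarrow> g \<in> smooth_fns \<Longrightarrow> (\<lambda>x. f x + g x) \<in> smooth_fns"
| mult: "f \<in> smooth_fns \<Longrightarrow> g \<in> smooth_fns \<Longrightarrow> (\<lambda>x. f x * g x) \<in> smooth_fns"

lemma partial_deriv_eqI:
  assumes "(f has_derivative f') (at x)"
  shows "partial_deriv f b x = f' b"
  using frechet_derivative_at[OF assms] by (simp add: partial_deriv_def)

lemma smooth_fns_derivative:
  assumes "f \<in> smooth_fns"
  shows "(\<forall>x. f differentiable (at x)) \<and> (\<forall>b. partial_deriv f b \<in> smooth_fns)"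
  using assms
proof (induction rule: smooth_fns.induct)
  case (const k)
  have "partial_deriv (\<lambda>_. k) b = (\<lambda>_::'a. 0)" for b
    by (intro ext partial_deriv_eqI) simp
  then show ?case
    by (simp add: smooth_fns.const)
next
  case (flat c m v a)
  have d: "((\<lambda>x. flat m c (x \<bullet> v - a)) has_derivative
      (\<lambda>h. (h \<bullet> v) * (c * flat (m + 2) c (x \<bullet> v - a) - real m * flat (m + 1) c (x \<bullet> v - a)))) (at x)" for x
  proof (rule has_derivative_eq_rhs)
    show "((\<lambda>x. flat m c (x \<bullet> v - a)) has_derivative
        (\<lambda>h. (c * flat (m + 2) c (x \<bullet> v - a) - real m * flat (m + 1) c (x \<bullet> v - a)) * (h \<bullet> v))) (at x)"
      by (rule has_derivative_compose[OF _ flat_has_derivative[OF flat, unfolded has_field_derivative_def]])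
        (auto intro!: derivative_eq_intros)
  qed (simp add: mult.commute)
  have "(\<lambda>x. flat m c (x \<bullet> v - a)) differentiable (at x)" for x
    using d by (auto simp: differentiable_def)
  moreover have "partial_deriv (\<lambda>x. flat m c (x \<bullet> v - a)) b = (\<lambda>x. ((b \<bullet> v) * c) * flat (m + 2) c (x \<bullet> v - a) +
      (- real m * (b \<bullet> v)) * flat (m + 1) c (x \<bullet> v - a))" for b
    by (rule ext, subst partial_deriv_eqI[OF d]) (simp add: algebra_simps)
  then have "partial_deriv (\<lambda>x. flat m c (x \<bullet> v - a)) b \<in> smooth_fns" for b
    by (simp only:) (intro smooth_fns.intros flat)
  ultimately show ?case
    by blast
next
  case (add f g)
  have "partial_deriv (\<lambda>x. f x + g x) b = (\<lambda>x. partial_deriv f b x + partial_deriv g b x)" for b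
  proof
    fix x
    show "partial_deriv (\<lambda>x. f x + g x) b x = partial_deriv f b x + partial_deriv g b x"
      using add.IH unfolding partial_deriv_def[of f] partial_deriv_def[of g]
      by (intro partial_deriv_eqI has_derivative_add) (auto simp: frechet_derivative_works)
  qed
  then show ?case
    using add by (auto intro!: smooth_fns.add differentiable_add)
next
  case (mult f g)
  have "partial_deriv (\<lambda>x. f x * g x) b = (\<lambda>x. f x * partial_deriv g b x + partial_deriv f b x * g x)" for b
  proof
    fix x
    show "partial_deriv (\<lambda>x. f x * g x) b x = f x * partial_deriv g b x + partial_deriv f b x * g x"
      using mult.IH unfolding partial_deriv_def[of f] partial_deriv_def[of g]
      by (intro partial_deriv_eqI has_derivative_mult) (auto simp: frechet_derivative_works)
  qed
  then show ?case
    using mult by (auto intro!: smooth_fns.add smooth_fns.mult differentiable_mult)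
qed

lemma smooth_fns_Ck_on: "f \<in> smooth_fns \<Longrightarrow> Ck_on k \<Omega> f"
proof (induction k arbitrary: f)
  case 0
  then show ?case
    using smooth_fns_derivative[OF 0]
    unfolding Ck_on.simps by (intro differentiable_imp_continuous_on) (simp add: differentiable_on_def differentiable_at_withinI)
next
  case (Suc k)
  then show ?case
    using smooth_fns_derivative by auto
qed

lemma smooth_fns_prod:
  "finite I \<Longrightarrow> (\<And>i. i \<in> I \<Longrightarrow> f i \<in> smooth_fns) \<Longrightarrow> (\<lambda>x. \<Prod>i\<in>I. f i x) \<in> smooth_fns"
  by (induction I rule: finite_induct) (auto intro: smooth_fns.intros)

text \<open>Each coordinate contributes two factors, one vanishing at and beyond the lower face and
  one at and beyond the upper face; the vector \<open>- i\<close> turns the second into a function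
  of \<open>b \<bullet> i - x \<bullet> i\<close>. The parameter \<open>1 / (n + 1)\<close> lets all
  factors tend to 1 inside the box.\<close>

definition box_bump :: "nat \<Rightarrow> 'a::euclidean_space \<Rightarrow> 'a \<Rightarrow> 'a \<Rightarrow> real"
  where "box_bump n a b x = (\<Prod>i\<in>Basis. flat 0 (1 / real (Suc n)) (x \<bullet> i - a \<bullet> i) *
    flat 0 (1 / real (Suc n)) (x \<bullet> (- i) - (- (b \<bullet> i))))"

lemma box_bump_eq_0:
  assumes "x \<notin> box a b"
  shows "box_bump n a b x = 0"
proof -
  obtain i where "i \<in> Basis" "x \<bullet> i \<le> a \<bullet> i \<or> b \<bullet> i \<le> x \<bullet> i"
    using assms by (auto simp: mem_box not_less)
  then show ?thesis
    unfolding box_bump_def by (intro prod_zero) (auto simp: flat_def intro!: bexI[of _ i])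
qed

lemma flat_0_bounds: "0 < c \<Longrightarrow> 0 \<le> flat 0 c t" "0 < c \<Longrightarrow> flat 0 c t \<le> 1"
  by (auto simp: flat_def)

lemma box_bump_bounds: "0 \<le> box_bump n a b x" "box_bump n a b x \<le> 1"
  unfolding box_bump_def
  by (auto intro!: prod_nonneg prod_le_1 mult_le_one flat_0_bounds mult_nonneg_nonneg)

lemma box_bump_tendsto: "(\<lambda>n. box_bump n a b x) \<longlonglongrightarrow> indicator (box a b) x"
proof (cases "x \<in> box a b")
  case True
  have *: "(\<lambda>n. flat 0 (1 / real (Suc n)) t) \<longlonglongrightarrow> 1" if "0 < t" for t
  proof -
    have "(\<lambda>n. exp (- (1 / real (Suc n)) / t)) \<longlonglongrightarrow> exp (- 0 / t)"
      using LIMSEQ_inverse_real_of_nat that by (intro tendsto_intros) (auto simp: inverse_eq_divide)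
    then show ?thesis
      using that by (simp add: flat_def)
  qed
  have "(\<lambda>n. box_bump n a b x) \<longlonglongrightarrow> (\<Prod>i\<in>(Basis :: 'a set). 1 * 1)"
    unfolding box_bump_def using True by (intro tendsto_prod tendsto_mult *) (auto simp: mem_box)
  then show ?thesis
    using True by simp
next
  case False
  then show ?thesis
    by (simp add: box_bump_eq_0)
qed

lemma box_bump_test_function:
  assumes "cbox a b \<subseteq> \<Omega>"
  shows "box_bump n a b \<in> test_functions \<Omega>"
proof -
  have "box_bump n a b \<in> smooth_fns"
    unfolding box_bump_def by (intro smooth_fns_prod smooth_fns.mult smooth_fns.flat) auto
  moreover have "closure {x. box_bump n a b x \<noteq> 0} \<subseteq> cbox a b"
    using box_bump_eq_0[of _ a b n] box_subset_cbox[of a b] by (intro closure_minimal) auto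
  moreover have "compact (closure {x. box_bump n a b x \<noteq> 0})"
    using calculation(2) bounded_subset[OF bounded_cbox] by (simp add: compact_eq_bounded_closed)
  ultimately show ?thesis
    using assms by (auto simp: test_functions_def smooth_fns_Ck_on)
qed

subsection \<open>Uniqueness of the divergence\<close>

text \<open>Boxes are an intersection-stable generator of the Borel sets, so a Dynkin argument makes
  all Borel integrals vanish; the integral over the whole space enters for complements. As
  \<open>H\<close> is only Lebesgue measurable, the argument runs on a Borel function equal to it
  almost everywhere.\<close>

lemma AE_zero_if_box_integrals_zero:
  fixes H :: "'a::euclidean_space \<Rightarrow> real"
  assumes H: "integrable lebesgue H" and UNIV: "(\<integral>x. H x \<partial>lebesgue) = 0"
    and box: "\<And>a b. (LINT x:box a b|lebesgue. H x) = 0"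
  shows "AE x in lebesgue. H x = 0"
proof -
  obtain H' where H'[measurable]: "H' \<in> borel_measurable lborel" and eq: "AE x in lborel. H x = H' x"
    using completion_ex_borel_measurable_real[of H lborel] H by auto
  have eq': "AE x in lebesgue. H x = H' x"
    using eq by (rule AE_completion)
  have int': "integrable lborel H'"
  proof -
    have "integrable lebesgue H'"
      by (rule integrable_cong_AE_imp[OF H _ eq']) (rule measurable_completion[OF H'])
    then show ?thesis
      by (subst (asm) integrable_completion) auto
  qed
  have leb: "(LINT x:A|lebesgue. H x) = (LINT x:A|lborel. H' x)" if [measurable]: "A \<in> sets borel" for A
  proof -
    have "(LINT x:A|lebesgue. H x) = (LINT x:A|lebesgue. H' x)"
      unfolding set_lebesgue_integral_def
    proof (rule integral_cong_AE)
      have [measurable]: "A \<in> sets lebesgue" "H \<in> borel_measurable lebesgue" "H' \<in> borel_measurable lebesgue"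
        using that H measurable_completion[OF H'] by auto
      show "(\<lambda>x. indicat_real A x *\<^sub>R H x) \<in> borel_measurable lebesgue"
        "(\<lambda>x. indicat_real A x *\<^sub>R H' x) \<in> borel_measurable lebesgue"
        by measurable
    qed (use eq' in \<open>auto elim!: eventually_mono\<close>)
    also have "\<dots> = (LINT x:A|lborel. H' x)"
      unfolding set_lebesgue_integral_def by (intro integral_completion) measurable
    finally show ?thesis .
  qed
  have set_int: "set_integrable lborel A H'" if "A \<in> sets borel" for A
    unfolding set_integrable_def using that int' by (intro integrable_mult_indicator) auto
  have zero: "(LINT x:A|lborel. H' x) = 0" if "A \<in> sets borel" for A
  proof -
    have "Int_stable (range (\<lambda>(a, b). box a b :: 'a set))"
      unfolding Int_stable_def by (auto simp: Int_interval box_Int_box) 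
    moreover have "range (\<lambda>(a, b). box a b :: 'a set) \<subseteq> Pow UNIV"
      by auto
    moreover have "A \<in> sigma_sets UNIV (range (\<lambda>(a, b). box a b))"
      using that by (simp add: borel_eq_box)
    ultimately show ?thesis
    proof (induction rule: sigma_sets_induct_disjoint)
      case (basic A)
      then obtain a b where "A = box a b" by auto
      then show ?case
        using leb[of "box a b"] box by simp
    next
      case empty
      then show ?case by (simp add: set_lebesgue_integral_def)
    next
      case (compl A)
      then have A: "A \<in> sets borel"
        by (simp add: borel_eq_box)
      have si: "set_integrable lborel A H'" "set_integrable lborel (UNIV - A) H'"
        using A by (auto intro!: set_int)
      have "(LINT x:A \<union> (UNIV - A)|lborel. H' x) = (LINT x:A|lborel. H' x) + (LINT x:UNIV - A|lborel. H' x)"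
        by (intro set_integral_Un si) auto
      moreover have "(LINT x:UNIV|lborel. H' x) = 0"
        using leb[of UNIV] UNIV by (simp add: set_lebesgue_integral_def)
      ultimately show ?case
        using compl by simp
    next
      case (union A)
      then have A: "A i \<in> sets lborel" for i
        by (auto simp: borel_eq_box)
      have "(LINT x:(\<Union>i. A i)|lborel. H' x) = (\<Sum>i. LINT x:A i|lborel. H' x)"
        using A union.hyps(1)
        by (intro lebesgue_integral_countable_add set_int) (auto simp: disjoint_family_on_def)
      then show ?case
        using union by simp
    qed
  qed
  \<comment> \<open>The integral over the set where \<open>k * H'\<close> is positive vanishes;
    \<open>k = 1\<close> and \<open>k = -1\<close> treat the two signs.\<close>
  have half: "AE x in lborel. indicator {x. 0 < k * H' x} x *\<^sub>R (k * H' x) = 0" for k :: real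
  proof (rule integral_nonneg_eq_0_iff_AE[THEN iffD1])
    have [measurable]: "{x. 0 < k * H' x} \<in> sets lborel"
      by measurable
    show "integrable lborel (\<lambda>x. indicator {x. 0 < k * H' x} x *\<^sub>R (k * H' x))"
      using int' by (intro integrable_mult_indicator integrable_mult_right) auto
    show "(\<integral>x. indicator {x. 0 < k * H' x} x *\<^sub>R (k * H' x) \<partial>lborel) = 0"
      using zero[of "{x. 0 < k * H' x}"] by (simp add: set_lebesgue_integral_def mult.left_commute)
  qed (auto split: split_indicator)
  have "AE x in lborel. H' x = 0"
    using half[of 1] half[of "-1"] by eventually_elim (auto simp: indicator_def split: if_splits)
  then have "AE x in lborel. H x = 0"
    using eq by eventually_elim simp
  then show ?thesis
    by (rule AE_completion)
qed

lemma Lp_iff: "h \<in> Lp p \<Omega> \<longleftrightarrow> p_integrable (lebesgue_on \<Omega>) p h"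
  by (simp add: Lp_def p_integrable_def)

lemma bounded_finite_supportI:
  fixes \<phi> :: "'a::euclidean_space \<Rightarrow> real"
  assumes \<Omega>: "open \<Omega>" and cont: "continuous_on \<Omega> \<phi>" and bd: "bounded (\<phi> ` \<Omega>)"
    and supp: "bounded {x \<in> \<Omega>. \<phi> x \<noteq> 0}"
  shows "bounded_finite_support (lebesgue_on \<Omega>) \<phi>"
proof -
  have \<Omega>_leb: "\<Omega> \<in> sets lebesgue"
    using \<Omega> by auto
  have meas: "\<phi> \<in> borel_measurable (lebesgue_on \<Omega>)"
    by (rule continuous_imp_measurable_on_sets_lebesgue[OF cont \<Omega>_leb])
  obtain C where C: "\<And>x. x \<in> \<Omega> \<Longrightarrow> \<bar>\<phi> x\<bar> \<le> C"
    using bd by (auto simp: bounded_iff)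
  obtain R where R: "\<And>x. x \<in> \<Omega> \<Longrightarrow> \<phi> x \<noteq> 0 \<Longrightarrow> norm x \<le> R"
    using supp by (auto simp: bounded_iff)
  define S where "S = \<Omega> \<inter> cball 0 R"
  have "S \<in> sets lebesgue"
    using \<Omega>_leb by (auto simp: S_def)
  have "S \<in> sets (lebesgue_on \<Omega>)"
    using \<Omega>_leb \<open>S \<in> sets lebesgue\<close> by (simp add: S_def sets_restrict_space_iff)
  moreover have "emeasure (lebesgue_on \<Omega>) S < \<infinity>"
  proof -
    have "emeasure (lebesgue_on \<Omega>) S = emeasure lebesgue S"
      using \<Omega>_leb by (intro emeasure_restrict_space) (auto simp: S_def)
    also have "\<dots> \<le> emeasure lebesgue (cball 0 R :: 'a set)"
      by (intro emeasure_mono) (auto simp: S_def)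
    also have "\<dots> < \<infinity>"
      using emeasure_bounded_finite[OF bounded_cball] by simp
    finally show ?thesis .
  qed
  moreover have "\<forall>x\<in>space (lebesgue_on \<Omega>). \<bar>\<phi> x\<bar> \<le> C * indicator S x"
    using C R by (auto simp: S_def split: split_indicator)
  ultimately show ?thesis
    using meas by (auto simp: bounded_finite_support_def)
qed

text \<open>An \<open>L^p\<close> function need not be integrable on all of \<Omega>, so the claim
  is localised to closed boxes inside \<Omega>, countably many of which cover it. In such a box all
  integrals over smaller boxes vanish as limits of integrals against bumps.\<close>

lemma AE_zero_if_test_integrals_zero:
  fixes h :: "'a::euclidean_space \<Rightarrow> real"
  assumes \<Omega>: "open \<Omega>" and p: "1 < p" and h: "h \<in> Lp p \<Omega>"
    and zero: "\<And>\<phi>. \<phi> \<in> test_functions \<Omega> \<Longrightarrow> (\<integral>x. \<phi> x * h x \<partial>lebesgue_on \<Omega>) = 0"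
  shows "AE x in lebesgue_on \<Omega>. h x = 0"
proof -
  have \<Omega>_leb: "\<Omega> \<in> sets lebesgue"
    using \<Omega> by auto
  have [measurable]: "h \<in> borel_measurable (lebesgue_on \<Omega>)"
    using h by (simp add: Lp_def)
  have box_AE: "AE x in lebesgue. x \<in> cbox c d \<longrightarrow> h x = 0" if sub: "cbox c d \<subseteq> \<Omega>" for c d
  proof -
    \<comment> \<open>Truncation to the open box makes the function integrable and extends it by 0
      to the whole space, as the box criterion requires.\<close>
    define H where "H = (\<lambda>x. indicator (box c d) x * h x)"
    have boxc: "box c d \<subseteq> \<Omega>"
      using sub box_subset_cbox[of c d] by blast
    have [measurable]: "box a b \<in> sets (lebesgue_on \<Omega>)" if "box a b \<subseteq> \<Omega>" for a b
      using \<Omega>_leb that by (simp add: sets_restrict_space_iff)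
    have "bounded_finite_support (lebesgue_on \<Omega>) (indicator (box c d))"
      unfolding bounded_finite_support_def
    proof (intro conjI exI)
      show "indicat_real (box c d) \<in> borel_measurable (lebesgue_on \<Omega>)"
        using boxc by measurable
      show "box c d \<in> sets (lebesgue_on \<Omega>)"
        using boxc by measurable
      have "emeasure (lebesgue_on \<Omega>) (box c d) = emeasure lebesgue (box c d)"
        using \<Omega>_leb boxc by (intro emeasure_restrict_space) auto
      then show "emeasure (lebesgue_on \<Omega>) (box c d) < \<infinity>"
        using emeasure_bounded_finite[OF bounded_box[of c d]] by simp
      show "\<forall>x\<in>space (lebesgue_on \<Omega>). \<bar>indicat_real (box c d) x\<bar> \<le> 1 * indicator (box c d) x"
        by (auto split: split_indicator)
    qed
    then have intO: "integrable (lebesgue_on \<Omega>) H"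
      unfolding H_def using pairing_bound[OF _ p] h by (metis Lp_iff)
    have toO: "(\<integral>x. u x \<partial>lebesgue_on \<Omega>) = (\<integral>x. u x \<partial>lebesgue) \<and> (integrable (lebesgue_on \<Omega>) u \<longleftrightarrow> integrable lebesgue u)"
      if "\<And>x. x \<notin> \<Omega> \<Longrightarrow> u x = 0" for u :: "'a \<Rightarrow> real"
    proof -
      have "(\<lambda>x. indicator \<Omega> x *\<^sub>R u x) = u"
        using that by (auto simp: fun_eq_iff split: split_indicator)
      then show ?thesis
        using \<Omega>_leb integral_restrict_space[of \<Omega> lebesgue u] integrable_restrict_space[of \<Omega> lebesgue u] by simp
    qed
    have H0: "H x = 0" if "x \<notin> \<Omega>" for x
      using that boxc by (auto simp: H_def split: split_indicator)
    have inner: "(\<integral>x. indicator (box a b) x * h x \<partial>lebesgue_on \<Omega>) = 0" if ab: "box a b \<subseteq> box c d" for a b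
    proof (cases "box a b = {}")
      case True
      then show ?thesis by simp
    next
      case False
      \<comment> \<open>The supports of the bumps lie in the closed box, which must stay inside
        \<Omega>. The inclusion of open boxes passes to closures only for a nonempty box, hence the
        case distinction.\<close>
      have "cbox a b \<subseteq> cbox c d"
        using closure_mono[OF ab] closure_box[OF False] closure_minimal[OF box_subset_cbox closed_cbox, of c d]
        by blast
      then have t: "box_bump n a b \<in> test_functions \<Omega>" for n
        using sub by (intro box_bump_test_function) auto
      have "(\<lambda>n. \<integral>x. box_bump n a b x * h x \<partial>lebesgue_on \<Omega>) \<longlonglongrightarrow> (\<integral>x. indicator (box a b) x * h x \<partial>lebesgue_on \<Omega>)"
      proof (rule integral_dominated_convergence[where w = "\<lambda>x. \<bar>H x\<bar>"])
        show "integrable (lebesgue_on \<Omega>) (\<lambda>x. \<bar>H x\<bar>)"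
          using intO by simp
        have "box a b \<subseteq> \<Omega>"
          using ab boxc by blast
        then show "(\<lambda>x. indicator (box a b) x * h x) \<in> borel_measurable (lebesgue_on \<Omega>)"
          by measurable
        show "(\<lambda>x. box_bump n a b x * h x) \<in> borel_measurable (lebesgue_on \<Omega>)" for n
        proof -
          have "continuous_on \<Omega> (box_bump n a b)"
            using t[of n] unfolding test_functions_def by (auto dest: spec[of _ 0])
          then have "box_bump n a b \<in> borel_measurable (lebesgue_on \<Omega>)"
            using \<Omega>_leb by (rule continuous_imp_measurable_on_sets_lebesgue)
          then show ?thesis
            by measurable
        qed
        show "AE x in lebesgue_on \<Omega>. (\<lambda>n. box_bump n a b x * h x) \<longlonglongrightarrow> indicator (box a b) x * h x"
          by (intro AE_I2 tendsto_intros box_bump_tendsto)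
        show "AE x in lebesgue_on \<Omega>. norm (box_bump n a b x * h x) \<le> \<bar>H x\<bar>" for n
        proof (rule AE_I2)
          fix x
          show "norm (box_bump n a b x * h x) \<le> \<bar>H x\<bar>"
            using box_bump_bounds[of n a b x] box_bump_eq_0[of x a b n] ab
            by (cases "x \<in> box a b") (auto simp: H_def abs_mult mult_left_le_one_le)
        qed
      qed
      then show ?thesis
        using zero[OF t] by (simp add: LIMSEQ_const_iff)
    qed
    have "AE x in lebesgue. H x = 0"
    proof (rule AE_zero_if_box_integrals_zero)
      show "integrable lebesgue H"
        using toO[of H] H0 intO by blast
      show "(\<integral>x. H x \<partial>lebesgue) = 0"
        using toO[of H] H0 inner[OF order_refl] by (simp add: H_def)
      fix a b
      obtain a' b' where ab: "box a b \<inter> box c d = box a' b'"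
        using box_Int_box by blast
      have "(LINT x:box a b|lebesgue. H x) = (\<integral>x. indicator (box a' b') x * h x \<partial>lebesgue)"
        unfolding set_lebesgue_integral_def H_def ab[symmetric]
        by (intro Bochner_Integration.integral_cong) (auto split: split_indicator)
      also have "\<dots> = (\<integral>x. indicator (box a' b') x * h x \<partial>lebesgue_on \<Omega>)"
      proof -
        have "indicator (box a' b') x * h x = 0" if "x \<notin> \<Omega>" for x
          using that ab boxc by (auto split: split_indicator)
        then show ?thesis
          by (rule toO[THEN conjunct1, symmetric])
      qed
      also have "\<dots> = 0"
        using ab by (intro inner) blast
      finally show "(LINT x:box a b|lebesgue. H x) = 0" .
    qed
    \<comment> \<open>\<open>H\<close> says nothing about \<open>h\<close> on the faces of the box,
      which form a null set.\<close>
    moreover have "AE x in lebesgue. x \<notin> cbox c d - box c d"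
      using negligible_frontier_interval[of c d] by (intro AE_not_in) (simp add: negligible_iff_null_sets)
    ultimately show ?thesis
      by eventually_elim (auto simp: H_def indicator_def split: if_splits)
  qed
  obtain \<D> where \<D>: "countable \<D>" "\<And>X. X \<in> \<D> \<Longrightarrow> \<exists>c d. X = cbox c d" "\<Union>\<D> = \<Omega>"
    using open_countable_Union_open_cbox[OF \<Omega>] by metis
  have "AE x in lebesgue. \<forall>X\<in>\<D>. x \<in> X \<longrightarrow> h x = 0"
    unfolding AE_ball_countable[OF \<D>(1)]
  proof
    fix X assume X: "X \<in> \<D>"
    then obtain c d where "X = cbox c d"
      using \<D>(2) by blast
    then show "AE x in lebesgue. x \<in> X \<longrightarrow> h x = 0"
      using box_AE[of c d] X \<D>(3) by blast
  qed
  then have "AE x in lebesgue. x \<in> \<Omega> \<longrightarrow> h x = 0"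
    by eventually_elim (use \<D>(3) in blast)
  then show ?thesis
    using \<Omega>_leb by (subst AE_restrict_space_iff) auto
qed

subsection \<open>Test functions, bounded \<open>C\<^sup>1\<close> functions and cutoffs\<close>

lemma grad_inner: "b \<in> Basis \<Longrightarrow> grad \<phi> x \<bullet> b = partial_deriv \<phi> b x"
  by (simp add: grad_def)

lemma grad_measurable_bounded:
  fixes \<phi> :: "'a::euclidean_space \<Rightarrow> real"
  assumes \<alpha>: "\<alpha> \<in> nonneg_measures \<Omega>"
    and C1: "Ck_on 1 \<Omega> \<phi>" and bd: "\<And>b. b \<in> Basis \<Longrightarrow> bounded (partial_deriv \<phi> b ` \<Omega>)"
  shows "grad \<phi> \<in> borel_measurable \<alpha>" "\<exists>C. \<forall>x\<in>\<Omega>. norm (grad \<phi> x) \<le> C"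
proof -
  note S = nonneg_measuresD[OF \<alpha>]
  have "partial_deriv \<phi> b \<in> borel_measurable \<alpha>" if "b \<in> Basis" for b
  proof -
    have "continuous_on \<Omega> (partial_deriv \<phi> b)"
      using C1 that by simp
    then have "partial_deriv \<phi> b \<in> borel_measurable (borel_on \<Omega>)"
      by (rule borel_measurable_continuous_on_restrict)
    then show ?thesis
      using measurable_cong_sets[OF S(1) refl] by blast
  qed
  then show "grad \<phi> \<in> borel_measurable \<alpha>"
    unfolding grad_def[abs_def] by (intro borel_measurable_sum borel_measurable_scaleR) auto
  have "\<exists>C. \<forall>x\<in>\<Omega>. \<bar>partial_deriv \<phi> b x\<bar> \<le> C" if "b \<in> Basis" for b
    using bd[OF that] by (auto simp: bounded_iff)
  then obtain C where C: "\<And>b x. b \<in> Basis \<Longrightarrow> x \<in> \<Omega> \<Longrightarrow> \<bar>partial_deriv \<phi> b x\<bar> \<le> C b"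
    by metis
  have "norm (grad \<phi> x) \<le> (\<Sum>b\<in>Basis. C b)" if "x \<in> \<Omega>" for x
    unfolding grad_def using C that by (intro order_trans[OF norm_sum] sum_mono) auto
  then show "\<exists>C. \<forall>x\<in>\<Omega>. norm (grad \<phi> x) \<le> C"
    by blast
qed

lemma Ck_on_1_continuous: "Ck_on 1 \<Omega> \<phi> \<Longrightarrow> continuous_on \<Omega> \<phi>"
  by (rule differentiable_imp_continuous_on) (simp add: differentiable_on_def differentiable_at_withinI)

text \<open>Off the compact support \<phi> and its partial derivatives vanish, so their boundedness
  on \<Omega> reduces to continuity on a compact set.\<close>

lemma test_functions_regular:
  fixes \<phi> :: "'a::euclidean_space \<Rightarrow> real"
  assumes "\<phi> \<in> test_functions \<Omega>"
  shows "Ck_on 1 \<Omega> \<phi>" "bounded (\<phi> ` \<Omega>)" "\<And>b. b \<in> Basis \<Longrightarrow> bounded (partial_deriv \<phi> b ` \<Omega>)"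
    "bounded {x \<in> \<Omega>. \<phi> x \<noteq> 0}"
proof -
  define K where "K = closure {x. \<phi> x \<noteq> 0}"
  have K: "compact K" "K \<subseteq> \<Omega>" and C1: "Ck_on 1 \<Omega> \<phi>"
    using assms unfolding test_functions_def K_def by blast+
  show "Ck_on 1 \<Omega> \<phi>"
    by fact
  have out: "\<phi> x = 0" if "x \<notin> K" for x
    using that closure_subset[of "{x. \<phi> x \<noteq> 0}"] by (auto simp: K_def)
  have bounded_image: "bounded (u ` \<Omega>)" if "continuous_on \<Omega> u" "\<And>x. x \<notin> K \<Longrightarrow> u x = 0" for u :: "'a \<Rightarrow> real"
  proof (rule bounded_subset)
    show "bounded (insert 0 (u ` K))"
      using compact_continuous_image[OF continuous_on_subset[OF that(1) K(2)] K(1)] compact_imp_bounded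
      by simp
    show "u ` \<Omega> \<subseteq> insert 0 (u ` K)"
      using that(2) by auto
  qed
  show "bounded (\<phi> ` \<Omega>)"
    using Ck_on_1_continuous[OF C1] out by (rule bounded_image)
  show "bounded {x \<in> \<Omega>. \<phi> x \<noteq> 0}"
    by (rule bounded_subset[OF compact_imp_bounded[OF K(1)]]) (use out in auto)
  fix b :: 'a assume "b \<in> Basis"
  have "partial_deriv \<phi> b x = 0" if "x \<notin> K" for x
  proof -
    have "((\<lambda>_. 0) has_derivative (\<lambda>_. 0)) (at x)"
      by simp
    then have "(\<phi> has_derivative (\<lambda>_. 0)) (at x)"
      by (rule has_derivative_transform_within_open[OF _ open_Compl[of K]])
        (use that out K compact_imp_closed in auto)
    then show ?thesis
      by (rule partial_deriv_eqI)
  qed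
  moreover have "continuous_on \<Omega> (partial_deriv \<phi> b)"
    using C1 \<open>b \<in> Basis\<close> by simp
  ultimately show "bounded (partial_deriv \<phi> b ` \<Omega>)"
    by (intro bounded_image)
qed

text \<open>The difference of two divergences integrates to 0 against every test function. Bounded
  support makes each product integrable, so the integral of the difference splits.\<close>

lemma has_divergence_unique:
  fixes h h' :: "'a::euclidean_space \<Rightarrow> real"
  assumes \<Omega>: "open \<Omega>" and p: "1 < p" and h: "has_divergence p \<Omega> \<mu> h" and h': "has_divergence p \<Omega> \<mu> h'"
  shows "AE x in lebesgue_on \<Omega>. h x = h' x"
proof -
  have Lp: "p_integrable (lebesgue_on \<Omega>) p h" "p_integrable (lebesgue_on \<Omega>) p h'"
    using h h' by (simp_all add: has_divergence_def Lp_iff)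
  have "AE x in lebesgue_on \<Omega>. h x - h' x = 0"
  proof (rule AE_zero_if_test_integrals_zero[OF \<Omega> p])
    show "(\<lambda>x. h x - h' x) \<in> Lp p \<Omega>"
      using p_integrable_diff[OF _ Lp] p by (simp add: Lp_iff)
    fix \<phi> assume \<phi>: "\<phi> \<in> test_functions \<Omega>"
    note reg = test_functions_regular[OF \<phi>]
    have "bounded_finite_support (lebesgue_on \<Omega>) \<phi>"
      by (rule bounded_finite_supportI[OF \<Omega> Ck_on_1_continuous[OF reg(1)] reg(2,4)])
    then have "integrable (lebesgue_on \<Omega>) (\<lambda>x. \<phi> x * h x)" "integrable (lebesgue_on \<Omega>) (\<lambda>x. \<phi> x * h' x)"
      using pairing_bound[OF _ p] Lp by metis+
    moreover have "- (\<integral>x. \<phi> x * h x \<partial>lebesgue_on \<Omega>) = - (\<integral>x. \<phi> x * h' x \<partial>lebesgue_on \<Omega>)"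
      using h h' \<phi> by (auto simp: has_divergence_def)
    ultimately show "(\<integral>x. \<phi> x * (h x - h' x) \<partial>lebesgue_on \<Omega>) = 0"
      by (simp add: right_diff_distrib)
  qed
  then show ?thesis
    by eventually_elim simp
qed

text \<open>A smooth bump on the ball of radius \<open>n + 1\<close>. The squared norm keeps it
  differentiable at the origin, and the factor \<open>exp 1\<close> normalises its value there to
  1.\<close>

definition cutoff :: "nat \<Rightarrow> 'a::euclidean_space \<Rightarrow> real"
  where "cutoff n x = exp 1 * flat 0 1 (1 - (x \<bullet> x) / (real (Suc n))\<^sup>2)"

text \<open>The derivative of \<open>flat 0 1\<close> is \<open>flat 2 1\<close>; the remaining
  factors come from the chain rule for the squared norm.\<close>

definition grad_cutoff :: "nat \<Rightarrow> 'a::euclidean_space \<Rightarrow> 'a"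
  where "grad_cutoff n x = (exp 1 * flat 2 1 (1 - (x \<bullet> x) / (real (Suc n))\<^sup>2) * (- 2 / (real (Suc n))\<^sup>2)) *\<^sub>R x"

lemma continuous_on_flat:
  assumes "0 < c" and "continuous_on A u"
  shows "continuous_on A (\<lambda>x. flat m c (u x))"
proof -
  have "continuous_on UNIV (flat m c)"
    by (intro continuous_at_imp_continuous_on ballI DERIV_isCont[OF flat_has_derivative] assms(1))
  then show ?thesis
    by (rule continuous_on_compose2) (use assms(2) in auto)
qed

lemma cutoff_has_derivative:
  "(cutoff n has_derivative (\<lambda>y. grad_cutoff n x \<bullet> y)) (at x)"
proof -
  have "((\<lambda>x. flat 0 1 (1 - (x \<bullet> x) / (real (Suc n))\<^sup>2)) has_derivative
      (\<lambda>y. (1 * flat (0 + 2) 1 (1 - (x \<bullet> x) / (real (Suc n))\<^sup>2) - real 0 * flat (0 + 1) 1 (1 - (x \<bullet> x) / (real (Suc n))\<^sup>2)) *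
        (- (2 * (x \<bullet> y) / (real (Suc n))\<^sup>2)))) (at x)"
    by (rule has_derivative_compose[OF _ flat_has_derivative[unfolded has_field_derivative_def]])
      (auto intro!: derivative_eq_intros simp: inner_commute fun_eq_iff power2_eq_square power4_eq_xxxx)
  from has_derivative_mult_right[OF this, of "exp 1"] show ?thesis
    unfolding cutoff_def[abs_def]
    by (rule has_derivative_eq_rhs) (simp add: grad_cutoff_def fun_eq_iff numeral_2_eq_2)
qed

lemma continuous_on_cutoff: "continuous_on A (cutoff n)" "continuous_on A (grad_cutoff n)"
  unfolding cutoff_def[abs_def] grad_cutoff_def[abs_def]
  by (intro continuous_on_mult continuous_on_scaleR continuous_on_diff continuous_on_divide
      continuous_on_inner continuous_on_const continuous_on_id continuous_on_flat; simp)+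

text \<open>A crude bound from \<open>flat 0 1 \<le> 1\<close>; what matters for dominated
  convergence is that it is uniform in \<open>n\<close> and \<open>x\<close>.\<close>

lemma cutoff_bounds: "0 \<le> cutoff n x" "cutoff n x \<le> exp 1"
  using flat_0_bounds[of 1] by (simp_all add: cutoff_def)

lemma cutoff_eq_0:
  assumes "real (Suc n) \<le> norm x"
  shows "cutoff n x = 0" "grad_cutoff n x = 0"
proof -
  have "(real (Suc n))\<^sup>2 \<le> x \<bullet> x"
    using assms by (simp add: dot_square_norm power_mono del: of_nat_Suc)
  then have "\<not> 0 < 1 - (x \<bullet> x) / (real (Suc n))\<^sup>2"
    by (simp add: field_simps del: of_nat_Suc)
  then show "cutoff n x = 0" "grad_cutoff n x = 0"
    by (simp_all add: cutoff_def grad_cutoff_def flat_def del: of_nat_Suc)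
qed

text \<open>With \<open>s = 1 / t\<close> the upper bound is \<open>s ^ 2 / 2 \<le> exp s\<close>,
  the quadratic Taylor estimate.\<close>

lemma flat_2_bounds: "0 \<le> flat 2 1 t" "flat 2 1 t \<le> 2"
proof -
  show "0 \<le> flat 2 1 t"
    by (simp add: flat_def)
  show "flat 2 1 t \<le> 2"
  proof (cases "0 < t")
    case True
    have "(1 / t)\<^sup>2 / 2 \<le> exp (1 / t)"
      using exp_lower_Taylor_quadratic[of "1 / t"] divide_pos_pos[OF zero_less_one True] by linarith
    then show ?thesis
      using True by (simp add: flat_def exp_minus field_simps)
  qed (simp add: flat_def)
qed

text \<open>Inside the ball of radius \<open>R = n + 1\<close> the chain rule gives a factor of
  order \<open>1 / R ^ 2\<close> times \<open>norm x \<le> R\<close>; outside the gradient is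
  0.\<close>

lemma norm_grad_cutoff: "norm (grad_cutoff n x) \<le> 4 * exp 1 / real (Suc n)"
proof (cases "real (Suc n) \<le> norm x")
  case True
  then show ?thesis
    by (simp add: cutoff_eq_0)
next
  case False
  define R where "R = real (Suc n)"
  have R: "0 < R" "norm x \<le> R"
    using False by (simp_all add: R_def)
  define a where "a = flat 2 1 (1 - (x \<bullet> x) / R\<^sup>2)"
  have "norm (grad_cutoff n x) = exp 1 * (a * 2 / R\<^sup>2 * norm x)"
    using flat_2_bounds(1) by (simp add: grad_cutoff_def a_def R_def[symmetric] abs_mult del: of_nat_Suc)
  also have "\<dots> \<le> exp 1 * (2 * 2 / R\<^sup>2 * R)"
    using flat_2_bounds R by (intro mult_left_mono mult_mono divide_right_mono) (auto simp: a_def)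
  also have "\<dots> = 4 * exp 1 / R"
    using R by (simp add: power2_eq_square)
  finally show ?thesis
    by (simp add: R_def)
qed

lemma cutoff_tendsto: "(\<lambda>n. cutoff n x) \<longlonglongrightarrow> 1" "(\<lambda>n. grad_cutoff n x) \<longlonglongrightarrow> 0"
proof -
  have inv0: "(\<lambda>n. 1 / real (Suc n)) \<longlonglongrightarrow> 0"
    using LIMSEQ_inverse_real_of_nat by (simp add: inverse_eq_divide)
  have "(\<lambda>n. 1 - (x \<bullet> x) * (1 / real (Suc n))\<^sup>2) \<longlonglongrightarrow> 1 - (x \<bullet> x) * 0\<^sup>2"
    by (intro tendsto_intros inv0)
  then have s: "(\<lambda>n. 1 - (x \<bullet> x) / (real (Suc n))\<^sup>2) \<longlonglongrightarrow> 1"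
    by (simp add: power_divide)
  have "isCont (flat 0 1) 1"
    by (rule DERIV_isCont[OF flat_has_derivative]) simp
  from isCont_tendsto_compose[OF this s]
  have "(\<lambda>n. cutoff n x) \<longlonglongrightarrow> exp 1 * flat 0 1 1"
    unfolding cutoff_def by (intro tendsto_intros)
  also have "exp 1 * flat 0 1 1 = (1::real)"
    by (simp add: flat_def exp_minus)
  finally show "(\<lambda>n. cutoff n x) \<longlonglongrightarrow> 1" .
  have "(\<lambda>n. 4 * exp 1 * (1 / real (Suc n))) \<longlonglongrightarrow> 4 * exp 1 * 0"
    by (intro tendsto_intros inv0)
  then have lim: "(\<lambda>n. 4 * exp 1 / real (Suc n)) \<longlonglongrightarrow> 0"
    by (simp del: of_nat_Suc)
  show "(\<lambda>n. grad_cutoff n x) \<longlonglongrightarrow> 0"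
    by (rule Lim_null_comparison[OF _ lim]) (rule always_eventually, rule allI, rule norm_grad_cutoff)
qed

lemma grad_cutoff_mult:
  fixes \<phi> :: "'a::euclidean_space \<Rightarrow> real"
  assumes "\<phi> differentiable (at x)"
  shows "partial_deriv (\<lambda>x. cutoff n x * \<phi> x) b x = cutoff n x * partial_deriv \<phi> b x + (grad_cutoff n x \<bullet> b) * \<phi> x"
    and "grad (\<lambda>x. cutoff n x * \<phi> x) x = cutoff n x *\<^sub>R grad \<phi> x + \<phi> x *\<^sub>R grad_cutoff n x"
proof -
  have 1: "partial_deriv (\<lambda>x. cutoff n x * \<phi> x) b x = cutoff n x * partial_deriv \<phi> b x + (grad_cutoff n x \<bullet> b) * \<phi> x" for b
    using assms unfolding partial_deriv_def[of \<phi>]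
    by (intro partial_deriv_eqI has_derivative_mult cutoff_has_derivative) (simp add: frechet_derivative_works)
  then show "partial_deriv (\<lambda>x. cutoff n x * \<phi> x) b x = cutoff n x * partial_deriv \<phi> b x + (grad_cutoff n x \<bullet> b) * \<phi> x" .
  show "grad (\<lambda>x. cutoff n x * \<phi> x) x = cutoff n x *\<^sub>R grad \<phi> x + \<phi> x *\<^sub>R grad_cutoff n x"
    by (rule euclidean_eqI) (simp add: grad_inner 1 inner_add_left)
qed

lemma C1b_closure_regular:
  assumes "\<phi> \<in> C1b_closure \<Omega>"
  shows "Ck_on 1 \<Omega> \<phi>" "bounded (\<phi> ` \<Omega>)" "\<And>b. b \<in> Basis \<Longrightarrow> bounded (partial_deriv \<phi> b ` \<Omega>)"
    "continuous_on (closure \<Omega>) \<phi>"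
  using assms by (auto simp: C1b_closure_def)

lemma bounded_mult_image:
  fixes u v :: "'a \<Rightarrow> real"
  assumes "bounded (u ` A)" "bounded (v ` A)"
  shows "bounded ((\<lambda>x. u x * v x) ` A)"
proof -
  obtain C D where C: "\<And>x. x \<in> A \<Longrightarrow> \<bar>u x\<bar> \<le> C" and D: "\<And>x. x \<in> A \<Longrightarrow> \<bar>v x\<bar> \<le> D"
    using assms by (auto simp: bounded_iff)
  have "\<bar>u x * v x\<bar> \<le> C * D" if "x \<in> A" for x
    unfolding abs_mult using C[OF that] D[OF that] by (intro mult_mono) auto
  then show ?thesis
    by (auto simp: bounded_iff)
qed

text \<open>The product keeps the zeros of \<phi>, so it satisfies the same boundary condition, and
  its bounded support makes it eligible for \<open>trace_functions\<close>.\<close>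

lemma cutoff_mult_C1b_closure:
  fixes \<phi> :: "'a::euclidean_space \<Rightarrow> real"
  assumes \<phi>: "\<phi> \<in> C1b_closure \<Omega>"
  shows "(\<lambda>x. cutoff n x * \<phi> x) \<in> C1b_closure \<Omega>" "bounded {x \<in> \<Omega>. cutoff n x * \<phi> x \<noteq> 0}"
proof -
  note reg = C1b_closure_regular[OF \<phi>]
  have cont: "continuous_on \<Omega> \<phi>"
    by (rule Ck_on_1_continuous[OF reg(1)])
  have diff: "\<phi> differentiable (at x)" if "x \<in> \<Omega>" for x
    using reg(1) that by simp
  have bc: "bounded (cutoff n ` \<Omega>)"
    unfolding bounded_iff
  proof (intro exI ballI)
    fix y assume "y \<in> cutoff n ` \<Omega>"
    then obtain x :: 'a where "y = cutoff n x"
      by blast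
    then show "norm y \<le> exp 1"
      using cutoff_bounds[of n x] by simp
  qed
  have pd: "partial_deriv (\<lambda>x. cutoff n x * \<phi> x) b x = cutoff n x * partial_deriv \<phi> b x + (grad_cutoff n x \<bullet> b) * \<phi> x"
    if "x \<in> \<Omega>" for b x
    by (rule grad_cutoff_mult(1)[OF diff[OF that]])
  have bg: "bounded ((\<lambda>x. grad_cutoff n x \<bullet> b) ` \<Omega>)" if "b \<in> Basis" for b
    unfolding bounded_iff
  proof (intro exI ballI)
    fix y assume "y \<in> (\<lambda>x. grad_cutoff n x \<bullet> b) ` \<Omega>"
    then obtain x :: 'a where y: "y = grad_cutoff n x \<bullet> b"
      by blast
    show "norm y \<le> 4 * exp 1 / real (Suc n)"
      unfolding y real_norm_def by (rule order_trans[OF Basis_le_norm[OF that] norm_grad_cutoff])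
  qed
  show "(\<lambda>x. cutoff n x * \<phi> x) \<in> C1b_closure \<Omega>"
    unfolding C1b_closure_def
  proof (intro CollectI conjI ballI)
    show "Ck_on 1 \<Omega> (\<lambda>x. cutoff n x * \<phi> x)"
      unfolding One_nat_def Ck_on.simps
    proof (intro conjI ballI)
      fix x assume "x \<in> \<Omega>"
      then show "(\<lambda>x. cutoff n x * \<phi> x) differentiable (at x)"
        by (intro differentiable_mult differentiableI[OF cutoff_has_derivative] diff)
    next
      fix b :: 'a assume b: "b \<in> Basis"
      have "continuous_on \<Omega> (partial_deriv \<phi> b)"
        using reg(1) b by simp
      then have "continuous_on \<Omega> (\<lambda>x. cutoff n x * partial_deriv \<phi> b x + (grad_cutoff n x \<bullet> b) * \<phi> x)"
        by (intro continuous_on_add continuous_on_mult continuous_on_inner continuous_on_const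
            continuous_on_cutoff cont)
      then show "continuous_on \<Omega> (partial_deriv (\<lambda>x. cutoff n x * \<phi> x) b)"
        using pd by (subst continuous_on_cong[OF refl]) auto
    qed
    show "bounded ((\<lambda>x. cutoff n x * \<phi> x) ` \<Omega>)"
      by (rule bounded_mult_image[OF bc reg(2)])
    show "continuous_on (closure \<Omega>) (\<lambda>x. cutoff n x * \<phi> x)"
      by (rule continuous_on_mult[OF continuous_on_cutoff(1) reg(4)])
    fix b :: 'a assume b: "b \<in> Basis"
    have eq: "partial_deriv (\<lambda>x. cutoff n x * \<phi> x) b ` \<Omega> =
        (\<lambda>x. cutoff n x * partial_deriv \<phi> b x + (grad_cutoff n x \<bullet> b) * \<phi> x) ` \<Omega>"
      using pd by (intro image_cong) auto
    show "bounded (partial_deriv (\<lambda>x. cutoff n x * \<phi> x) b ` \<Omega>)"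
      unfolding eq
      by (rule bounded_plus_comp[OF bounded_mult_image[OF bc reg(3)[OF b]] bounded_mult_image[OF bg[OF b] reg(2)]])
  qed
  have "{x \<in> \<Omega>. cutoff n x * \<phi> x \<noteq> 0} \<subseteq> cball 0 (real (Suc n))"
  proof
    fix x assume "x \<in> {x \<in> \<Omega>. cutoff n x * \<phi> x \<noteq> 0}"
    then have "\<not> real (Suc n) \<le> norm x"
      using cutoff_eq_0(1)[of n x] by auto
    then show "x \<in> cball 0 (real (Suc n))"
      by (simp del: of_nat_Suc)
  qed
  then show "bounded {x \<in> \<Omega>. cutoff n x * \<phi> x \<noteq> 0}"
    by (rule bounded_subset[OF bounded_cball])
qed

subsection \<open>Existence of minimisers\<close>

lemma divergence_properties:
  assumes \<Omega>: "open \<Omega>" and p: "1 < p" and h: "has_divergence p \<Omega> \<mu> h"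
  shows "has_divergence p \<Omega> \<mu> (divergence p \<Omega> \<mu>)"
    "AE x in lebesgue_on \<Omega>. divergence p \<Omega> \<mu> x = h x"
proof -
  show "has_divergence p \<Omega> \<mu> (divergence p \<Omega> \<mu>)"
    unfolding divergence_def by (rule someI[of "has_divergence p \<Omega> \<mu>", OF h])
  then show "AE x in lebesgue_on \<Omega>. divergence p \<Omega> \<mu> x = h x"
    using h by (rule has_divergence_unique[OF \<Omega> p])
qed

text \<open>Only functions with bounded support are kept among the trace conditions, because for them
  \<open>\<phi> div \<mu>\<close> is always integrable; \<open>trace_of_cutoffs\<close> recovers the other ones.\<close>

definition trace_functions :: "'a::euclidean_space set \<Rightarrow> 'a set \<Rightarrow> ('a \<Rightarrow> real) set"
  where "trace_functions \<Omega> \<Gamma> = (if \<Gamma> = {} then {} else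
    {\<phi> \<in> C1b_closure \<Omega>. (\<forall>x\<in>closure (frontier \<Omega> - \<Gamma>). \<phi> x = 0) \<and> bounded {x \<in> \<Omega>. \<phi> x \<noteq> 0}})"

lemma constraint_functions_regular:
  fixes \<phi> :: "'a::euclidean_space \<Rightarrow> real"
  assumes "\<phi> \<in> test_functions \<Omega> \<union> trace_functions \<Omega> \<Gamma>"
  shows "Ck_on 1 \<Omega> \<phi>" "bounded (\<phi> ` \<Omega>)" "\<And>b. b \<in> Basis \<Longrightarrow> bounded (partial_deriv \<phi> b ` \<Omega>)"
    "bounded {x \<in> \<Omega>. \<phi> x \<noteq> 0}"
  using assms test_functions_regular[of \<phi> \<Omega>] C1b_closure_regular[of \<phi> \<Omega>]
  by (auto simp: trace_functions_def split: if_splits)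

text \<open>Dominated convergence in both integrals. Over the finite measure \<alpha> a constant
  majorises the gradients, and the term containing \<open>grad_cutoff\<close> tends to 0. Over
  \<Omega> the majorant is a multiple of \<open>\<bar>\<phi> d\<bar>\<close>, which is integrable
  precisely for those \<phi> whose trace is defined.\<close>

lemma trace_of_cutoffs:
  fixes g :: "'a::euclidean_space \<Rightarrow> 'a" and d :: "'a \<Rightarrow> real"
  assumes \<alpha>: "\<alpha> \<in> nonneg_measures \<Omega>"
    and g: "g \<in> borel_measurable \<alpha>" and ng: "\<And>x. norm (g x) \<le> 1"
    and \<phi>: "\<phi> \<in> C1b_closure \<Omega>" and int: "integrable (lebesgue_on \<Omega>) (\<lambda>x. \<phi> x * d x)"
    and zero: "\<And>n. (\<integral>x. grad (\<lambda>x. cutoff n x * \<phi> x) x \<bullet> g x \<partial>\<alpha>) +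
      (\<integral>x. cutoff n x * \<phi> x * d x \<partial>lebesgue_on \<Omega>) = 0"
    and \<Omega>: "open \<Omega>"
  shows "(\<integral>x. grad \<phi> x \<bullet> g x \<partial>\<alpha>) + (\<integral>x. \<phi> x * d x \<partial>lebesgue_on \<Omega>) = 0"
proof -
  note S = nonneg_measuresD[OF \<alpha>]
  interpret finite_measure \<alpha> by (rule S)
  note reg = C1b_closure_regular[OF \<phi>]
  have diff: "\<phi> differentiable (at x)" if "x \<in> \<Omega>" for x
    using reg(1) that by simp
  obtain C where C: "\<And>x. x \<in> \<Omega> \<Longrightarrow> norm (grad \<phi> x) \<le> C"
    using grad_measurable_bounded(2)[OF \<alpha> reg(1,3)] by blast
  obtain D where D: "\<And>x. x \<in> \<Omega> \<Longrightarrow> \<bar>\<phi> x\<bar> \<le> D"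
    using reg(2) by (auto simp: bounded_iff)
  have "(\<lambda>n. \<integral>x. grad (\<lambda>x. cutoff n x * \<phi> x) x \<bullet> g x \<partial>\<alpha>) \<longlonglongrightarrow> (\<integral>x. grad \<phi> x \<bullet> g x \<partial>\<alpha>)"
  proof (rule integral_dominated_convergence[where w = "\<lambda>_. exp 1 * C + D * (4 * exp 1)"])
    show "(\<lambda>x. grad \<phi> x \<bullet> g x) \<in> borel_measurable \<alpha>"
      using g grad_measurable_bounded(1)[OF \<alpha> reg(1,3)] by measurable
    show "(\<lambda>x. grad (\<lambda>x. cutoff n x * \<phi> x) x \<bullet> g x) \<in> borel_measurable \<alpha>" for n
      using g grad_measurable_bounded(1)[OF \<alpha> C1b_closure_regular(1,3)[OF cutoff_mult_C1b_closure(1)[OF \<phi>, of n]]]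
      by measurable
    show "AE x in \<alpha>. (\<lambda>n. grad (\<lambda>x. cutoff n x * \<phi> x) x \<bullet> g x) \<longlonglongrightarrow> grad \<phi> x \<bullet> g x"
    proof (rule AE_I2)
      fix x assume "x \<in> space \<alpha>"
      then have x: "x \<in> \<Omega>"
        using S(3) by simp
      have "(\<lambda>n. (cutoff n x *\<^sub>R grad \<phi> x + \<phi> x *\<^sub>R grad_cutoff n x) \<bullet> g x) \<longlonglongrightarrow> (1 *\<^sub>R grad \<phi> x + \<phi> x *\<^sub>R 0) \<bullet> g x"
        by (intro tendsto_intros cutoff_tendsto)
      then show "(\<lambda>n. grad (\<lambda>x. cutoff n x * \<phi> x) x \<bullet> g x) \<longlonglongrightarrow> grad \<phi> x \<bullet> g x"
        by (simp add: grad_cutoff_mult(2)[OF diff[OF x]])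
    qed
    show "AE x in \<alpha>. norm (grad (\<lambda>x. cutoff n x * \<phi> x) x \<bullet> g x) \<le> exp 1 * C + D * (4 * exp 1)" for n
    proof (rule AE_I2)
      fix x assume "x \<in> space \<alpha>"
      then have x: "x \<in> \<Omega>"
        using S(3) by simp
      have gc: "norm (grad_cutoff n x) \<le> 4 * exp 1"
      proof -
        have "4 * exp 1 / real (Suc n) \<le> 4 * exp 1 / 1"
          by (intro divide_left_mono) auto
        then show ?thesis
          using norm_grad_cutoff[of n x] by simp
      qed
      have "norm (grad (\<lambda>x. cutoff n x * \<phi> x) x) \<le> norm (cutoff n x *\<^sub>R grad \<phi> x) + norm (\<phi> x *\<^sub>R grad_cutoff n x)"
        unfolding grad_cutoff_mult(2)[OF diff[OF x]] by (rule norm_triangle_ineq)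
      also have "\<dots> \<le> exp 1 * C + D * (4 * exp 1)"
        unfolding norm_scaleR
        using cutoff_bounds[of n x] C[OF x] D[OF x] gc by (intro add_mono mult_mono) auto
      finally have "norm (grad (\<lambda>x. cutoff n x * \<phi> x) x) \<le> exp 1 * C + D * (4 * exp 1)" .
      moreover have "\<bar>grad (\<lambda>x. cutoff n x * \<phi> x) x \<bullet> g x\<bar> \<le> norm (grad (\<lambda>x. cutoff n x * \<phi> x) x) * 1"
        using ng[of x] by (intro order_trans[OF Cauchy_Schwarz_ineq2] mult_left_mono) auto
      ultimately show "norm (grad (\<lambda>x. cutoff n x * \<phi> x) x \<bullet> g x) \<le> exp 1 * C + D * (4 * exp 1)"
        by simp
    qed
  qed simp
  moreover have "(\<lambda>n. \<integral>x. cutoff n x * \<phi> x * d x \<partial>lebesgue_on \<Omega>) \<longlonglongrightarrow> (\<integral>x. \<phi> x * d x \<partial>lebesgue_on \<Omega>)"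
  proof (rule integral_dominated_convergence[where w = "\<lambda>x. exp 1 * \<bar>\<phi> x * d x\<bar>"])
    show "(\<lambda>x. cutoff n x * \<phi> x * d x) \<in> borel_measurable (lebesgue_on \<Omega>)" for n
    proof -
      have "cutoff n \<in> borel_measurable (lebesgue_on \<Omega>)"
        using \<Omega> by (intro continuous_imp_measurable_on_sets_lebesgue continuous_on_cutoff) auto
      then have "(\<lambda>x. cutoff n x * (\<phi> x * d x)) \<in> borel_measurable (lebesgue_on \<Omega>)"
        by (rule borel_measurable_times[OF _ borel_measurable_integrable[OF int]])
      then show ?thesis
        by (simp add: mult.assoc)
    qed
    show "AE x in lebesgue_on \<Omega>. (\<lambda>n. cutoff n x * \<phi> x * d x) \<longlonglongrightarrow> \<phi> x * d x"
    proof (rule AE_I2)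
      fix x
      have "(\<lambda>n. cutoff n x * \<phi> x * d x) \<longlonglongrightarrow> 1 * \<phi> x * d x"
        by (intro tendsto_intros cutoff_tendsto)
      then show "(\<lambda>n. cutoff n x * \<phi> x * d x) \<longlonglongrightarrow> \<phi> x * d x"
        by simp
    qed
    show "AE x in lebesgue_on \<Omega>. norm (cutoff n x * \<phi> x * d x) \<le> exp 1 * \<bar>\<phi> x * d x\<bar>" for n
    proof (rule AE_I2)
      fix x
      show "norm (cutoff n x * \<phi> x * d x) \<le> exp 1 * \<bar>\<phi> x * d x\<bar>"
        using mult_right_mono[OF cutoff_bounds(2)[of n x], of "\<bar>\<phi> x * d x\<bar>"] cutoff_bounds(1)[of n x]
        by (simp add: abs_mult mult.assoc)
    qed
  qed (use int in auto)
  ultimately have "(\<lambda>n. (\<integral>x. grad (\<lambda>x. cutoff n x * \<phi> x) x \<bullet> g x \<partial>\<alpha>) +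
      (\<integral>x. cutoff n x * \<phi> x * d x \<partial>lebesgue_on \<Omega>)) \<longlonglongrightarrow>
      (\<integral>x. grad \<phi> x \<bullet> g x \<partial>\<alpha>) + (\<integral>x. \<phi> x * d x \<partial>lebesgue_on \<Omega>)"
    by (rule tendsto_add)
  then show ?thesis
    by (simp add: zero LIMSEQ_const_iff)
qed

theorem theorem5p1:
  fixes \<Omega> \<Gamma> :: "'a::euclidean_space set"
    and p :: real
    and \<alpha> :: "'a measure"
    and f \<beta> :: "'a \<Rightarrow> real"
  assumes "open \<Omega>"
    and "1 < p"
    and "\<alpha> \<in> nonneg_measures \<Omega>"
    and "f \<in> Lp p \<Omega>"
    and "continuous_on \<Omega> \<beta>" and "bounded (\<beta> ` \<Omega>)" and "\<forall>x\<in>\<Omega>. 0 \<le> \<beta> x"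
    and "\<Gamma> \<subseteq> frontier \<Omega>"
  shows "\<exists>\<mu> \<in> admissible p \<Omega> \<Gamma> \<alpha>. \<forall>\<nu> \<in> admissible p \<Omega> \<Gamma> \<alpha>.
    objective p \<Omega> f \<beta> \<mu> \<le> objective p \<Omega> f \<beta> \<nu>"
proof -
  note \<Omega> = assms(1) and p = assms(2) and \<alpha> = assms(3)
  note S = nonneg_measuresD[OF \<alpha>]
  interpret finite_measure \<alpha> by (rule S)
  let ?L = "lebesgue_on \<Omega>"
  let ?F = "test_functions \<Omega> \<union> trace_functions \<Omega> \<Gamma>"
  \<comment> \<open>One linear identity serves both kinds of functions: for test functions it says
    that \<open>h\<close> is the divergence, for trace functions that the normal trace
    vanishes.\<close>
  define T where "T = (\<lambda>\<phi>. (grad \<phi>, \<phi>)) ` ?F"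
  define K where "K = {(g :: 'a \<Rightarrow> 'a, h). g \<in> borel_measurable \<alpha> \<and> (\<forall>x. norm (g x) \<le> 1) \<and> p_integrable ?L p h \<and>
      (\<forall>(G, \<phi>)\<in>T. (\<integral>x. G x \<bullet> g x \<partial>\<alpha>) + (\<integral>x. \<phi> x * h x \<partial>?L) = 0)}"
  define J where "J = (\<lambda>(g :: 'a \<Rightarrow> 'a, h). 1 / p * (\<integral>x. \<bar>h x - f x\<bar> powr p \<partial>?L) + (\<integral>x. norm (g x) * \<beta> x \<partial>\<alpha>))"
  have K_iff: "(g, h) \<in> K \<longleftrightarrow> g \<in> borel_measurable \<alpha> \<and> (\<forall>x. norm (g x) \<le> 1) \<and> p_integrable ?L p h \<and>
      (\<forall>\<phi>\<in>?F. (\<integral>x. grad \<phi> x \<bullet> g x \<partial>\<alpha>) + (\<integral>x. \<phi> x * h x \<partial>?L) = 0)" for g h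
    by (simp add: K_def T_def)
  have \<beta>_meas[measurable]: "\<beta> \<in> borel_measurable \<alpha>"
    using borel_measurable_continuous_on_restrict[OF assms(5)] measurable_cong_sets[OF S(1) refl] by blast
  obtain B where B: "\<And>x. x \<in> \<Omega> \<Longrightarrow> \<bar>\<beta> x\<bar> \<le> B"
    using assms(6) by (auto simp: bounded_iff)
  have f: "p_integrable ?L p f"
    using assms(4) by (simp add: Lp_iff)
  note reg = constraint_functions_regular[of _ \<Omega> \<Gamma>]
  have bfs: "bounded_finite_support ?L \<phi>" if "\<phi> \<in> ?F" for \<phi>
    using reg[OF that] Ck_on_1_continuous by (intro bounded_finite_supportI[OF \<Omega>])
  have grad: "grad \<phi> \<in> borel_measurable \<alpha>" "\<exists>C. \<forall>x\<in>\<Omega>. norm (grad \<phi> x) \<le> C" if "\<phi> \<in> ?F" for \<phi>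
    using grad_measurable_bounded[OF \<alpha> reg(1,3)[OF that]] by blast+
  have "\<exists>z\<in>K. \<forall>w\<in>K. J z \<le> J w"
    unfolding K_def J_def
  proof (rule constrained_minimizer[OF S(2) p f \<beta>_meas])
    show "0 \<le> \<beta> x \<and> \<beta> x \<le> B" if "x \<in> space \<alpha>" for x
      using assms(7) B[of x] that S(3) by auto
    show "G \<in> borel_measurable \<alpha> \<and> (\<exists>C. \<forall>x\<in>space \<alpha>. norm (G x) \<le> C) \<and> bounded_finite_support ?L \<phi>"
      if "(G, \<phi>) \<in> T" for G \<phi>
      using that bfs grad S(3) by (auto simp: T_def)
  qed
  then obtain g h where gh: "(g, h) \<in> K" and min: "\<And>w. w \<in> K \<Longrightarrow> J (g, h) \<le> J w"
    by (metis surj_pair)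
  have int_g: "integrable \<alpha> u" if "u \<in> borel_measurable \<alpha>" "\<And>x. norm (u x) \<le> 1" for u :: "'a \<Rightarrow> 'a"
    using that by (intro integrable_const_bound[where B = 1]) auto
  have vi: "vector_integral \<Omega> (density_vector \<alpha> u) (grad \<phi>) = (\<integral>x. grad \<phi> x \<bullet> u x \<partial>\<alpha>)"
    if u: "integrable \<alpha> u" and C1: "Ck_on 1 \<Omega> \<phi>" "\<And>b. b \<in> Basis \<Longrightarrow> bounded (partial_deriv \<phi> b ` \<Omega>)" for u \<phi>
  proof -
    obtain C where "\<And>x. x \<in> \<Omega> \<Longrightarrow> norm (grad \<phi> x) \<le> C"
      using grad_measurable_bounded(2)[OF \<alpha> C1] by blast
    then show ?thesis
      using vector_integral_density[OF \<alpha> u grad_measurable_bounded(1)[OF \<alpha> C1]] by blast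
  qed
  have obj: "objective p \<Omega> f \<beta> (density_vector \<alpha> u) = J (u, divergence p \<Omega> (density_vector \<alpha> u))"
    if "integrable \<alpha> u" for u
    using that unfolding objective_def J_def split total_variation_density[OF \<alpha> that]
    by (subst integral_density) auto
  define \<mu> where "\<mu> = density_vector \<alpha> g"
  \<comment> \<open>The objective and the trace are evaluated at this chosen representative, which
    agrees with \<open>h\<close> only almost everywhere; each identity for \<open>h\<close> has to
    be carried over.\<close>
  define d where "d = divergence p \<Omega> \<mu>"
  have g: "g \<in> borel_measurable \<alpha>" "\<And>x. norm (g x) \<le> 1" and h: "p_integrable ?L p h"
    and zero: "\<And>\<phi>. \<phi> \<in> ?F \<Longrightarrow> (\<integral>x. grad \<phi> x \<bullet> g x \<partial>\<alpha>) + (\<integral>x. \<phi> x * h x \<partial>?L) = 0"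
    using gh by (auto simp: K_iff)
  have ig: "integrable \<alpha> g"
    using g by (rule int_g)
  have hd: "has_divergence p \<Omega> \<mu> h"
    unfolding has_divergence_def
  proof (intro conjI ballI)
    show "h \<in> Lp p \<Omega>"
      using h by (simp add: Lp_iff)
    fix \<phi> assume \<phi>: "\<phi> \<in> test_functions \<Omega>"
    then show "vector_integral \<Omega> \<mu> (grad \<phi>) = - (\<integral>x. \<phi> x * h x \<partial>?L)"
      using zero[of \<phi>] vi[OF ig reg(1,3)] by (simp add: \<mu>_def eq_neg_iff_add_eq_0)
  qed
  have d_meas: "d \<in> borel_measurable ?L"
    using divergence_properties(1)[OF \<Omega> p hd] by (simp add: d_def has_divergence_def Lp_def)
  have h_meas: "h \<in> borel_measurable ?L"
    using h by (simp add: p_integrable_def)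
  have dh: "AE x in ?L. d x = h x"
    using divergence_properties(2)[OF \<Omega> p hd] by (simp add: d_def)
  have "\<mu> \<in> admissible p \<Omega> \<Gamma> \<alpha>"
  proof -
    have "\<mu> \<in> Mp_div p \<Omega>"
      using hd density_vector_in_vector_measures[OF \<alpha> ig] by (auto simp: Mp_div_def \<mu>_def)
    moreover have "normal_trace p \<Omega> \<phi> \<mu> = 0"
      if "\<Gamma> \<noteq> {}" and \<phi>: "\<phi> \<in> C1b_closure \<Omega>" and van: "\<forall>x\<in>closure (frontier \<Omega> - \<Gamma>). \<phi> x = 0"
        and int: "integrable ?L (\<lambda>x. \<phi> x * divergence p \<Omega> \<mu> x)" for \<phi>
    proof -
      have "(\<integral>x. grad (\<lambda>x. cutoff n x * \<phi> x) x \<bullet> g x \<partial>\<alpha>) + (\<integral>x. cutoff n x * \<phi> x * d x \<partial>?L) = 0" for n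
      proof -
        \<comment> \<open>The constraints in \<open>K\<close> apply to the cutoff product although
          they may not apply to \<phi> itself.\<close>
        have F: "(\<lambda>x. cutoff n x * \<phi> x) \<in> ?F"
          using cutoff_mult_C1b_closure[OF \<phi>, of n] van \<open>\<Gamma> \<noteq> {}\<close> by (simp add: trace_functions_def)
        have m: "(\<lambda>x. cutoff n x * \<phi> x) \<in> borel_measurable ?L"
          using bfs[OF F] by (simp add: bounded_finite_support_def)
        have "AE x in ?L. cutoff n x * \<phi> x * d x = cutoff n x * \<phi> x * h x"
          using dh by eventually_elim simp
        then have "(\<integral>x. cutoff n x * \<phi> x * d x \<partial>?L) = (\<integral>x. cutoff n x * \<phi> x * h x \<partial>?L)"
          by (intro integral_cong_AE borel_measurable_times[OF m d_meas] borel_measurable_times[OF m h_meas])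
        then show ?thesis
          using zero[OF F] by simp
      qed
      then have "(\<integral>x. grad \<phi> x \<bullet> g x \<partial>\<alpha>) + (\<integral>x. \<phi> x * d x \<partial>?L) = 0"
        using int by (intro trace_of_cutoffs[OF \<alpha> g \<phi>]) (auto simp: d_def \<Omega>)
      then show ?thesis
        using vi[OF ig C1b_closure_regular(1,3)[OF \<phi>]] by (simp add: normal_trace_def d_def \<mu>_def)
    qed
    moreover have "measure_le_on \<Omega> (total_variation \<Omega> \<mu>) \<alpha>"
      unfolding \<mu>_def total_variation_density[OF \<alpha> ig] density_norm_le_iff[OF \<alpha> ig] using g(2) by simp
    ultimately show ?thesis
      by (auto simp: admissible_def Mp_div_trace_def)
  qed
  moreover have "objective p \<Omega> f \<beta> \<mu> = J (g, h)"
  proof -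
    have "(\<integral>x. \<bar>d x - f x\<bar> powr p \<partial>?L) = (\<integral>x. \<bar>h x - f x\<bar> powr p \<partial>?L)"
    proof (rule integral_cong_AE)
      have [measurable]: "d \<in> borel_measurable ?L" "h \<in> borel_measurable ?L" "f \<in> borel_measurable ?L"
        using d_meas h_meas f by (auto simp: p_integrable_def)
      show "(\<lambda>x. \<bar>d x - f x\<bar> powr p) \<in> borel_measurable ?L" "(\<lambda>x. \<bar>h x - f x\<bar> powr p) \<in> borel_measurable ?L"
        by measurable
    qed (use dh in \<open>auto elim!: eventually_mono\<close>)
    then show ?thesis
      using obj[OF ig] by (simp add: \<mu>_def d_def J_def)
  qed
  moreover have "J (g, h) \<le> objective p \<Omega> f \<beta> \<nu>" if \<nu>: "\<nu> \<in> admissible p \<Omega> \<Gamma> \<alpha>" for \<nu>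
  proof -
    have \<nu>_vm: "\<nu> \<in> vector_measures \<Omega>" and \<nu>_le: "measure_le_on \<Omega> (total_variation \<Omega> \<nu>) \<alpha>"
      and \<nu>_div: "\<exists>k. has_divergence p \<Omega> \<nu> k"
      and \<nu>_tr: "\<And>\<phi>. \<phi> \<in> trace_functions \<Omega> \<Gamma> \<Longrightarrow>
        integrable ?L (\<lambda>x. \<phi> x * divergence p \<Omega> \<nu> x) \<Longrightarrow> normal_trace p \<Omega> \<phi> \<nu> = 0"
      using \<nu> by (auto simp: admissible_def Mp_div_trace_def Mp_div_def trace_functions_def split: if_splits)
    obtain w where iw: "integrable \<alpha> w" and \<nu>_w: "\<nu> = density_vector \<alpha> w"
      by (rule vector_measure_density[OF \<alpha> \<nu>_vm \<nu>_le])
    have w_le: "AE x in \<alpha>. norm (w x) \<le> 1"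
      using \<nu>_le unfolding \<nu>_w total_variation_density[OF \<alpha> iw] density_norm_le_iff[OF \<alpha> iw] .
    \<comment> \<open>The density of a competitor is bounded by 1 only almost everywhere, whereas
      \<open>K\<close> asks for the bound at every point; changing it on a null set leaves the
      measure as it is.\<close>
    define u where "u = (\<lambda>x. if norm (w x) \<le> 1 then w x else 0)"
    have [measurable]: "w \<in> borel_measurable \<alpha>"
      using iw by auto
    have u_meas[measurable]: "u \<in> borel_measurable \<alpha>"
      unfolding u_def by measurable
    have u_le: "norm (u x) \<le> 1" for x
      by (simp add: u_def)
    have iu: "integrable \<alpha> u"
      using u_meas u_le by (rule int_g)
    have \<nu>_u: "\<nu> = density_vector \<alpha> u"
    proof
      fix A
      have "(LINT x:A|\<alpha>. w x) = (LINT x:A|\<alpha>. u x)" if "A \<in> sets \<alpha>"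
        unfolding set_lebesgue_integral_def
        using w_le that by (intro integral_cong_AE) (auto simp: u_def elim!: eventually_mono)
      then show "\<nu> A = density_vector \<alpha> u A"
        by (simp add: \<nu>_w density_vector_def)
    qed
    define k where "k = divergence p \<Omega> \<nu>"
    have k: "has_divergence p \<Omega> \<nu> k"
      using \<nu>_div divergence_properties(1)[OF \<Omega> p] by (auto simp: k_def)
    then have k_int: "p_integrable ?L p k"
      by (simp add: has_divergence_def Lp_iff)
    have "(\<integral>x. grad \<phi> x \<bullet> u x \<partial>\<alpha>) + (\<integral>x. \<phi> x * k x \<partial>?L) = 0" if \<phi>: "\<phi> \<in> ?F" for \<phi>
    proof -
      have vi': "vector_integral \<Omega> \<nu> (grad \<phi>) = (\<integral>x. grad \<phi> x \<bullet> u x \<partial>\<alpha>)"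
        unfolding \<nu>_u by (rule vi[OF iu reg(1,3)[OF \<phi>]])
      show ?thesis
      proof (cases "\<phi> \<in> test_functions \<Omega>")
        case True
        then show ?thesis
          using k vi' by (simp add: has_divergence_def)
      next
        case False
        \<comment> \<open>The trace condition of an admissible measure is conditional on this
          integrability, which bounded support guarantees.\<close>
        moreover have "integrable ?L (\<lambda>x. \<phi> x * k x)"
          using pairing_bound[OF bfs[OF \<phi>] p] k_int by metis
        ultimately show ?thesis
          using \<phi> \<nu>_tr[of \<phi>] vi' by (simp add: normal_trace_def k_def)
      qed
    qed
    then have "(u, k) \<in> K"
      using u_meas u_le k_int by (simp add: K_iff)
    then show ?thesis
      using min[of "(u, k)"] obj[OF iu] by (simp add: \<nu>_u k_def)
  qed
  ultimately show ?thesis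
    by (intro bexI[of _ \<mu>]) auto
qed

end
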